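(* Let grid sizes $h_d>0$, $d\in\{x,y,z\}$, be given, and use the Gaussian window $\widehat W=\widehat W_{\mathrm{GS}}$ with shape parameter $\mathcal S>0$ and half-width support $H_d$ in dimension $d$, so that the number of grid points within the support of the window is $\mathcal P_d=2H_d/h_d+1$. Assume that $$H_d^2/\mathcal S<s_\ell^2\le s_m^2,\qquad \ell=0,1,\dots,m,\quad d\in\{x,y,z\},$$ and put $\mu_d^\ell=s_\ell^2-H_d^2/\mathcal S$. Then the padding error and the gathering error of the mid-range Fourier solver satisfy $$\|\mathcal E^{\mathrm{padd}}_{\mathrm{mid}}(\boldsymbol r_i)\|_\infty=O\left(\operatorname{erfc}\left[\frac{\lambda_z(L_z+\delta_z)}{2\sqrt{\mu_z^m}}\right]\right)$$ and $$\left\|\mathcal E^{\mathrm{gath}}_{\mathrm{mid}}(\boldsymbol r_i)\right\|_\infty=O\left(\max_{d\in\{x,y,z\}}\left\{\sum_{\ell=0}^m w_\ell\,e^{-\frac{\pi^2\mu_d^\ell(\mathcal P_d-1)^2}{4s_\ell^2\mathcal S}}\right\}+\operatorname{erfc}\left(\sqrt{\mathcal S}\right)\right).$$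
   Context: System: charges $q_1,\dots,q_N\in\mathbb R$ with $\sum_i q_i=0$ at positions $\boldsymbol r_i=(\dot{\boldsymbol r}_i,z_i)\in[-L_x/2,L_x/2]\times[-L_y/2,L_y/2]\times[-L_z/2,L_z/2]$, periodic in $x,y$ and free in $z$. Write $\mathcal R^2=[-L_x/2,L_x/2]\times[-L_y/2,L_y/2]$, $\boldsymbol k=(\dot{\boldsymbol k},k_z)$, $k=|\boldsymbol k|$, $\boldsymbol r_{ij}=\boldsymbol r_i-\boldsymbol r_j$, $q_{\max}=\max_j|q_j|$, $\circ$ for the componentwise product, $\|\cdot\|_\infty$ for the maximum over $i$. Let $\mathcal K^2=\frac{2\pi}{L_x}\mathbb Z\times\frac{2\pi}{L_y}\mathbb Z$ and $\mathcal L[g(\boldsymbol k)]=\frac{1}{2\pi L_xL_y}\sum_{\dot{\boldsymbol k}\in\mathcal K^2}\int_{\mathbb R}g([\dot{\boldsymbol k},k_z])\,dk_z$. Sum-of-Gaussians (SOG) parameters: $b>1$, $\sigma>0$, $s_\ell=\sqrt2\,b^\ell\sigma$, $w_\ell=(\pi/2)^{-1/2}b^{-\ell}\sigma^{-1}\log b$ for $\ell\ge1$ and $w_0=\omega(\pi/2)^{-1/2}\sigma^{-1}\log b$ with fixed $\omega>0$. The mid-range Gaussians are those with $0\le\ell\le m$, where $s_m\le\eta L_z<s_{m+1}$ for a fixed $\eta>0$, and $\widehat\tau^{\mathrm{mid}}_{\mathrm{SOG}}(\boldsymbol k)=\frac{\sqrt\pi}{4}\sum_{\ell=0}^m w_\ell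 s_\ell^3k^2e^{-s_\ell^2k^2/4}$. The mid-range potential is $\Phi^{\mathrm{mid}}_{\mathrm{SOG}}(\boldsymbol r_i)=4\pi\sum_jq_j\mathcal L\left[\widehat\tau^{\mathrm{mid}}_{\mathrm{SOG}}(\boldsymbol k)k^{-2}e^{\mathrm i\boldsymbol k\cdot\boldsymbol r_{ij}}\right]$. Window: in each dimension $W_{\mathrm{GS}}(x)=e^{-\mathcal S(x/H)^2}$ for $|x|\le H$ and $0$ otherwise, and $\widehat W_{\mathrm{GS}}(k)=\sqrt{\pi/\mathcal S}\,H\,e^{-k^2H^2/(4\mathcal S)}$ (the Fourier transform of the untruncated Gaussian). The multi-dimensional $W,\widehat W$ are products over the dimensions with $H=H_d$. $\mathcal P_d$ is odd. A subscript $(\cdot)_*$ denotes periodization in the relevant direction (periods $L_x,L_y$, and $L_z^*$ when applied in $z$). Scaled grid function: $S_{\mathrm{scal}}$ is the inverse Fourier transform $S_{\mathrm{scal}}(\boldsymbol r)=\mathcal L[\widehat S_{\mathrm{scal}}(\boldsymbol k)e^{\mathrm i\boldsymbol k\cdot\boldsymbol r}]$ of $$\widehat S_{\mathrm{scal}}(\boldsymbol k)=\frac{\widehat\tau^{\mathrm{mid}}_{\mathrm{SOG}}(\boldsymbol k)}{k^2|\widehat W(\boldsymbol k)|^2}\sum_{j=1}^Nq_j\widehat W(\boldsymbol k)e^{-\mathrm i\boldsymbol k\cdot\boldsymbol r_j}.$$ The solver evaluates $\Phi^{\mathrm{mid}}_{\mathrm{SOG}}$ through $$\Phi^{\mathrm{mid}}_{\mathrm{SOG}}(\boldsymbol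 r_i)=4\pi\int_{\mathbb R}\int_{\mathcal R^2}S_{\mathrm{scal}}([\dot{\boldsymbol r},z])W(\dot{\boldsymbol r}_i-\dot{\boldsymbol r})_*W(z_i-z)\,d\dot{\boldsymbol r}\,dz .\qquad(\mathrm A)$$ Padding: the box is extended in $z$ to length $L_z^*=\lambda_z(L_z+\delta_z)$ with $\delta_z\ge2H_z$ and zero-padding factor $\lambda_z\ge1$. $\mathcal E^{\mathrm{padd}}_{\mathrm{mid}}(\boldsymbol r_i)$ is the difference between the right-hand side of (A) and $$4\pi\int_{-L_z^*/2}^{L_z^*/2}\int_{\mathcal R^2}S_{\mathrm{scal}}([\dot{\boldsymbol r},z])W(\dot{\boldsymbol r}_i-\dot{\boldsymbol r})_*W(z_i-z)_*\,d\dot{\boldsymbol r}\,dz.$$ Gathering: $\mathcal E^{\mathrm{gath}}_{\mathrm{mid}}(\boldsymbol r_i)=\Phi^{\mathrm{mid}}_{\mathrm{SOG}}(\boldsymbol r_i)-\mathcal T_{\boldsymbol{\mathcal P}}(\boldsymbol r_i)$, the error of the trapezoidal rule combined with truncation of the window support, where $$\mathcal T_{\boldsymbol{\mathcal P}}(\boldsymbol r_i)=4\pi V_h\sum_{\boldsymbol{\mathcal N}}S_{\mathrm{scal}}\left(\overline{\boldsymbol r}_i+\boldsymbol{\mathcal N}\circ\boldsymbol h\right)W\left(\boldsymbol r_i-\overline{\boldsymbol r}_i-\boldsymbol{\mathcal N}\circ\boldsymbol h\right)_*,$$ $\boldsymbol h=(h_x,h_y,h_z)$, $V_h=h_xh_yh_z$,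 $\overline{\boldsymbol r}_i$ is the point of the uniform grid of mesh $\boldsymbol h$ nearest to $\boldsymbol r_i$, and $\boldsymbol{\mathcal N}$ ranges over integer vectors with $|\mathcal N_d|\le(\mathcal P_d-1)/2$. Debye--H\"uckel (DH) assumption: there is a constant $C$ such that the charge sums entering the error, of the form $\sum_jq_je^{\mathrm i\boldsymbol k\cdot\boldsymbol r_{ij}}g_j$ with $|g_j|\le1$, are bounded in absolute value by $Cq_{\max}$ for all $i$ and $\boldsymbol k$. Standing approximation: in error estimates $\mathcal L[f]$ is replaced by $(2\pi)^{-3}\int_{\mathbb R^3}f(\boldsymbol k)\,d\boldsymbol k$. The $O(\cdot)$ refers to the regime where $\mathcal S$ and the exponents $\pi^2\mu_d^\ell(\mathcal P_d-1)^2/(4s_\ell^2\mathcal S)$ are bounded below by a positive constant (large in practice). The implied constants may depend on $C$, $q_{\max}$, the $w_\ell,s_\ell$ and positive lower bounds for the $\mu_d^\ell$; in the first estimate also on $\mathcal S$ and $H_x,H_y,H_z$. $\operatorname{erfc}$ is the complementary error function.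
   Formalization: The gathering estimate additionally assumes 2H_x ≤ L_x and 2H_y ≤ L_y (window support within one period); otherwise images of the periodized window are counted within the gathering sum and the error need not tend to 0 as S and P_d grow, although the stated bound does. *)

theory Defs
  imports "HOL-Analysis.Analysis"
begin

text \<open>
  Dimensions x, y, z are the indices 1, 2, 3 of the type \<open>real^3\<close>; particles are indexed
  by \<open>{1..N}\<close>. The sequences \<open>s\<close> and \<open>w\<close> of Gaussian bandwidths and weights are passed as
  arguments; their closed forms are hypotheses of the theorem.
\<close>

definition erfc :: "real \<Rightarrow> real" where
  "erfc x = 2 / sqrt pi * (LINT t:{x..}|lborel. exp (- t\<^sup>2))"

text \<open>
  The operator \<open>\<L>\<close> of the doubly periodic geometry, and the whole-space integral that replaces
  it in error estimates. The potential and the grid function below take the operator as their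
  argument \<open>\<L>\<close>, so the replacement is the instantiation \<open>\<L> = whole_space_op\<close>.
\<close>

definition quasi2d_op :: "real \<Rightarrow> real \<Rightarrow> (real^3 \<Rightarrow> complex) \<Rightarrow> complex" where
  "quasi2d_op Lx Ly g = complex_of_real (1 / (2 * pi * Lx * Ly)) *
     (\<Sum>\<^sub>\<infinity>(a, b)\<in>(UNIV :: (int \<times> int) set).
        LINT kz|lborel. g (vector [2 * pi / Lx * of_int a, 2 * pi / Ly * of_int b, kz]))"

definition whole_space_op :: "(real^3 \<Rightarrow> complex) \<Rightarrow> complex" where
  "whole_space_op g = complex_of_real (1 / (2 * pi) ^ 3) * (LINT k|lborel. g k)"

record solver =
  num     :: nat                  \<comment> \<open>number \<open>N\<close> of charges\<close>
  charge  :: "nat \<Rightarrow> real"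
  pos     :: "nat \<Rightarrow> real^3"
  box     :: "real^3"             \<comment> \<open>\<open>(L_x, L_y, L_z)\<close>\<close>
  eta     :: real
  shape   :: real                 \<comment> \<open>the shape parameter \<open>\<S>\<close>\<close>
  halfw   :: "real^3"             \<comment> \<open>the half-width supports \<open>H_d\<close>\<close>
  mesh    :: "real^3"             \<comment> \<open>the grid sizes \<open>h_d\<close>\<close>
  npts    :: "3 \<Rightarrow> nat"          \<comment> \<open>\<open>\<P>_d\<close>\<close>
  padlen  :: real                 \<comment> \<open>\<open>\<delta>_z\<close>\<close>
  padfac  :: real                 \<comment> \<open>\<open>\<lambda>_z\<close>\<close>
  gridpt  :: "nat \<Rightarrow> real^3"     \<comment> \<open>the grid point nearest to the \<open>i\<close>-th particle\<close>

definition q_max :: "solver \<Rightarrow> real" where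
  "q_max V = (MAX j\<in>{1..num V}. \<bar>charge V j\<bar>)"

definition max_norm :: "solver \<Rightarrow> (nat \<Rightarrow> complex) \<Rightarrow> real" where
  "max_norm V E = (MAX i\<in>{1..num V}. cmod (E i))"

definition Lz_ext :: "solver \<Rightarrow> real" where
  "Lz_ext V = padfac V * (box V $ 3 + padlen V)"

definition periods :: "solver \<Rightarrow> real^3" where
  "periods V = vector [box V $ 1, box V $ 2, Lz_ext V]"

definition mu :: "(nat \<Rightarrow> real) \<Rightarrow> solver \<Rightarrow> nat \<Rightarrow> 3 \<Rightarrow> real" where
  "mu s V l d = (s l)\<^sup>2 - (halfw V $ d)\<^sup>2 / shape V"

definition tau_mid :: "(nat \<Rightarrow> real) \<Rightarrow> (nat \<Rightarrow> real) \<Rightarrow> nat \<Rightarrow> real^3 \<Rightarrow> real" where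
  "tau_mid w s m k =
     sqrt pi / 4 * (\<Sum>l\<le>m. w l * (s l) ^ 3 * (norm k)\<^sup>2 * exp (- (s l)\<^sup>2 * (norm k)\<^sup>2 / 4))"

definition W_GS :: "real \<Rightarrow> real \<Rightarrow> real \<Rightarrow> real" where
  "W_GS S H x = (if \<bar>x\<bar> \<le> H then exp (- S * (x / H)\<^sup>2) else 0)"

definition W_GS_hat :: "real \<Rightarrow> real \<Rightarrow> real \<Rightarrow> real" where
  "W_GS_hat S H k = sqrt (pi / S) * H * exp (- k\<^sup>2 * H\<^sup>2 / (4 * S))"

definition window_hat :: "solver \<Rightarrow> real^3 \<Rightarrow> real" where
  "window_hat V k = (\<Prod>d\<in>UNIV. W_GS_hat (shape V) (halfw V $ d) (k $ d))"

definition periodize :: "real \<Rightarrow> (real \<Rightarrow> real) \<Rightarrow> real \<Rightarrow> real" where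
  "periodize L f x = (\<Sum>\<^sub>\<infinity>n\<in>(UNIV :: int set). f (x + of_int n * L))"

definition window_1d :: "solver \<Rightarrow> 3 \<Rightarrow> real \<Rightarrow> real" where
  "window_1d V d = W_GS (shape V) (halfw V $ d)"

definition window_1d_per :: "solver \<Rightarrow> 3 \<Rightarrow> real \<Rightarrow> real" where
  "window_1d_per V d = periodize (periods V $ d) (window_1d V d)"

text \<open>
  At \<open>k = 0\<close> the quotients by \<open>k^2\<close> below evaluate to 0; a single point does not affect
  the integrals.
\<close>

definition Phi_mid ::
  "((real^3 \<Rightarrow> complex) \<Rightarrow> complex) \<Rightarrow> (nat \<Rightarrow> real) \<Rightarrow> (nat \<Rightarrow> real) \<Rightarrow> nat \<Rightarrow> solver
     \<Rightarrow> nat \<Rightarrow> complex" where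
  "Phi_mid \<L> w s m V i = 4 * complex_of_real pi *
     (\<Sum>j=1..num V. complex_of_real (charge V j) *
        \<L> (\<lambda>k. complex_of_real (tau_mid w s m k / (norm k)\<^sup>2) * cis (k \<bullet> (pos V i - pos V j))))"

definition S_scal_hat ::
  "(nat \<Rightarrow> real) \<Rightarrow> (nat \<Rightarrow> real) \<Rightarrow> nat \<Rightarrow> solver \<Rightarrow> real^3 \<Rightarrow> complex" where
  "S_scal_hat w s m V k =
     complex_of_real (tau_mid w s m k / ((norm k)\<^sup>2 * \<bar>window_hat V k\<bar>\<^sup>2)) *
     (\<Sum>j=1..num V. complex_of_real (charge V j * window_hat V k) * cis (- (k \<bullet> pos V j)))"

definition S_scal ::
  "((real^3 \<Rightarrow> complex) \<Rightarrow> complex) \<Rightarrow> (nat \<Rightarrow> real) \<Rightarrow> (nat \<Rightarrow> real) \<Rightarrow> nat \<Rightarrow> solver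
     \<Rightarrow> real^3 \<Rightarrow> complex" where
  "S_scal \<L> w s m V r = \<L> (\<lambda>k. S_scal_hat w s m V k * cis (k \<bullet> r))"

definition cell_xy :: "solver \<Rightarrow> (real^2) set" where
  "cell_xy V = {p. \<bar>p $ 1\<bar> \<le> box V $ 1 / 2 \<and> \<bar>p $ 2\<bar> \<le> box V $ 2 / 2}"

text \<open>
  \<open>gather_integral \<L> w s m V Z W i\<close> is \<open>4\<pi>\<close> times the integral over \<open>z \<in> Z\<close> and the planar
  cell of the grid function against the window at particle \<open>i\<close>, the window being periodized in
  x and y and equal to \<open>W\<close> in z.
\<close>

definition gather_integral ::
  "((real^3 \<Rightarrow> complex) \<Rightarrow> complex) \<Rightarrow> (nat \<Rightarrow> real) \<Rightarrow> (nat \<Rightarrow> real) \<Rightarrow> nat \<Rightarrow> solver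
     \<Rightarrow> real set \<Rightarrow> (real \<Rightarrow> real) \<Rightarrow> nat \<Rightarrow> complex" where
  "gather_integral \<L> w s m V Z W i = 4 * complex_of_real pi *
     (LINT z:Z|lborel. LINT p:cell_xy V|lborel.
        S_scal \<L> w s m V (vector [p $ 1, p $ 2, z]) *
        complex_of_real (window_1d_per V 1 (pos V i $ 1 - p $ 1) *
                         window_1d_per V 2 (pos V i $ 2 - p $ 2) *
                         W (pos V i $ 3 - z)))"

definition E_padd ::
  "((real^3 \<Rightarrow> complex) \<Rightarrow> complex) \<Rightarrow> (nat \<Rightarrow> real) \<Rightarrow> (nat \<Rightarrow> real) \<Rightarrow> nat \<Rightarrow> solver
     \<Rightarrow> nat \<Rightarrow> complex" where
  "E_padd \<L> w s m V i =
     gather_integral \<L> w s m V UNIV (window_1d V 3) i -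
     gather_integral \<L> w s m V {- Lz_ext V / 2 .. Lz_ext V / 2} (window_1d_per V 3) i"

definition gather_sum ::
  "((real^3 \<Rightarrow> complex) \<Rightarrow> complex) \<Rightarrow> (nat \<Rightarrow> real) \<Rightarrow> (nat \<Rightarrow> real) \<Rightarrow> nat \<Rightarrow> solver
     \<Rightarrow> nat \<Rightarrow> complex" where
  "gather_sum \<L> w s m V i =
     4 * complex_of_real pi * complex_of_real (\<Prod>d\<in>UNIV. mesh V $ d) *
     (\<Sum>n\<in>{n :: int^3. \<forall>d. \<bar>real_of_int (n $ d)\<bar> \<le> (real (npts V d) - 1) / 2}.
        S_scal \<L> w s m V (\<chi> d. gridpt V i $ d + of_int (n $ d) * mesh V $ d) *
        complex_of_real (\<Prod>d\<in>UNIV. window_1d_per V d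
          (pos V i $ d - gridpt V i $ d - of_int (n $ d) * mesh V $ d)))"

definition E_gath ::
  "((real^3 \<Rightarrow> complex) \<Rightarrow> complex) \<Rightarrow> (nat \<Rightarrow> real) \<Rightarrow> (nat \<Rightarrow> real) \<Rightarrow> nat \<Rightarrow> solver
     \<Rightarrow> nat \<Rightarrow> complex" where
  "E_gath \<L> w s m V i = Phi_mid \<L> w s m V i - gather_sum \<L> w s m V i"

definition uniform_grid :: "real^3 \<Rightarrow> real^3 \<Rightarrow> (real^3) set" where
  "uniform_grid g h = {x. \<exists>n :: int^3. \<forall>d. x $ d = g $ d + of_int (n $ d) * h $ d}"

text \<open>The origin of the grid is arbitrary, but common to all particles.\<close>

definition nearest_grid_points :: "solver \<Rightarrow> bool" where
  "nearest_grid_points V \<longleftrightarrow> (\<exists>g. \<forall>i\<in>{1..num V}.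
     gridpt V i \<in> uniform_grid g (mesh V) \<and>
     (\<forall>x\<in>uniform_grid g (mesh V). dist (pos V i) (gridpt V i) \<le> dist (pos V i) x))"

text \<open>The physical system, the truncation index, the window, the grid and the padding.\<close>

definition valid_solver :: "(nat \<Rightarrow> real) \<Rightarrow> nat \<Rightarrow> solver \<Rightarrow> bool" where
  "valid_solver s m V \<longleftrightarrow>
     num V \<ge> 1 \<and> (\<Sum>i=1..num V. charge V i) = 0 \<and>
     (\<forall>d. box V $ d > 0) \<and>
     (\<forall>i\<in>{1..num V}. \<forall>d. \<bar>pos V i $ d\<bar> \<le> box V $ d / 2) \<and>
     eta V > 0 \<and> s m \<le> eta V * box V $ 3 \<and> eta V * box V $ 3 < s (m + 1) \<and>
     shape V > 0 \<and>
     (\<forall>d. mesh V $ d > 0 \<and> halfw V $ d > 0 \<and> odd (npts V d) \<and>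
          real (npts V d) = 2 * halfw V $ d / mesh V $ d + 1) \<and>
     (\<forall>l\<le>m. \<forall>d. (halfw V $ d)\<^sup>2 / shape V < (s l)\<^sup>2 \<and> (s l)\<^sup>2 \<le> (s m)\<^sup>2) \<and>
     padlen V \<ge> 2 * halfw V $ 3 \<and> padfac V \<ge> 1 \<and>
     nearest_grid_points V"

text \<open>
  Debye--Hueckel assumption. Completing the square in the error, whose integrand is a Gaussian of
  squared width \<open>\<mu>_d^l\<close> around \<open>r_j\<close> times the window around \<open>r_i\<close>, shows that the factors \<open>g_j\<close>
  of the charge sums occurring there are products over \<open>d\<close> of Gaussians in \<open>x_d - r_{j,d}\<close> of
  squared width \<open>s_l^2\<close> or \<open>\<mu>_d^l\<close>. The bound is required for these \<open>g_j\<close> only: for arbitrary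
  \<open>g_j\<close> in the unit disc it would amount to a bound on the sum of all \<open>|q_j|\<close>, which screening
  does not provide.
\<close>

definition debye_hueckel :: "real \<Rightarrow> (nat \<Rightarrow> real) \<Rightarrow> nat \<Rightarrow> solver \<Rightarrow> bool" where
  "debye_hueckel C s m V \<longleftrightarrow>
     (\<forall>i\<in>{1..num V}. \<forall>k x a :: real^3. \<forall>l\<le>m.
        (\<forall>d. a $ d = (s l)\<^sup>2 \<or> a $ d = mu s V l d) \<longrightarrow>
        cmod (\<Sum>j=1..num V. complex_of_real (charge V j) * cis (k \<bullet> (pos V i - pos V j)) *
               complex_of_real (\<Prod>d\<in>UNIV. exp (- (x $ d - pos V j $ d)\<^sup>2 / a $ d)))
        \<le> C * q_max V)"

definition alias_exponent :: "(nat \<Rightarrow> real) \<Rightarrow> solver \<Rightarrow> nat \<Rightarrow> 3 \<Rightarrow> real" where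
  "alias_exponent s V l d =
     pi\<^sup>2 * mu s V l d * (real (npts V d) - 1)\<^sup>2 / (4 * (s l)\<^sup>2 * shape V)"

text \<open>
  The regime of the estimates: \<open>\<S>\<close> and the exponents are at least \<open>c0\<close>, and the \<open>\<mu>_d^l\<close> are at
  least \<open>\<mu>0\<close>.
\<close>

definition in_regime :: "real \<Rightarrow> real \<Rightarrow> (nat \<Rightarrow> real) \<Rightarrow> nat \<Rightarrow> solver \<Rightarrow> bool" where
  "in_regime c0 \<mu>0 s m V \<longleftrightarrow>
     shape V \<ge> c0 \<and> (\<forall>l\<le>m. \<forall>d. alias_exponent s V l d \<ge> c0 \<and> mu s V l d \<ge> \<mu>0)"

text \<open>
  The support of the window fits into one period. Otherwise the periodized window overlaps its
  own images within the range of the gathering sum, and grid points are counted repeatedly.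
\<close>

definition window_fits :: "solver \<Rightarrow> bool" where
  "window_fits V \<longleftrightarrow> 2 * halfw V $ 1 \<le> box V $ 1 \<and> 2 * halfw V $ 2 \<le> box V $ 2"

end

theory Submission
  imports Defs "HOL-Probability.Characteristic_Functions"
begin

text \<open>
  The padding error vanishes: as \<open>L_z* \<ge> L_z + 2 H_z\<close>, the window around a particle stays inside
  the padded box, where it agrees with its periodization up to the two end points.

  For the gathering error, \<open>S_scal\<close> is a sum over \<open>l\<close> and \<open>j\<close> of products over \<open>d\<close> of Gaussians of
  squared width \<open>\<mu>_d^l\<close> around \<open>r_j\<close>, so the potential and the trapezoidal sum are sums over \<open>j\<close> of
  products of one-dimensional factors, and their difference telescopes over the dimensions. In one
  dimension the product of the source Gaussian and the untruncated window is, after completing the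
  square, a Gaussian in the grid point. Poisson summation turns the error of its infinite
  trapezoidal sum into the modes \<open>exp (- p\<^sup>2 E) cis (2 \<pi> p v)\<close>, \<open>p \<noteq> 0\<close>, where \<open>E\<close> is the
  aliasing exponent and the centre \<open>v\<close> is affine in the coordinate of \<open>r_j\<close>; the remaining terms are the grid points outside the window, of total weight
  \<open>O(exp (- S) / sqrt S) = O(erfc (sqrt S))\<close>, and the two points at the edge of the window. All of
  these are absolutely convergent combinations of the modes to which the Debye--Hueckel bound applies.
\<close>

section \<open>Poisson summation for Gaussians\<close>

text \<open>The charges are controlled only through sums against particular modes; the sum of all
  \<open>\<bar>charge V j\<bar>\<close> has no bound. So no estimate may be made inside a sum over
  \<open>j\<close>: absolute values may fall only on coefficients that do not depend on
  \<open>j\<close>. Hence the one-dimensional error must first be written exactly in terms of modes,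
  and the Poisson formula is needed as an identity, not merely as an estimate of a quadrature error.

  The identity fits because \<open>\<mu> + H\<^sup>2 / S = s\<^sup>2\<close>: completing the square
  leaves the Gaussian of squared width \<open>s\<^sup>2\<close> as a prefactor, and the zero mode
  supplies its normalisation, so the zero mode is the exact potential factor and everything else is
  error.

  Uniformity in the mesh rests on \<open>\<rho> = sqrt S / M\<close>, the square root of the
  window's decay rate in mesh units. Since \<open>\<mu> \<le> s\<^sup>2\<close>, the aliasing
  exponent is at most \<open>pi\<^sup>2 / \<rho>\<^sup>2\<close>; its lower bound \<open>c0\<close>
  therefore bounds \<open>\<rho>\<close> from above, and with it all lattice sums, whatever the
  number of grid points.\<close>

lemma gaussian_fourier_std:
  "integrable lborel (\<lambda>x. complex_of_real (exp (- x\<^sup>2 / 2)) * cis (t * x))"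
  "(LINT x|lborel. complex_of_real (exp (- x\<^sup>2 / 2)) * cis (t * x)) =
     complex_of_real (sqrt (2 * pi) * exp (- t\<^sup>2 / 2))"
proof -
  have int: "integrable lborel (\<lambda>x::real. exp (- x\<^sup>2 / 2))"
    using integrable_mult_right[OF integrable_normal_density[of 1 0], of "sqrt (2 * pi)"]
    by (simp add: normal_density_def)
  have "integrable lborel (\<lambda>x. exp (- x\<^sup>2 / 2) *\<^sub>R cis (t * x))"
    by (rule Bochner_Integration.integrable_bound[OF int])
       (auto intro!: borel_measurable_continuous_onI continuous_intros)
  then show "integrable lborel (\<lambda>x. complex_of_real (exp (- x\<^sup>2 / 2)) * cis (t * x))"
    by (simp add: scaleR_conv_of_real)
  have "complex_of_real (exp (- t\<^sup>2 / 2)) = char std_normal_distribution t"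
    by (simp add: char_std_normal_distribution)
  also have "\<dots> = (LINT x|lborel. std_normal_density x *\<^sub>R cis (t * x))"
    unfolding char_def by (subst integral_density) (auto simp: cis_conv_exp)
  also have "\<dots> = (LINT x|lborel. complex_of_real (1 / sqrt (2 * pi)) *
                   (complex_of_real (exp (- x\<^sup>2 / 2)) * cis (t * x)))"
    by (intro Bochner_Integration.integral_cong)
       (auto simp: std_normal_density_def scaleR_conv_of_real)
  also have "\<dots> = complex_of_real (1 / sqrt (2 * pi)) *
      (LINT x|lborel. complex_of_real (exp (- x\<^sup>2 / 2)) * cis (t * x))"
    by (rule integral_mult_right_zero)
  finally have *: "complex_of_real (exp (- t\<^sup>2 / 2)) = complex_of_real (1 / sqrt (2 * pi)) *
      (LINT x|lborel. complex_of_real (exp (- x\<^sup>2 / 2)) * cis (t * x))" .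
  have "complex_of_real (sqrt (2 * pi)) * complex_of_real (exp (- t\<^sup>2 / 2)) =
    complex_of_real (sqrt (2 * pi) * (1 / sqrt (2 * pi))) *
      (LINT x|lborel. complex_of_real (exp (- x\<^sup>2 / 2)) * cis (t * x))"
    unfolding * by (simp only: of_real_mult mult.assoc)
  then show "(LINT x|lborel. complex_of_real (exp (- x\<^sup>2 / 2)) * cis (t * x)) =
     complex_of_real (sqrt (2 * pi) * exp (- t\<^sup>2 / 2))"
    by (simp add: field_simps)
qed

lemma gaussian_fourier:
  assumes "\<beta> > 0"
  shows "integrable lborel (\<lambda>x. complex_of_real (exp (- \<beta> * x\<^sup>2)) * cis (t * x))"
    and "(LINT x|lborel. complex_of_real (exp (- \<beta> * x\<^sup>2)) * cis (t * x)) =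
           complex_of_real (sqrt (pi / \<beta>) * exp (- t\<^sup>2 / (4 * \<beta>)))"
proof -
  let ?f = "\<lambda>x. complex_of_real (exp (- \<beta> * x\<^sup>2)) * cis (t * x)"
  define c where "c = 1 / sqrt (2 * \<beta>)"
  have c: "c \<noteq> 0" "c > 0" "c\<^sup>2 = 1 / (2 * \<beta>)"
    using assms by (auto simp: c_def power_divide)
  have *: "?f (0 + c * x) = complex_of_real (exp (- x\<^sup>2 / 2)) * cis (t * c * x)" for x
    using assms by (simp add: power_mult_distrib c mult.assoc)
  have "integrable lborel (\<lambda>x. ?f (0 + c * x))"
    unfolding * by (rule gaussian_fourier_std)
  then show "integrable lborel ?f"
    using lborel_integrable_real_affine_iff[OF c(1), of ?f 0] by simp
  have "(LINT x|lborel. ?f x) = \<bar>c\<bar> *\<^sub>R (LINT x|lborel. ?f (0 + c * x))"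
    by (rule lborel_integral_real_affine[OF c(1)])
  also have "\<dots> = complex_of_real c * complex_of_real (sqrt (2 * pi) * exp (- (t * c)\<^sup>2 / 2))"
    unfolding * gaussian_fourier_std using c by (simp add: scaleR_conv_of_real)
  also have "\<dots> = complex_of_real (c * sqrt (2 * pi) * exp (- (t * c)\<^sup>2 / 2))"
    by simp
  also have "c * sqrt (2 * pi) = sqrt (pi / \<beta>)"
    by (simp add: c_def real_sqrt_divide real_sqrt_mult)
  also have "(t * c)\<^sup>2 / 2 = t\<^sup>2 / (4 * \<beta>)"
    by (simp add: power_mult_distrib c)
  then have "- (t * c)\<^sup>2 / 2 = - t\<^sup>2 / (4 * \<beta>)" by simp
  finally show "(LINT x|lborel. ?f x) = complex_of_real (sqrt (pi / \<beta>) * exp (- t\<^sup>2 / (4 * \<beta>)))"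
    by simp
qed

section \<open>Uniqueness of Fourier coefficients of continuous periodic functions\<close>

lemma continuous_on_circle_of_periodic:
  fixes D :: "real \<Rightarrow> real"
  assumes cont: "continuous_on UNIV D" and per: "\<And>x. D (x + 1) = D x"
  obtains f :: "complex \<Rightarrow> real"
    where "continuous_on (sphere 0 1) f" "\<And>x. f (cis (2 * pi * x)) = D x"
proof
  have nat: "D (x + real n) = D x" for x n
    by (induction n) (auto simp: per add.assoc[symmetric] add.commute[of 1])
  have int: "D (x + of_int n) = D x" for x n
  proof (cases "n \<ge> 0")
    case True then show ?thesis using nat[of x "nat n"] by simp
  next
    case False then show ?thesis using nat[of "x + of_int n" "nat (- n)"] by simp
  qed
  have eq: "D (a / (2 * pi)) = D (c / (2 * pi))" if "cis a = cis c" for a c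
  proof -
    have "cos a = cos c" "sin a = sin c"
      using that by (auto simp: complex_eq_iff)
    then obtain n :: int where "a = c + 2 * pi * of_int n"
      using sin_cos_eq_iff[of a c] by auto
    then have "a / (2 * pi) = c / (2 * pi) + of_int n" by (simp add: field_simps)
    then show ?thesis using int by simp
  qed
  define f where "f = (\<lambda>z. D (Arg z / (2 * pi)))"
  show "f (cis (2 * pi * x)) = D x" for x
    using eq[of "Arg (cis (2 * pi * x))" "2 * pi * x"] by (simp add: f_def cis_Arg)
  \<comment> \<open>\<open>Arg\<close> jumps across the negative real axis. There
    \<open>Arg (- z) + pi\<close> is an argument of \<open>z\<close> that varies continuously, and
    periodicity of \<open>D\<close> makes the choice of argument irrelevant.\<close>
  have f_minus: "f z = D (Arg (- z) / (2 * pi) + 1 / 2)" if "z \<noteq> 0" for z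
  proof -
    have "cis (Arg (- z) + pi) = cis (Arg z)"
      using that by (simp add: cis_mult[symmetric] cis_Arg sgn_minus)
    from eq[OF this] show ?thesis by (simp add: f_def add_divide_distrib)
  qed
  have D: "isCont D x" for x
    using cont by (simp add: continuous_on_eq_continuous_at)
  show "continuous_on (sphere 0 1) f"
  proof (intro continuous_at_imp_continuous_on ballI)
    fix z :: complex assume z: "z \<in> sphere 0 1"
    show "isCont f z"
    proof (cases "z \<in> \<real>\<^sub>\<le>\<^sub>0")
      case False
      then have "isCont Arg z" by (rule continuous_at_Arg)
      then show ?thesis unfolding f_def
        by (intro isCont_o2[OF _ D] continuous_intros) auto
    next
      case True
      then have z': "- z \<notin> \<real>\<^sub>\<le>\<^sub>0" "z \<noteq> 0"
        using z by (auto simp: complex_nonpos_Reals_iff complex_eq_iff cmod_def)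
      then have "isCont Arg (- z)" by (intro continuous_at_Arg)
      then have "isCont (\<lambda>z. Arg (- z)) z"
        by (intro isCont_o2[of _ "\<lambda>z. - z" Arg] continuous_intros)
      then have "isCont (\<lambda>z. D (Arg (- z) / (2 * pi) + 1 / 2)) z"
        by (intro isCont_o2[OF _ D] continuous_intros) auto
      moreover have "\<forall>\<^sub>F x in nhds z. f x = D (Arg (- x) / (2 * pi) + 1 / 2)"
        using eventually_neq_at_within[of 0 z UNIV] t1_space_nhds[of z 0] z' f_minus
        by (metis (mono_tags, lifting) eventually_mono)
      ultimately show ?thesis by (simp add: isCont_cong)
    qed
  qed
qed

definition fourier_null :: "(real \<Rightarrow> real) \<Rightarrow> bool" where
  "fourier_null D \<longleftrightarrow> continuous_on UNIV D \<and>
     (\<forall>p::int. integral {0..1} (\<lambda>x. complex_of_real (D x) * cis (2 * pi * of_int p * x)) = 0)"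

text \<open>By Euler's formulas a real-linear functional of \<open>cis y\<close> is
  \<open>A * cis y + B * cis (- y)\<close>, and a factor
  \<open>cis (\<plusminus> 2 * pi * x)\<close> only shifts the frequency by one, so vanishing of all
  coefficients is preserved. Products are handled by multiplying twice, which is why the induction
  leaves \<open>D\<close> arbitrary.\<close>

lemma fourier_null_mult_polynomial:
  assumes "real_polynomial_function g" "fourier_null D"
  shows "fourier_null (\<lambda>x. D x * g (cis (2 * pi * x)))"
  using assms
proof (induction g arbitrary: D rule: real_polynomial_function.induct)
  case (linear f)
  interpret f: bounded_linear f by fact
  define A where "A = complex_of_real (f 1) / 2 + complex_of_real (f \<i>) / (2 * \<i>)"
  define B where "B = complex_of_real (f 1) / 2 - complex_of_real (f \<i>) / (2 * \<i>)"
  have f: "complex_of_real (f (cis y)) = A * cis y + B * cis (- y)" for y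
  proof -
    have "cis y = cos y *\<^sub>R 1 + sin y *\<^sub>R \<i>" by (simp add: complex_eq_iff)
    then have "f (cis y) = cos y * f 1 + sin y * f \<i>"
      by (simp only: f.add f.scaleR real_scaleR_def)
    then show ?thesis by (simp add: A_def B_def complex_eq_iff)
  qed
  have D: "continuous_on UNIV D"
    "\<And>p::int. integral {0..1} (\<lambda>x. complex_of_real (D x) * cis (2 * pi * of_int p * x)) = 0"
    using linear.prems by (auto simp: fourier_null_def)
  have D': "continuous_on S D" for S using D(1) continuous_on_subset by blast
  have "integral {0..1} (\<lambda>x. complex_of_real (D x * f (cis (2 * pi * x))) * cis (2 * pi * of_int p * x)) = 0" for p
  proof -
    have "complex_of_real (D x * f (cis (2 * pi * x))) * cis (2 * pi * of_int p * x) =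
      A * (complex_of_real (D x) * cis (2 * pi * of_int (p + 1) * x)) +
      B * (complex_of_real (D x) * cis (2 * pi * of_int (p - 1) * x))" for x
    proof -
      have "cis (2 * pi * of_int (p + 1) * x) = cis (2 * pi * x) * cis (2 * pi * of_int p * x)"
        "cis (2 * pi * of_int (p - 1) * x) = cis (- (2 * pi * x)) * cis (2 * pi * of_int p * x)"
        by (simp_all add: cis_mult algebra_simps)
      then show ?thesis unfolding of_real_mult f by (simp only: ring_distribs mult_ac)
    qed
    moreover have "(\<lambda>x. c * (complex_of_real (D x) * cis (2 * pi * of_int q * x))) integrable_on {0..1}" for q c
      by (intro integrable_continuous_interval continuous_intros D')
    ultimately show ?thesis
      using D(2)[of "p + 1"] D(2)[of "p - 1"]
      by (simp only: Henstock_Kurzweil_Integration.integral_add integral_mult_right) simp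
  qed
  moreover have "continuous_on UNIV (\<lambda>x. D x * f (cis (2 * pi * x)))"
    by (intro continuous_intros D f.continuous_on)
  ultimately show ?case by (simp add: fourier_null_def)
next
  case (const c)
  have "complex_of_real (D x * c) * z = of_real c * (complex_of_real (D x) * z)" for x z
    by simp
  then have "integral {0..1} (\<lambda>x. complex_of_real (D x * c) * cis (2 * pi * of_int p * x)) = 0" for p
    using const unfolding fourier_null_def by (simp only: integral_mult_right) simp
  then show ?case using const
    by (auto simp: fourier_null_def intro!: continuous_intros simp del: of_real_mult)
next
  case (add f g)
  note 1 = add.IH(1)[OF add.prems] and 2 = add.IH(2)[OF add.prems]
  have int: "(\<lambda>x. complex_of_real (D' x) * cis (2 * pi * of_int p * x)) integrable_on {0..1}"
    if "fourier_null D'" for p D'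
    using that unfolding fourier_null_def
    by (intro integrable_continuous_interval continuous_intros) (auto intro: continuous_on_subset)
  show ?case
    unfolding fourier_null_def
  proof (intro conjI allI)
    show "continuous_on UNIV (\<lambda>x. D x * (f (cis (2 * pi * x)) + g (cis (2 * pi * x))))"
      using 1 2 unfolding fourier_null_def ring_distribs by (intro continuous_on_add) auto
    fix p
    show "integral {0..1} (\<lambda>x. complex_of_real (D x * (f (cis (2 * pi * x)) + g (cis (2 * pi * x)))) *
              cis (2 * pi * of_int p * x)) = 0"
      using 1 2 int[OF 1, of p] int[OF 2, of p] unfolding fourier_null_def ring_distribs of_real_add
      by (simp add: Henstock_Kurzweil_Integration.integral_add)
  qed
next
  case (mult f g)
  from mult.IH(2)[OF mult.IH(1)[OF mult.prems]] show ?case by (simp add: mult_ac)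
qed

text \<open>Approximate \<open>D\<close> itself by polynomials in \<open>cis (2 \<pi> x)\<close>: then \<open>\<integral> D\<^sup>2 \<approx> 0\<close>.\<close>

lemma fourier_null_imp_zero:
  assumes null: "fourier_null D" and per: "\<And>x. D (x + 1) = D x" and x: "x \<in> {0..1}"
  shows "D x = 0"
proof -
  have cont: "continuous_on S D" for S
    using null continuous_on_subset by (auto simp: fourier_null_def)
  obtain f where f: "continuous_on (sphere 0 1) f" "\<And>x. f (cis (2 * pi * x)) = D x"
    using continuous_on_circle_of_periodic[OF cont per] by blast
  define I where "I = integral {0..1} (\<lambda>x. (D x)\<^sup>2)"
  define J where "J = integral {0..1} (\<lambda>x. \<bar>D x\<bar>)"
  have J: "J \<ge> 0" unfolding J_def by (rule integral_nonneg) (auto intro!: integrable_continuous_interval continuous_intros cont)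
  have le: "I \<le> e * J" if e: "e > 0" for e
  proof -
    obtain g where g: "real_polynomial_function g" "\<And>x. x \<in> sphere 0 1 \<Longrightarrow> \<bar>f x - g x\<bar> < e"
      using Stone_Weierstrass_real_polynomial_function[OF _ f(1) e] by auto
    have cg: "continuous_on UNIV (\<lambda>x. D x * g (cis (2 * pi * x)))"
      using fourier_null_mult_polynomial[OF g(1) null] by (auto simp: fourier_null_def)
    have int: "(\<lambda>x. D x * g (cis (2 * pi * x))) integrable_on {0..1}"
      by (intro integrable_continuous_interval continuous_on_subset[OF cg]) auto
    have "complex_of_real (integral {0..1} (\<lambda>x. D x * g (cis (2 * pi * x)))) =
        integral {0..1} (\<lambda>x. complex_of_real (D x * g (cis (2 * pi * x))))"
      by (rule integral_unique[symmetric, OF has_integral_of_real[OF integrable_integral[OF int]]])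
    also have "\<dots> = 0"
      using fourier_null_mult_polynomial[OF g(1) null] by (auto simp: fourier_null_def dest!: spec[of _ 0])
    finally have 0: "integral {0..1} (\<lambda>x. D x * g (cis (2 * pi * x))) = 0" by simp
    have int': "(\<lambda>x. (D x)\<^sup>2) integrable_on {0..1}"
      by (intro integrable_continuous_interval continuous_intros cont)
    have "I = integral {0..1} (\<lambda>x. (D x)\<^sup>2 - D x * g (cis (2 * pi * x)))"
      unfolding I_def Henstock_Kurzweil_Integration.integral_diff[OF int' int] 0 by simp
    also have "\<dots> \<le> integral {0..1} (\<lambda>x. e * \<bar>D x\<bar>)"
    proof (rule integral_le)
      show "(\<lambda>x. (D x)\<^sup>2 - D x * g (cis (2 * pi * x))) integrable_on {0..1}"
        by (rule Henstock_Kurzweil_Integration.integrable_diff[OF int' int])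
      show "(\<lambda>x. e * \<bar>D x\<bar>) integrable_on {0..1}"
        by (intro integrable_continuous_interval continuous_intros cont)
      fix x :: real
      have eq: "(D x)\<^sup>2 - D x * g (cis (2 * pi * x)) = D x * (f (cis (2 * pi * x)) - g (cis (2 * pi * x)))"
        unfolding f(2)[of x] power2_eq_square by (rule right_diff_distrib[symmetric])
      have "D x * (f (cis (2 * pi * x)) - g (cis (2 * pi * x))) \<le> \<bar>D x\<bar> * \<bar>f (cis (2 * pi * x)) - g (cis (2 * pi * x))\<bar>"
        by (metis abs_ge_self abs_mult)
      also have "\<dots> \<le> \<bar>D x\<bar> * e"
        by (intro mult_left_mono less_imp_le[OF g(2)]) auto
      finally show "(D x)\<^sup>2 - D x * g (cis (2 * pi * x)) \<le> e * \<bar>D x\<bar>" unfolding eq by (simp only: mult.commute)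
    qed
    also have "\<dots> = e * J" by (simp add: J_def)
    finally show ?thesis .
  qed
  have "I \<le> 0"
  proof (rule ccontr)
    assume "\<not> I \<le> 0"
    then have "I > 0" by simp
    \<comment> \<open>This choice of \<open>e\<close> gives \<open>e * J < I\<close>; the summand 1
      keeps the denominator positive when \<open>J = 0\<close>.\<close>
    have "I \<le> I / (2 * (J + 1)) * J" using \<open>I > 0\<close> J by (intro le) auto
    also have "\<dots> < I"
    proof -
      have "J / (2 * (J + 1)) < 1" using J by (simp add: divide_simps)
      then have "I * (J / (2 * (J + 1))) < I * 1" using \<open>I > 0\<close> by (intro mult_strict_left_mono)
      then show ?thesis by simp
    qed
    finally show False by simp
  qed
  moreover have "I \<ge> 0" unfolding I_def
    by (rule integral_nonneg) (auto intro!: integrable_continuous_interval continuous_intros cont)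
  ultimately have "I = 0" by simp
  then have "\<forall>x\<in>{0..1}. (D x)\<^sup>2 = 0"
    unfolding I_def by (subst (asm) integral_eq_0_iff) (auto intro!: continuous_intros cont)
  then show ?thesis using x by auto
qed

section \<open>The periodized Gaussian and its Fourier coefficients\<close>

text \<open>The tangent inequality \<open>y\<^sup>2 \<ge> 2 * y - 1\<close> replaces Gaussian decay
  by exponential decay, so that Gaussian series have geometric majorants.\<close>

lemma exp_neg_sq_le: "exp (- \<beta> * y\<^sup>2) \<le> exp \<beta> * exp (- 2 * \<beta> * y)" if "\<beta> > 0" for \<beta> y :: real
proof -
  have "0 \<le> \<beta> * (y - 1)\<^sup>2" using that by simp
  then show ?thesis by (simp add: exp_add[symmetric] power2_eq_square algebra_simps)
qed

text \<open>Groups the integer shifts \<open>k\<close> and \<open>-(k + 1)\<close>. Each integer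
  occurs once, and the first \<open>n\<close> pairs cover the shifts from \<open>-n\<close> to
  \<open>n - 1\<close>; a two-sided lattice sum thus becomes an ordinary series.\<close>

definition gauss_pair :: "real \<Rightarrow> nat \<Rightarrow> real \<Rightarrow> real" where
  "gauss_pair \<beta> k x = exp (- \<beta> * (x + real k)\<^sup>2) + exp (- \<beta> * (x - (real k + 1))\<^sup>2)"

lemma gauss_pair_nonneg: "gauss_pair \<beta> k x \<ge> 0" by (simp add: gauss_pair_def)

lemma gauss_pair_bound:
  assumes "\<beta> > 0" "\<bar>x\<bar> \<le> R"
  shows "gauss_pair \<beta> k x \<le> 2 * exp (\<beta> + 2 * \<beta> * R) * exp (- 2 * \<beta>) ^ k"
proof -
  have e: "exp (- 2 * \<beta>) ^ k = exp (- 2 * \<beta> * real k)"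
    by (simp add: exp_of_nat_mult[symmetric] mult_ac)
  have "\<beta> * \<bar>x\<bar> \<le> \<beta> * R" using assms by (intro mult_left_mono) auto
  moreover have "\<beta> * x \<le> \<beta> * \<bar>x\<bar>" "- (\<beta> * x) \<le> \<beta> * \<bar>x\<bar>"
    using assms mult_left_mono[of x "\<bar>x\<bar>" \<beta>] mult_left_mono[of "-x" "\<bar>x\<bar>" \<beta>] by auto
  ultimately have R: "- (\<beta> * x) \<le> \<beta> * R" "\<beta> * x \<le> \<beta> * R" by linarith+
  have "exp (- \<beta> * (x + real k)\<^sup>2) \<le> exp \<beta> * exp (- 2 * \<beta> * (x + real k))"
    by (rule exp_neg_sq_le[OF assms(1)])
  also have "\<dots> \<le> exp (\<beta> + 2 * \<beta> * R) * exp (- 2 * \<beta> * real k)"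
    unfolding exp_add[symmetric] exp_le_cancel_iff using R by (simp add: algebra_simps)
  finally have 1: "exp (- \<beta> * (x + real k)\<^sup>2) \<le> exp (\<beta> + 2 * \<beta> * R) * exp (- 2 * \<beta> * real k)" .
  have "exp (- \<beta> * (x - (real k + 1))\<^sup>2) = exp (- \<beta> * (real k + 1 - x)\<^sup>2)"
    by (simp add: power2_commute)
  also have "\<dots> \<le> exp \<beta> * exp (- 2 * \<beta> * (real k + 1 - x))"
    by (rule exp_neg_sq_le[OF assms(1)])
  also have "\<dots> \<le> exp (\<beta> + 2 * \<beta> * R) * exp (- 2 * \<beta> * real k)"
    unfolding exp_add[symmetric] exp_le_cancel_iff
  proof -
    have "\<beta> + - 2 * \<beta> * (real k + 1 - x) = 2 * (\<beta> * x) - \<beta> - 2 * (\<beta> * real k)" by algebra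
    moreover have "\<beta> + 2 * \<beta> * R + - 2 * \<beta> * real k = \<beta> + 2 * (\<beta> * R) - 2 * (\<beta> * real k)" by algebra
    ultimately show "\<beta> + - 2 * \<beta> * (real k + 1 - x) \<le> \<beta> + 2 * \<beta> * R + - 2 * \<beta> * real k"
      using R assms(1) by linarith
  qed
  finally show ?thesis using 1 unfolding gauss_pair_def e by simp
qed

lemma gauss_pair_bound_summable:
  "\<beta> > 0 \<Longrightarrow> summable (\<lambda>k. c * exp (- 2 * \<beta>) ^ k)" for \<beta> c :: real
  by (intro summable_mult summable_geometric) auto

lemma gauss_pair_summable:
  assumes "\<beta> > 0" shows "summable (\<lambda>k. gauss_pair \<beta> k x)"
  by (rule summable_comparison_test'[OF gauss_pair_bound_summable[OF assms, of "2 * exp (\<beta> + 2 * \<beta> * \<bar>x\<bar>)"], of 0])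
     (use gauss_pair_bound[OF assms order_refl] gauss_pair_nonneg in auto)

lemma gauss_pair_uniform_limit:
  assumes "\<beta> > 0"
  shows "uniform_limit {-R..R} (\<lambda>n x. \<Sum>k<n. gauss_pair \<beta> k x) (\<lambda>x. \<Sum>k. gauss_pair \<beta> k x) sequentially"
  by (rule Weierstrass_m_test[OF _ gauss_pair_bound_summable[OF assms, of "2 * exp (\<beta> + 2 * \<beta> * R)"]])
     (use gauss_pair_bound[OF assms] gauss_pair_nonneg in auto)

lemma gauss_pair_continuous: "continuous_on S (gauss_pair \<beta> k)"
  unfolding gauss_pair_def by (intro continuous_intros)

text \<open>The geometric majorant is uniform only on bounded sets, so continuity at
  \<open>x\<close> comes from uniform convergence on an interval around \<open>x\<close>.\<close>

lemma gauss_pair_suminf_continuous: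
  assumes "\<beta> > 0" shows "continuous_on UNIV (\<lambda>x. \<Sum>k. gauss_pair \<beta> k x)"
proof (intro continuous_at_imp_continuous_on ballI)
  fix x :: real
  have "continuous_on {- (\<bar>x\<bar> + 1)..\<bar>x\<bar> + 1} (\<lambda>x. \<Sum>k. gauss_pair \<beta> k x)"
    by (rule uniform_limit_theorem[OF _ gauss_pair_uniform_limit[OF assms]])
       (auto intro!: always_eventually continuous_intros gauss_pair_continuous)
  then show "isCont (\<lambda>x. \<Sum>k. gauss_pair \<beta> k x) x"
    by (rule continuous_on_interior) auto
qed

text \<open>Replacing \<open>x\<close> by \<open>x + 1\<close> moves the window of shifts by one:
  the partial sum gains the term at \<open>x + n\<close> and loses the one at \<open>x - n\<close>,
  and both tend to 0.\<close>

lemma gauss_pair_suminf_periodic: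
  assumes "\<beta> > 0" shows "(\<Sum>k. gauss_pair \<beta> k (x + 1)) = (\<Sum>k. gauss_pair \<beta> k x)"
proof -
  define g where "g = (\<lambda>x. exp (- \<beta> * x\<^sup>2))"
  have tele: "(\<Sum>k<n. gauss_pair \<beta> k (x + 1)) = (\<Sum>k<n. gauss_pair \<beta> k x) + g (x + real n) - g (x - real n)" for n
    by (induction n) (auto simp: g_def gauss_pair_def algebra_simps)
  have "(\<lambda>n. g (x + real n)) \<longlonglongrightarrow> 0" "(\<lambda>n. g (x - real n)) \<longlonglongrightarrow> 0"
  proof -
    have *: "filterlim (\<lambda>n. \<beta> * y n ^ 2) at_top sequentially" if "filterlim y at_infinity sequentially" for y :: "nat \<Rightarrow> real"
    proof -
      have "filterlim (\<lambda>n. norm (y n) ^ 2) at_top sequentially"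
        by (rule filterlim_pow_at_top[OF _ filterlim_at_infinity_imp_norm_at_top[OF that]]) simp
      then show ?thesis using assms by (intro filterlim_tendsto_pos_mult_at_top[OF tendsto_const]) auto
    qed
    have g: "(\<lambda>n. g (y n)) \<longlonglongrightarrow> 0" if "filterlim y at_infinity sequentially" for y
      unfolding g_def
      using filterlim_compose[OF exp_at_bot, of "\<lambda>n. - (\<beta> * (y n)\<^sup>2)"] *[OF that]
      by (simp add: filterlim_uminus_at_bot)
    have "filterlim (\<lambda>n. x + real n) at_infinity sequentially"
      by (intro filterlim_at_top_imp_at_infinity filterlim_tendsto_add_at_top[OF tendsto_const] filterlim_real_sequentially)
    moreover have "filterlim (\<lambda>n. x - real n) at_infinity sequentially"
    proof (rule filterlim_at_bot_imp_at_infinity)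
      have "filterlim (\<lambda>n. - x + real n) at_top sequentially"
        by (intro filterlim_tendsto_add_at_top[OF tendsto_const] filterlim_real_sequentially)
      then show "filterlim (\<lambda>n. x - real n) at_bot sequentially"
        by (simp add: filterlim_uminus_at_top)
    qed
    ultimately show "(\<lambda>n. g (x + real n)) \<longlonglongrightarrow> 0" "(\<lambda>n. g (x - real n)) \<longlonglongrightarrow> 0"
      using g by auto
  qed
  then have "(\<lambda>n. (\<Sum>k<n. gauss_pair \<beta> k x) + g (x + real n) - g (x - real n)) \<longlonglongrightarrow> (\<Sum>k. gauss_pair \<beta> k x) + 0 - 0"
    by (intro tendsto_intros summable_LIMSEQ gauss_pair_summable assms)
  then have "(\<lambda>k. gauss_pair \<beta> k (x + 1)) sums (\<Sum>k. gauss_pair \<beta> k x)"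
    by (simp add: sums_def tele)
  then show ?thesis by (simp add: sums_iff)
qed

text \<open>Termwise integration by the Weierstrass test, stated for a general majorant because both
  sides of the Poisson identity need it.\<close>

lemma fourier_coefficient_sums:
  fixes t :: "nat \<Rightarrow> real \<Rightarrow> real"
  assumes cont: "\<And>k. continuous_on {0..1} (t k)"
    and le: "\<And>k x. x \<in> {0..1} \<Longrightarrow> \<bar>t k x\<bar> \<le> M k" and M: "summable M"
  shows "(\<lambda>k. integral {0..1} (\<lambda>x. complex_of_real (t k x) * cis (a * x))) sums
           integral {0..1} (\<lambda>x. complex_of_real (\<Sum>k. t k x) * cis (a * x))"
proof -
  let ?f = "\<lambda>k x. complex_of_real (t k x) * cis (a * x)"
  have u: "uniform_limit {0..1} (\<lambda>n x. \<Sum>k<n. ?f k x) (\<lambda>x. \<Sum>k. ?f k x) sequentially"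
    by (rule Weierstrass_m_test[OF _ M]) (use le in \<open>auto simp: norm_mult\<close>)
  have eq: "(\<Sum>k. ?f k x) = complex_of_real (\<Sum>k. t k x) * cis (a * x)" if "x \<in> {0..1}" for x
  proof -
    have "summable (\<lambda>k. t k x)"
      by (rule summable_comparison_test'[OF M, of 0]) (use le that in auto)
    then show ?thesis by (simp add: suminf_of_real suminf_mult2 summable_of_real)
  qed
  have int: "(\<lambda>x. ?f k x) integrable_on {0..1}" for k
    by (intro integrable_continuous_interval continuous_intros cont)
  obtain I J where IJ: "\<And>n. ((\<lambda>x. \<Sum>k<n. ?f k x) has_integral I n) {0..1}"
      "((\<lambda>x. \<Sum>k. ?f k x) has_integral J) {0..1}" "I \<longlonglongrightarrow> J"
    by (rule uniform_limit_integral[OF u]) (auto intro!: continuous_intros cont)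
  have "I n = (\<Sum>k<n. integral {0..1} (?f k))" for n
    by (rule has_integral_unique[OF IJ(1) has_integral_sum]) (auto intro: integrable_integral int)
  moreover have "J = integral {0..1} (\<lambda>x. complex_of_real (\<Sum>k. t k x) * cis (a * x))"
    unfolding integral_unique[OF IJ(2), symmetric] by (rule integral_cong) (use eq in auto)
  moreover have "I = (\<lambda>n. \<Sum>k<n. integral {0..1} (?f k))" by (rule ext) fact
  ultimately show ?thesis using IJ(3) by (simp add: sums_def)
qed

lemma tendsto_integral_symmetric_interval:
  fixes f :: "real \<Rightarrow> complex"
  assumes f: "integrable lborel f"
  shows "(\<lambda>n. integral {- real n..real n} f) \<longlonglongrightarrow> (LINT x|lborel. f x)"
proof -
  have [measurable]: "f \<in> borel_measurable borel" using borel_measurable_integrable[OF f] by simp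
  have "(\<lambda>n. LINT x|lborel. indicator {- real n..real n} x *\<^sub>R f x) \<longlonglongrightarrow> (LINT x|lborel. f x)"
  proof (rule integral_dominated_convergence[where w = "\<lambda>x. norm (f x)"])
    show "AE x in lborel. (\<lambda>n. indicator {- real n..real n} x *\<^sub>R f x) \<longlonglongrightarrow> f x"
    proof (intro AE_I2)
      fix x
      have "\<forall>\<^sub>F n in sequentially. indicator {- real n..real n} x *\<^sub>R f x = f x"
        using eventually_ge_at_top[of "nat \<lceil>\<bar>x\<bar>\<rceil>"]
        by eventually_elim (auto simp: indicator_def)
      then show "(\<lambda>n. indicator {- real n..real n} x *\<^sub>R f x) \<longlonglongrightarrow> f x"
        by (rule tendsto_eventually)
    qed
  qed (use f in \<open>auto simp: indicator_def\<close>)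
  moreover have "(LINT x|lborel. indicator {- real n..real n} x *\<^sub>R f x) = integral {- real n..real n} f" for n
    using set_borel_integral_eq_integral(2)[of "{- real n..real n}" f] f
    by (simp add: set_lebesgue_integral_def set_integrable_def integrable_mult_indicator)
  ultimately show ?thesis by simp
qed

lemma cis_2pi_periodic: "cis (2 * pi * of_int p * (x + real k)) = cis (2 * pi * of_int p * x)"
proof -
  have "2 * pi * of_int p * (x + real k) = 2 * pi * of_int p * x + 2 * pi * of_int (p * int k)"
    by (simp add: algebra_simps)
  then show ?thesis
    by (simp only: cis_mult[symmetric] cis_multiple_2pi[OF Ints_of_int] mult_1_right)
qed

text \<open>Unfolding: since the character has period 1, the \<open>k\<close>-th pair integrated
  over the unit interval is the Gaussian integrated over \<open>[k, k + 1]\<close> and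
  \<open>[-(k + 1), -k]\<close>. The partial sums are integrals over \<open>[-n, n]\<close> and tend
  to the Fourier transform on the line.\<close>

lemma gauss_pair_fourier_coefficient:
  assumes b: "\<beta> > 0"
  shows "integral {0..1} (\<lambda>x. complex_of_real (\<Sum>k. gauss_pair \<beta> k x) * cis (2 * pi * of_int p * x)) =
           complex_of_real (sqrt (pi / \<beta>) * exp (- (pi\<^sup>2 * (of_int p)\<^sup>2 / \<beta>)))" (is "?I = ?R")
proof -
  define f where "f = (\<lambda>x. complex_of_real (exp (- \<beta> * x\<^sup>2)) * cis (2 * pi * of_int p * x))"
  have f_cont: "continuous_on S f" for S unfolding f_def by (intro continuous_intros)
  have f_int: "f integrable_on {x..y}" for x y by (intro integrable_continuous_interval f_cont)
  have shift: "integral {0..1} (\<lambda>x. f (x + c)) = integral {c..c+1} f" for c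
    using integral_shift[of 0 c 1 f] f_cont by (simp add: o_def add.commute)
  have "integral {0..1} (\<lambda>x. complex_of_real (gauss_pair \<beta> k x) * cis (2 * pi * of_int p * x)) =
      integral {real k..real k + 1} f + integral {- (real k + 1)..- real k} f" for k
  proof -
    have "complex_of_real (gauss_pair \<beta> k x) * cis (2 * pi * of_int p * x) =
       f (x + real k) + f (x + - (real k + 1))" for x
    proof -
      have "cis (2 * pi * of_int p * (x + - (real k + 1))) = cis (2 * pi * of_int p * x)"
        using cis_2pi_periodic[of p "x - (real k + 1)" "k + 1"] by (simp add: algebra_simps)
      then show ?thesis
        by (simp only: f_def gauss_pair_def cis_2pi_periodic of_real_add ring_distribs(2)
            diff_conv_add_uminus[of x "real k + 1"])
    qed
    moreover have "(\<lambda>x. f (x + c)) integrable_on {0..1}" for c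
      by (intro integrable_continuous_interval continuous_on_compose2[OF f_cont[of UNIV]] continuous_intros) auto
    ultimately show ?thesis
      using shift[of "real k"] shift[of "- (real k + 1)"]
      by (simp add: Henstock_Kurzweil_Integration.integral_add)
  qed
  then have part: "(\<Sum>k<n. integral {0..1} (\<lambda>x. complex_of_real (gauss_pair \<beta> k x) * cis (2 * pi * of_int p * x))) =
      integral {- real n..real n} f" for n
  proof (induction n)
    case (Suc n)
    have "integral {- real (Suc n)..real (Suc n)} f = integral {- real (Suc n)..real n} f + integral {real n..real (Suc n)} f"
      by (rule Henstock_Kurzweil_Integration.integral_combine[symmetric, OF _ _ f_int]) auto
    also have "integral {- real (Suc n)..real n} f = integral {- real (Suc n)..- real n} f + integral {- real n..real n} f"
      by (rule Henstock_Kurzweil_Integration.integral_combine[symmetric, OF _ _ f_int]) auto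
    finally show ?case using Suc by (simp add: add.commute)
  qed simp
  have "(\<lambda>n. integral {- real n..real n} f) \<longlonglongrightarrow> ?I"
    using fourier_coefficient_sums[of "gauss_pair \<beta>" _ "2 * pi * of_int p", OF gauss_pair_continuous _
        gauss_pair_bound_summable[OF b, of "2 * exp (\<beta> + 2 * \<beta> * 1)"]]
      gauss_pair_bound[OF b, of _ 1] gauss_pair_nonneg
    by (simp add: sums_def part)
  moreover have "(\<lambda>n. integral {- real n..real n} f) \<longlonglongrightarrow> (LINT x|lborel. f x)"
    unfolding f_def by (rule tendsto_integral_symmetric_interval gaussian_fourier(1)[OF b])+
  ultimately have "?I = (LINT x|lborel. f x)" by (rule LIMSEQ_unique)
  also have "\<dots> = complex_of_real (sqrt (pi / \<beta>) * exp (- (2 * pi * of_int p)\<^sup>2 / (4 * \<beta>)))"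
    unfolding f_def by (rule gaussian_fourier(2)[OF b])
  also have "- (2 * pi * of_int p)\<^sup>2 / (4 * \<beta>) = - (pi\<^sup>2 * (of_int p)\<^sup>2 / \<beta>)"
    using b by (simp add: field_simps power_mult_distrib)
  finally show ?thesis .
qed

section \<open>The dual cosine series and the Poisson identity\<close>

text \<open>The dual modes \<open>k + 1\<close> and \<open>-(k + 1)\<close> taken together; the zero
  mode is kept apart as the summand 1 in \<open>1 + (\<Sum>k. cos_term \<beta> k x)\<close>.\<close>

definition cos_term :: "real \<Rightarrow> nat \<Rightarrow> real \<Rightarrow> real" where
  "cos_term \<beta> k x = 2 * exp (- (pi\<^sup>2 * (real k + 1)\<^sup>2 / \<beta>)) * cos (2 * pi * (real k + 1) * x)"

text \<open>From \<open>(k + 1)\<^sup>2 \<ge> k + 1\<close>. The leading factor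
  \<open>exp (- E)\<close> is retained because it later becomes the aliasing estimate.\<close>

lemma theta_weight_le:
  assumes "E \<ge> 0" shows "exp (- (E * (real k + 1)\<^sup>2)) \<le> exp (- E) * exp (- E) ^ k"
proof -
  have "exp (- E) * exp (- E) ^ k = exp (- (E * (real k + 1)))"
    by (simp add: exp_of_nat_mult[symmetric] exp_add[symmetric] algebra_simps)
  moreover have "real k + 1 \<le> (real k + 1)\<^sup>2" by (simp add: power2_eq_square)
  ultimately show ?thesis using assms by (simp add: mult_left_mono)
qed

lemma cos_term_bound:
  assumes "\<beta> > 0" shows "\<bar>cos_term \<beta> k x\<bar> \<le> 2 * exp (- (pi\<^sup>2 / \<beta>)) * exp (- (pi\<^sup>2 / \<beta>)) ^ k"
proof -
  have "\<bar>cos_term \<beta> k x\<bar> \<le> 2 * exp (- (pi\<^sup>2 * (real k + 1)\<^sup>2 / \<beta>)) * 1"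
    unfolding cos_term_def abs_mult by (intro mult_mono) auto
  also have "\<dots> \<le> 2 * (exp (- (pi\<^sup>2 / \<beta>)) * exp (- (pi\<^sup>2 / \<beta>)) ^ k)"
    using theta_weight_le[of "pi\<^sup>2 / \<beta>" k] assms by simp
  finally show ?thesis by simp
qed

lemma cos_term_bound_summable:
  "\<beta> > 0 \<Longrightarrow> summable (\<lambda>k. c * exp (- (pi\<^sup>2 / \<beta>)) ^ k)" for \<beta> c :: real
  by (intro summable_mult summable_geometric) auto

lemma cos_term_summable: "\<beta> > 0 \<Longrightarrow> summable (\<lambda>k. cos_term \<beta> k x)"
  by (rule summable_comparison_test'[OF cos_term_bound_summable, of _ 0]) (use cos_term_bound in auto)

lemma cos_term_continuous: "continuous_on S (cos_term \<beta> k)"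
  unfolding cos_term_def by (intro continuous_intros)

lemma cos_term_suminf_continuous:
  assumes "\<beta> > 0" shows "continuous_on UNIV (\<lambda>x. \<Sum>k. cos_term \<beta> k x)"
proof -
  have "uniform_limit UNIV (\<lambda>n x. \<Sum>k<n. cos_term \<beta> k x) (\<lambda>x. \<Sum>k. cos_term \<beta> k x) sequentially"
    by (rule Weierstrass_m_test[OF _ cos_term_bound_summable[OF assms]])
       (use cos_term_bound[OF assms] in auto)
  then show ?thesis
    by (rule uniform_limit_theorem[rotated])
       (auto intro!: always_eventually continuous_intros cos_term_continuous)
qed

lemma cos_term_periodic: "cos_term \<beta> k (x + 1) = cos_term \<beta> k x"
proof -
  have "2 * pi * (real k + 1) * (x + 1) = 2 * pi * (real k + 1) * x + 2 * pi * of_int (int k + 1)"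
    by (simp add: algebra_simps)
  then show ?thesis unfolding cos_term_def
    by (metis cos_add cos_int_2pin sin_int_2pin mult.right_neutral mult_zero_right diff_zero)
qed

lemma integral_cis_unit_interval:
  "integral {0..1} (\<lambda>x. cis (2 * pi * of_int q * x)) = (if q = 0 then 1 else 0)"
proof (cases "q = 0")
  case False
  define a where "a = 2 * pi * of_int q"
  have a: "a \<noteq> 0" using False by (simp add: a_def)
  have "((\<lambda>x. cis (a * x)) has_integral cis (a * 1) / (\<i> * a) - cis (a * 0) / (\<i> * a)) {0..1}"
  proof (rule fundamental_theorem_of_calculus)
    fix x :: real
    have "((\<lambda>x. cis (a * x) / (\<i> * a)) has_vector_derivative (a *\<^sub>R (\<i> * cis (a * x))) / (\<i> * a)) (at x within {0..1})"
      unfolding has_vector_derivative_def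
      by (auto intro!: derivative_eq_intros simp: scaleR_conv_of_real mult.left_commute)
    then show "((\<lambda>x. cis (a * x) / (\<i> * a)) has_vector_derivative cis (a * x)) (at x within {0..1})"
      using a by (simp add: scaleR_conv_of_real)
  qed simp
  moreover have "cis (a * 1) = 1" unfolding a_def by (simp add: cis_multiple_2pi)
  ultimately show ?thesis using False by (simp add: a_def integral_unique)
qed simp

lemma cos_series_fourier_coefficient:
  assumes b: "\<beta> > 0"
  shows "integral {0..1} (\<lambda>x. complex_of_real (1 + (\<Sum>k. cos_term \<beta> k x)) * cis (2 * pi * of_int p * x)) =
           complex_of_real (exp (- (pi\<^sup>2 * (of_int p)\<^sup>2 / \<beta>)))" (is "?I = ?R")
proof -
  let ?f = "\<lambda>k x. complex_of_real (cos_term \<beta> k x) * cis (2 * pi * of_int p * x)"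
  let ?g = "\<lambda>x. complex_of_real (\<Sum>k. cos_term \<beta> k x) * cis (2 * pi * of_int p * x)"
  let ?e = "\<lambda>k. complex_of_real (exp (- (pi\<^sup>2 * (real k + 1)\<^sup>2 / \<beta>)))"
  have s: "(\<lambda>k. integral {0..1} (?f k)) sums integral {0..1} ?g"
    by (rule fourier_coefficient_sums[OF cos_term_continuous _ cos_term_bound_summable[OF b]])
       (use cos_term_bound[OF b] in auto)
  \<comment> \<open>Against the character \<open>p\<close>, the cosine of index \<open>k\<close> has
    the frequencies \<open>p + (k + 1)\<close> and \<open>p - (k + 1)\<close>; at most one of them
    vanishes, and exactly when \<open>k + 1 = \<bar>p\<bar>\<close>.\<close>
  have coeff: "integral {0..1} (?f k) = (if int k + 1 = \<bar>p\<bar> then ?e k else 0)" for k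
  proof -
    have "?f k x = ?e k * cis (2 * pi * of_int (p + (int k + 1)) * x) +
        ?e k * cis (2 * pi * of_int (p - (int k + 1)) * x)" for x
    proof -
      have c: "complex_of_real (2 * cos y) = cis y + cis (- y)" for y by (simp add: complex_eq_iff)
      have "?f k x = ?e k * (complex_of_real (2 * cos (2 * pi * (real k + 1) * x)) * cis (2 * pi * of_int p * x))"
        by (simp add: cos_term_def)
      also have "complex_of_real (2 * cos (2 * pi * (real k + 1) * x)) * cis (2 * pi * of_int p * x) =
         cis (2 * pi * of_int (p + (int k + 1)) * x) + cis (2 * pi * of_int (p - (int k + 1)) * x)"
        unfolding c ring_distribs cis_mult by (simp add: algebra_simps)
      finally show ?thesis by (simp add: ring_distribs)
    qed
    moreover have "(\<lambda>x. ?e k * cis (2 * pi * of_int q * x)) integrable_on {0..1}" for q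
      by (intro integrable_continuous_interval continuous_intros)
    ultimately have "integral {0..1} (?f k) = ?e k * (if p + (int k + 1) = 0 then 1 else 0) +
        ?e k * (if p - (int k + 1) = 0 then 1 else 0)"
      by (simp only: Henstock_Kurzweil_Integration.integral_add integral_mult_right integral_cis_unit_interval)
    also have "\<dots> = (if int k + 1 = \<bar>p\<bar> then ?e k else 0)" by auto
    finally show ?thesis .
  qed
  have "(\<lambda>k. integral {0..1} (?f k)) sums (if p = 0 then 0 else ?R)"
  proof (cases "p = 0")
    case False
    define k0 where "k0 = nat (\<bar>p\<bar> - 1)"
    have k0: "int k0 + 1 = \<bar>p\<bar>" using False by (simp add: k0_def)
    then have "real_of_int (int k0 + 1) = real_of_int \<bar>p\<bar>" by (rule arg_cong)
    then have k0': "real k0 + 1 = \<bar>of_int p\<bar>" by simp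
    have "integral {0..1} (?f k) = 0" if "k \<notin> {k0}" for k
      using that k0 unfolding coeff by auto
    then have "(\<lambda>k. integral {0..1} (?f k)) sums (\<Sum>k\<in>{k0}. integral {0..1} (?f k))"
      by (intro sums_finite) auto
    then show ?thesis
      using False by (simp add: coeff k0 k0')
  next
    case True
    then have "(\<lambda>k. integral {0..1} (?f k)) = (\<lambda>_. 0)"
      unfolding coeff by (intro ext) auto
    then show ?thesis using True by (simp only: simp_thms if_True sums_zero)
  qed
  then have g: "integral {0..1} ?g = (if p = 0 then 0 else ?R)" using s sums_unique2 by blast
  have "?I = integral {0..1} (\<lambda>x. cis (2 * pi * of_int p * x) + ?g x)"
    by (simp add: ring_distribs)
  also have "\<dots> = integral {0..1} (\<lambda>x. cis (2 * pi * of_int p * x)) + integral {0..1} ?g"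
    by (intro Henstock_Kurzweil_Integration.integral_add integrable_continuous_interval continuous_intros
         continuous_on_subset[OF cos_term_suminf_continuous[OF b]]) auto
  also have "\<dots> = ?R" unfolding g integral_cis_unit_interval by simp
  finally show ?thesis .
qed

text \<open>Both sides are continuous, 1-periodic and have the same Fourier coefficients, so their
  difference is \<open>fourier_null\<close>. Uniqueness gives equality at every point without a
  theorem on pointwise convergence of Fourier series.\<close>

theorem poisson_summation_gaussian:
  assumes b: "\<beta> > 0"
  shows "(\<Sum>k. gauss_pair \<beta> k x) = sqrt (pi / \<beta>) * (1 + (\<Sum>k. cos_term \<beta> k x))"
proof -
  define D where "D = (\<lambda>x. (\<Sum>k. gauss_pair \<beta> k x) - sqrt (pi / \<beta>) * (1 + (\<Sum>k. cos_term \<beta> k x)))"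
  have per: "D (x + 1) = D x" for x
    by (simp add: D_def gauss_pair_suminf_periodic[OF b] cos_term_periodic)
  have cont: "continuous_on UNIV D" unfolding D_def
    by (intro continuous_intros gauss_pair_suminf_continuous cos_term_suminf_continuous b)
  have "fourier_null D" unfolding fourier_null_def
  proof (intro conjI allI)
    fix p :: int
    let ?c = "\<lambda>x. cis (2 * pi * of_int p * x)"
    have "integral {0..1} (\<lambda>x. complex_of_real (D x) * ?c x) =
       integral {0..1} (\<lambda>x. complex_of_real (\<Sum>k. gauss_pair \<beta> k x) * ?c x -
         of_real (sqrt (pi / \<beta>)) * (complex_of_real (1 + (\<Sum>k. cos_term \<beta> k x)) * ?c x))"
      unfolding D_def of_real_diff of_real_mult left_diff_distrib mult.assoc ..
    also have "\<dots> = integral {0..1} (\<lambda>x. complex_of_real (\<Sum>k. gauss_pair \<beta> k x) * ?c x) -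
        integral {0..1} (\<lambda>x. of_real (sqrt (pi / \<beta>)) * (complex_of_real (1 + (\<Sum>k. cos_term \<beta> k x)) * ?c x))"
      by (intro Henstock_Kurzweil_Integration.integral_diff integrable_continuous_interval continuous_intros
         continuous_on_subset[OF cos_term_suminf_continuous[OF b]]
         continuous_on_subset[OF gauss_pair_suminf_continuous[OF b]]) auto
    also have "\<dots> = 0"
      unfolding integral_mult_right gauss_pair_fourier_coefficient[OF b] cos_series_fourier_coefficient[OF b]
      by simp
    finally show "integral {0..1} (\<lambda>x. complex_of_real (D x) * ?c x) = 0" .
  qed (rule cont)
  then have D0: "D x = 0" if "x \<in> {0..1}" for x using per that by (rule fourier_null_imp_zero)
  have nat: "D (x + real n) = D x" for x n
    by (induction n) (auto simp: per add.assoc[symmetric] add.commute[of 1])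
  have "D x = D (frac x)"
  proof (cases "x \<ge> 0")
    case True
    then have "x = frac x + real (nat \<lfloor>x\<rfloor>)" by (simp add: frac_def)
    then show ?thesis using nat by metis
  next
    case False
    then have "frac x = x + real (nat (- \<lfloor>x\<rfloor>))" by (simp add: frac_def)
    then show ?thesis using nat by metis
  qed
  also have "\<dots> = 0" by (rule D0) (auto simp: frac_lt_1 less_imp_le)
  finally show ?thesis by (simp add: D_def)
qed

section \<open>The grid function and the gathering sum as sums of products\<close>

lemma lborel_vec_prod:
  fixes f :: "'n::finite \<Rightarrow> real \<Rightarrow> complex"
  assumes int: "\<And>d. integrable lborel (f d)"
  shows "integrable lborel (\<lambda>k::real^'n. \<Prod>d\<in>UNIV. f d (k $ d))"
    and "(LINT k|lborel. (\<Prod>d\<in>UNIV. f d ((k::real^'n) $ d))) = (\<Prod>d\<in>UNIV. (LINT x|lborel. f d x))"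
proof -
  interpret product_sigma_finite "\<lambda>_::real^'n. lborel :: real measure" by standard
  let ?P = "\<Pi>\<^sub>M b\<in>(Basis :: (real^'n) set). (lborel :: real measure)"
  let ?h = "\<lambda>g. \<Sum>b\<in>(Basis :: (real^'n) set). g b *\<^sub>R b"
  \<comment> \<open>The product measure is indexed by basis vectors while \<open>f\<close> is
    indexed by coordinates; \<open>F\<close> recovers \<open>d\<close> from
    \<open>axis d 1\<close>.\<close>
  define F where "F = (\<lambda>b::real^'n. f (THE d. b = axis d 1))"
  have the: "(THE d'. axis d (1::real) = axis d' 1) = d" for d :: 'n
    by (rule the_equality) (auto simp: axis_eq_axis)
  have F: "F (axis d 1) = f d" for d by (simp add: F_def the)
  have inj: "inj (\<lambda>d::'n. axis d (1::real))" by (auto simp: inj_on_def axis_eq_axis)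
  have Basis: "(Basis :: (real^'n) set) = range (\<lambda>d. axis d 1)"
    by (auto simp: Basis_vec_def)
  have prod: "(\<Prod>b\<in>Basis. H b) = (\<Prod>d\<in>UNIV. H (axis d 1))" for H :: "real^'n \<Rightarrow> complex"
    unfolding Basis by (simp add: prod.reindex[OF inj])
  have comp: "?h g $ d = g (axis d 1)" for g d
  proof -
    have "?h g $ d = ?h g \<bullet> axis d 1" by (simp add: cart_eq_inner_axis)
    also have "\<dots> = g (axis d 1)"
      by (rule inner_sum_left_Basis) (simp add: Basis)
    finally show ?thesis .
  qed
  have [measurable]: "f d \<in> borel_measurable borel" for d
    using borel_measurable_integrable[OF int[of d]] by simp
  have m: "?h \<in> measurable ?P borel" by measurable
  have m': "(\<lambda>k::real^'n. \<Prod>d\<in>UNIV. f d (k $ d)) \<in> borel_measurable borel"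
    by (intro borel_measurable_prod measurable_compose[OF _ \<open>f _ \<in> _\<close>]
        borel_measurable_continuous_onI continuous_intros)
  have eq: "(\<Prod>d\<in>UNIV. f d (?h g $ d)) = (\<Prod>b\<in>Basis. F b (g b))" for g
    unfolding prod F comp ..
  have intF: "integrable lborel (F b)" for b by (simp add: F_def int)
  show "integrable lborel (\<lambda>k::real^'n. \<Prod>d\<in>UNIV. f d (k $ d))"
    by (subst lborel_eq, subst integrable_distr_eq[OF m m'], subst eq)
       (rule product_integrable_prod, auto simp: intF)
  show "(LINT k|lborel. (\<Prod>d\<in>UNIV. f d ((k::real^'n) $ d))) = (\<Prod>d\<in>UNIV. (LINT x|lborel. f d x))"
    by (subst lborel_eq, subst integral_distr[OF m m'], subst eq,
        subst product_integral_prod) (auto simp: intF prod F)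
qed

lemma cis_sum: "cis (\<Sum>i\<in>A. f i) = (\<Prod>i\<in>A. cis (f i))"
  by (induction A rule: infinite_finite_induct) (auto simp: cis_mult[symmetric])

text \<open>Each one-dimensional integral yields a factor \<open>2 * pi\<close>, and three of them
  cancel the prefactor of \<open>whole_space_op\<close>; what remains is a product of normalised
  Gaussians of squared width \<open>a d\<close>.\<close>

lemma whole_space_op_gaussian:
  fixes y :: "real^3"
  assumes a: "\<And>d. a d > 0"
  defines "f \<equiv> \<lambda>k::real^3. complex_of_real (\<Prod>d\<in>UNIV. exp (- (a d * (k $ d)\<^sup>2 / 4))) * cis (k \<bullet> y)"
  shows "integrable lborel f"
    and "whole_space_op f = complex_of_real (\<Prod>d\<in>UNIV. exp (- ((y $ d)\<^sup>2 / a d)) / sqrt (pi * a d))"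
proof -
  define g where "g = (\<lambda>d x. complex_of_real (exp (- (a d / 4) * x\<^sup>2)) * cis (y $ d * x))"
  have f: "f = (\<lambda>k. \<Prod>d\<in>UNIV. g d (k $ d))"
    unfolding f_def g_def by (simp add: inner_vec_def cis_sum prod.distrib of_real_prod mult.commute)
  have a4: "a d / 4 > 0" for d using a by simp
  have int: "integrable lborel (g d)" for d unfolding g_def by (rule gaussian_fourier(1)[OF a4])
  show "integrable lborel f" unfolding f by (rule lborel_vec_prod[OF int])
  have g: "(LINT x|lborel. g d x) = complex_of_real (2 * pi * (exp (- ((y $ d)\<^sup>2 / a d)) / sqrt (pi * a d)))" for d
  proof -
    have "sqrt (pi / (a d / 4)) = 2 * (sqrt pi / sqrt (a d))"
      by (simp add: real_sqrt_divide real_sqrt_mult)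
    also have "sqrt pi / sqrt (a d) = pi / sqrt (pi * a d)"
      using a[of d] by (simp add: real_sqrt_mult field_simps)
    finally show ?thesis unfolding g_def using gaussian_fourier(2)[OF a4, of d "y $ d"] by simp
  qed
  have "(LINT k|lborel. f k) = complex_of_real ((2 * pi) ^ 3 * (\<Prod>d\<in>UNIV. exp (- ((y $ d)\<^sup>2 / a d)) / sqrt (pi * a d)))"
    unfolding f lborel_vec_prod(2)[OF int] g of_real_prod[symmetric] prod.distrib by simp
  then show "whole_space_op f = complex_of_real (\<Prod>d\<in>UNIV. exp (- ((y $ d)\<^sup>2 / a d)) / sqrt (pi * a d))"
    unfolding whole_space_op_def of_real_mult[symmetric] by simp
qed

text \<open>The representation of \<open>F\<close> is required off the origin only, because the
  quotients by \<open>(norm k)\<^sup>2\<close> take the default value 0 there; a single point is a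
  null set.\<close>

lemma whole_space_op_gaussian_sum:
  fixes y :: "'i \<Rightarrow> real^3"
  assumes I: "finite I" and a: "\<And>i d. i \<in> I \<Longrightarrow> a i d > 0"
    and F: "\<And>k. k \<noteq> 0 \<Longrightarrow> F k = (\<Sum>i\<in>I. c i *
        (complex_of_real (\<Prod>d\<in>UNIV. exp (- (a i d * (k $ d)\<^sup>2 / 4))) * cis (k \<bullet> y i)))"
  shows "whole_space_op F =
    (\<Sum>i\<in>I. c i * complex_of_real (\<Prod>d\<in>UNIV. exp (- ((y i $ d)\<^sup>2 / a i d)) / sqrt (pi * a i d)))"
proof -
  let ?f = "\<lambda>i k. complex_of_real (\<Prod>d\<in>UNIV. exp (- (a i d * (k $ d)\<^sup>2 / 4))) * cis (k \<bullet> y i)"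
  have "(LINT k|lborel. F k) = (LINT k|lborel. (\<Sum>i\<in>I. c i * ?f i k))"
    by (rule integral_discrete_difference[of "{0}"]) (auto simp: F)
  also have "\<dots> = (\<Sum>i\<in>I. c i * (LINT k|lborel. ?f i k))"
    using whole_space_op_gaussian(1)[OF a] by (subst Bochner_Integration.integral_sum) auto
  finally have "whole_space_op F = (\<Sum>i\<in>I. c i * whole_space_op (?f i))"
    by (simp add: whole_space_op_def sum_distrib_left mult_ac)
  then show ?thesis using whole_space_op_gaussian(2)[OF a] by simp
qed

lemma norm_sq_vec: "(norm k)\<^sup>2 = (\<Sum>d\<in>UNIV. (k $ d)\<^sup>2)" for k :: "real^'n"
  by (simp add: norm_vec_def L2_set_def sum_nonneg)

definition amplitude :: "(nat \<Rightarrow> real) \<Rightarrow> (nat \<Rightarrow> real) \<Rightarrow> nat \<Rightarrow> real" where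
  "amplitude w s l = sqrt pi / 4 * (w l * s l ^ 3)"

lemma tau_mid_div:
  assumes "k \<noteq> 0"
  shows "tau_mid w s m k / (norm k)\<^sup>2 =
    (\<Sum>l\<le>m. amplitude w s l * (\<Prod>d\<in>UNIV. exp (- ((s l)\<^sup>2 * (k $ d)\<^sup>2 / 4))))"
proof -
  have "exp (- (s l)\<^sup>2 * (norm k)\<^sup>2 / 4) = (\<Prod>d\<in>UNIV. exp (- ((s l)\<^sup>2 * (k $ d)\<^sup>2 / 4)))" for l
    unfolding norm_sq_vec
    by (simp add: exp_sum[symmetric] sum_distrib_left sum_negf sum_divide_distrib)
  then have "tau_mid w s m k = (norm k)\<^sup>2 *
    (\<Sum>l\<le>m. amplitude w s l * (\<Prod>d\<in>UNIV. exp (- ((s l)\<^sup>2 * (k $ d)\<^sup>2 / 4))))"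
    unfolding tau_mid_def amplitude_def by (simp add: sum_distrib_left mult_ac)
  then show ?thesis using assms by simp
qed

lemma Phi_mid_eq:
  assumes s: "\<And>l. s l > 0"
  shows "Phi_mid whole_space_op w s m V i = 4 * complex_of_real pi *
    (\<Sum>l\<le>m. complex_of_real (amplitude w s l) * (\<Sum>j=1..num V. complex_of_real (charge V j) *
       complex_of_real (\<Prod>d\<in>UNIV. exp (- ((pos V i $ d - pos V j $ d)\<^sup>2 / (s l)\<^sup>2)) / sqrt (pi * (s l)\<^sup>2))))"
proof -
  have "whole_space_op (\<lambda>k. complex_of_real (tau_mid w s m k / (norm k)\<^sup>2) * cis (k \<bullet> (pos V i - pos V j))) =
     (\<Sum>l\<le>m. complex_of_real (amplitude w s l) * complex_of_real
        (\<Prod>d\<in>UNIV. exp (- (((pos V i - pos V j) $ d)\<^sup>2 / (s l)\<^sup>2)) / sqrt (pi * (s l)\<^sup>2)))" for j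
    by (rule whole_space_op_gaussian_sum)
       (use s in \<open>auto simp: tau_mid_div sum_distrib_right sum_distrib_left mult_ac less_imp_neq[symmetric]\<close>)
  then show ?thesis
    unfolding Phi_mid_def by (simp add: sum_distrib_left mult_ac sum.swap[of _ "{..m}"])
qed

text \<open>The integral of the untruncated Gaussian window, that is, \<open>W_GS_hat\<close> at
  frequency 0.\<close>

definition window_mass :: "solver \<Rightarrow> 3 \<Rightarrow> real" where
  "window_mass V d = sqrt (pi / shape V) * halfw V $ d"

text \<open>Dividing by the squared window transform and multiplying by it once leaves a single
  division. Dividing a Gaussian of squared width \<open>(s l)\<^sup>2\<close> by one of squared
  width \<open>(halfw V $ d)\<^sup>2 / shape V\<close> subtracts the widths, whence
  \<open>mu\<close>; its positivity makes the quotient integrable.\<close>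

lemma S_scal_eq:
  assumes S: "shape V > 0" and H: "\<And>d. halfw V $ d > 0"
    and mu: "\<And>l d. l \<le> m \<Longrightarrow> mu s V l d > 0"
  shows "S_scal whole_space_op w s m V r =
    (\<Sum>l\<le>m. complex_of_real (amplitude w s l) * (\<Sum>j=1..num V. complex_of_real (charge V j) *
       complex_of_real (\<Prod>d\<in>UNIV. exp (- ((r $ d - pos V j $ d)\<^sup>2 / mu s V l d)) /
          (sqrt (pi * mu s V l d) * window_mass V d))))"
proof -
  define M where "M = (\<Prod>d\<in>UNIV. window_mass V d)"
  let ?I = "{..m} \<times> {1..num V}"
  let ?c = "\<lambda>(l, j). complex_of_real (amplitude w s l * charge V j / M)"
  let ?e = "\<lambda>l k. \<Prod>d\<in>UNIV. exp (- (mu s V l d * (k $ d)\<^sup>2 / 4))"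
  have win: "window_hat V k = M * (\<Prod>d\<in>UNIV. exp (- ((halfw V $ d)\<^sup>2 / shape V * (k $ d)\<^sup>2 / 4)))" for k
    unfolding window_hat_def W_GS_hat_def M_def window_mass_def prod.distrib[symmetric]
    by (intro prod.cong) (auto simp: mult_ac)
  have M: "M > 0" unfolding M_def window_mass_def using S H by (intro prod_pos) auto
  have pos: "window_hat V k > 0" for k
    unfolding win using M by (intro mult_pos_pos prod_pos) auto
  have split: "(\<Prod>d\<in>UNIV. exp (- ((s l)\<^sup>2 * (k $ d)\<^sup>2 / 4))) = window_hat V k / M * ?e l k" for l k
  proof -
    have "window_hat V k / M * ?e l k = (\<Prod>d\<in>UNIV. exp (- ((halfw V $ d)\<^sup>2 / shape V * (k $ d)\<^sup>2 / 4)) *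
        exp (- (mu s V l d * (k $ d)\<^sup>2 / 4)))"
      unfolding win prod.distrib using M by simp
    also have "\<dots> = (\<Prod>d\<in>UNIV. exp (- ((s l)\<^sup>2 * (k $ d)\<^sup>2 / 4)))"
      by (intro prod.cong refl) (simp add: exp_add[symmetric] mu_def field_simps)
    finally show ?thesis by simp
  qed
  have F: "S_scal_hat w s m V k * cis (k \<bullet> r) = (\<Sum>i\<in>?I. ?c i *
        (complex_of_real (\<Prod>d\<in>UNIV. exp (- (mu s V (fst i) d * (k $ d)\<^sup>2 / 4))) * cis (k \<bullet> (r - pos V (snd i)))))"
    if "k \<noteq> 0" for k
  proof -
    have t: "tau_mid w s m k / ((norm k)\<^sup>2 * \<bar>window_hat V k\<bar>\<^sup>2) =
      (\<Sum>l\<le>m. amplitude w s l * ?e l k) / (M * window_hat V k)"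
    proof -
      have "tau_mid w s m k / (norm k)\<^sup>2 = (\<Sum>l\<le>m. amplitude w s l * (window_hat V k / M * ?e l k))"
        unfolding tau_mid_div[OF that] split ..
      also have "\<dots> = window_hat V k / M * (\<Sum>l\<le>m. amplitude w s l * ?e l k)"
        by (simp add: sum_distrib_left mult_ac)
      finally have "tau_mid w s m k / (norm k)\<^sup>2 / (window_hat V k)\<^sup>2 =
         window_hat V k / M * (\<Sum>l\<le>m. amplitude w s l * ?e l k) / (window_hat V k)\<^sup>2" by simp
      then show ?thesis using pos[of k] by (simp add: power2_eq_square)
    qed
    have "complex_of_real (charge V j * window_hat V k) * cis (- (k \<bullet> pos V j)) * cis (k \<bullet> r) =
       complex_of_real (window_hat V k) * (complex_of_real (charge V j) * cis (k \<bullet> (r - pos V j)))" for j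
    proof -
      have "cis (k \<bullet> (r - pos V j)) = cis (- (k \<bullet> pos V j)) * cis (k \<bullet> r)"
        by (simp add: cis_mult inner_diff_right)
      then show ?thesis by simp
    qed
    then have q: "(\<Sum>j=1..num V. complex_of_real (charge V j * window_hat V k) * cis (- (k \<bullet> pos V j))) * cis (k \<bullet> r) =
       complex_of_real (window_hat V k) * (\<Sum>j=1..num V. complex_of_real (charge V j) * cis (k \<bullet> (r - pos V j)))"
      unfolding sum_distrib_right sum_distrib_left by (intro sum.cong refl)
    have "S_scal_hat w s m V k * cis (k \<bullet> r) =
      complex_of_real ((\<Sum>l\<le>m. amplitude w s l * ?e l k) / (M * window_hat V k)) *
      (complex_of_real (window_hat V k) * (\<Sum>j=1..num V. complex_of_real (charge V j) * cis (k \<bullet> (r - pos V j))))"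
      unfolding S_scal_hat_def t mult.assoc q ..
    also have "\<dots> = complex_of_real (\<Sum>l\<le>m. amplitude w s l / M * ?e l k) *
        (\<Sum>j=1..num V. complex_of_real (charge V j) * cis (k \<bullet> (r - pos V j)))"
    proof -
      have "A / (M * window_hat V k) * window_hat V k = A / M" for A using pos[of k] by simp
      then have cancel: "complex_of_real (A / (M * window_hat V k)) * (complex_of_real (window_hat V k) * B) =
          complex_of_real (A / M) * B" for A B
        unfolding mult.assoc[symmetric] of_real_mult[symmetric] by (simp only:)
      show ?thesis unfolding cancel by (simp add: sum_divide_distrib)
    qed
    also have "\<dots> = (\<Sum>l\<le>m. \<Sum>j=1..num V. complex_of_real (amplitude w s l * charge V j / M) *
       (complex_of_real (?e l k) * cis (k \<bullet> (r - pos V j))))"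
      unfolding of_real_sum sum_product by (intro sum.cong refl) (simp add: mult_ac)
    finally show ?thesis by (simp add: sum.cartesian_product split_def)
  qed
  have "S_scal whole_space_op w s m V r = (\<Sum>i\<in>?I. ?c i * complex_of_real
     (\<Prod>d\<in>UNIV. exp (- (((r - pos V (snd i)) $ d)\<^sup>2 / mu s V (fst i) d)) / sqrt (pi * mu s V (fst i) d)))"
    unfolding S_scal_def by (rule whole_space_op_gaussian_sum[OF _ _ F]) (use mu in auto)
  also have "\<dots> = (\<Sum>l\<le>m. \<Sum>j=1..num V. complex_of_real (amplitude w s l) * (complex_of_real (charge V j) *
       complex_of_real ((\<Prod>d\<in>UNIV. exp (- ((r $ d - pos V j $ d)\<^sup>2 / mu s V l d)) / sqrt (pi * mu s V l d)) / M)))"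
    unfolding sum.cartesian_product by (intro sum.cong) (auto simp: split_def)
  also have "\<dots> = (\<Sum>l\<le>m. complex_of_real (amplitude w s l) * (\<Sum>j=1..num V. complex_of_real (charge V j) *
       complex_of_real (\<Prod>d\<in>UNIV. exp (- ((r $ d - pos V j $ d)\<^sup>2 / mu s V l d)) /
          (sqrt (pi * mu s V l d) * window_mass V d))))"
    unfolding M_def prod_dividef[symmetric] sum_distrib_left by (simp add: divide_divide_eq_left)
  finally show ?thesis .
qed

lemma prod_three: "(\<Prod>d\<in>UNIV. f d) = f 1 * f 2 * f (3::3)"
  unfolding UNIV_3 by (simp add: mult_ac)

lemma sum_int_vec_prod:
  fixes f :: "'n::finite \<Rightarrow> int \<Rightarrow> 'a::comm_semiring_1"
  assumes "\<And>d. finite (B d)"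
  shows "(\<Sum>n\<in>{n::int^'n. \<forall>d. n $ d \<in> B d}. \<Prod>d\<in>UNIV. f d (n $ d)) = (\<Prod>d\<in>UNIV. \<Sum>k\<in>B d. f d k)"
proof -
  have "(\<Sum>n\<in>{n::int^'n. \<forall>d. n $ d \<in> B d}. \<Prod>d\<in>UNIV. f d (n $ d)) =
     (\<Sum>g\<in>PiE UNIV B. \<Prod>d\<in>UNIV. f d (g d))"
    by (rule sum.reindex_bij_witness[of _ "\<lambda>g. \<chi> d. g d" "\<lambda>n d. n $ d"]) auto
  then show ?thesis using assms by (simp add: prod_sum_PiE)
qed

text \<open>One-dimensional trapezoidal sum for a normalised source Gaussian of squared width
  \<open>a\<close> at \<open>x\<close>. Mesh size and window mass are included, so that the product
  over \<open>d\<close> is the whole gathering sum of one charge at one level.\<close>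

definition gather_factor :: "solver \<Rightarrow> nat \<Rightarrow> 3 \<Rightarrow> real \<Rightarrow> real \<Rightarrow> real" where
  "gather_factor V i d a x = (\<Sum>n | \<bar>real_of_int n\<bar> \<le> (real (npts V d) - 1) / 2.
     mesh V $ d * exp (- ((gridpt V i $ d + of_int n * mesh V $ d - x)\<^sup>2 / a)) / (sqrt (pi * a) * window_mass V d) *
     window_1d_per V d (pos V i $ d - gridpt V i $ d - of_int n * mesh V $ d))"

lemma finite_int_abs_le: "finite {n::int. \<bar>real_of_int n\<bar> \<le> x}"
  by (rule finite_subset[of _ "{- \<lceil>x\<rceil>..\<lceil>x\<rceil>}"]) (auto simp: abs_le_iff, linarith+)

lemma gather_sum_eq:
  assumes S: "shape V > 0" and H: "\<And>d. halfw V $ d > 0"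
    and mu: "\<And>l d. l \<le> m \<Longrightarrow> mu s V l d > 0"
  shows "gather_sum whole_space_op w s m V i = 4 * complex_of_real pi *
    (\<Sum>l\<le>m. complex_of_real (amplitude w s l) * (\<Sum>j=1..num V. complex_of_real (charge V j) *
       complex_of_real (\<Prod>d\<in>UNIV. gather_factor V i d (mu s V l d) (pos V j $ d))))"
proof -
  let ?N = "{n :: int^3. \<forall>d. \<bar>real_of_int (n $ d)\<bar> \<le> (real (npts V d) - 1) / 2}"
  let ?g = "\<lambda>l j d k. exp (- ((gridpt V i $ d + of_int k * mesh V $ d - pos V j $ d)\<^sup>2 / mu s V l d)) /
          (sqrt (pi * mu s V l d) * window_mass V d)"
  let ?w = "\<lambda>d k. window_1d_per V d (pos V i $ d - gridpt V i $ d - of_int k * mesh V $ d)"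
  have g: "gather_factor V i d (mu s V l d) (pos V j $ d) =
     (\<Sum>n | \<bar>real_of_int n\<bar> \<le> (real (npts V d) - 1) / 2. mesh V $ d * (?g l j d n * ?w d n))" for l j d
    by (simp add: gather_factor_def mult.assoc)
  have p: "(\<Prod>d\<in>UNIV. gather_factor V i d (mu s V l d) (pos V j $ d)) =
    (\<Prod>d\<in>UNIV. mesh V $ d) * (\<Sum>n\<in>?N. (\<Prod>d\<in>UNIV. ?g l j d (n $ d)) * (\<Prod>d\<in>UNIV. ?w d (n $ d)))" for l j
  proof -
    have "(\<Prod>d\<in>UNIV. gather_factor V i d (mu s V l d) (pos V j $ d)) =
      (\<Sum>n\<in>?N. \<Prod>d\<in>UNIV. mesh V $ d * (?g l j d (n $ d) * ?w d (n $ d)))"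
      unfolding g by (subst sum_int_vec_prod[symmetric, OF finite_int_abs_le]) simp
    then show ?thesis by (simp only: prod.distrib sum_distrib_left)
  qed
  have S_scal: "S_scal whole_space_op w s m V (\<chi> d. gridpt V i $ d + of_int (n $ d) * mesh V $ d) =
     (\<Sum>l\<le>m. complex_of_real (amplitude w s l) * (\<Sum>j=1..num V. complex_of_real (charge V j) *
       complex_of_real (\<Prod>d\<in>UNIV. ?g l j d (n $ d))))" for n
    using S_scal_eq[of V m s w "\<chi> d. gridpt V i $ d + of_int (n $ d) * mesh V $ d", OF S H mu] by simp
  have "gather_sum whole_space_op w s m V i = 4 * complex_of_real pi * (\<Sum>n\<in>?N.
     complex_of_real (\<Prod>d\<in>UNIV. mesh V $ d) *
     ((\<Sum>l\<le>m. complex_of_real (amplitude w s l) * (\<Sum>j=1..num V. complex_of_real (charge V j) *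
       complex_of_real (\<Prod>d\<in>UNIV. ?g l j d (n $ d)))) * complex_of_real (\<Prod>d\<in>UNIV. ?w d (n $ d))))"
    unfolding gather_sum_def S_scal by (simp only: sum_distrib_left mult.assoc)
  also have "(\<Sum>n\<in>?N. complex_of_real (\<Prod>d\<in>UNIV. mesh V $ d) *
     ((\<Sum>l\<le>m. complex_of_real (amplitude w s l) * (\<Sum>j=1..num V. complex_of_real (charge V j) *
       complex_of_real (\<Prod>d\<in>UNIV. ?g l j d (n $ d)))) * complex_of_real (\<Prod>d\<in>UNIV. ?w d (n $ d)))) =
     (\<Sum>n\<in>?N. \<Sum>l\<le>m. \<Sum>j=1..num V. complex_of_real (amplitude w s l) * (complex_of_real (charge V j) *
       complex_of_real ((\<Prod>d\<in>UNIV. mesh V $ d) * ((\<Prod>d\<in>UNIV. ?g l j d (n $ d)) * (\<Prod>d\<in>UNIV. ?w d (n $ d))))))"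
    unfolding sum_distrib_left sum_distrib_right of_real_mult by (intro sum.cong refl) (simp only: mult_ac)
  also have "\<dots> = (\<Sum>l\<le>m. \<Sum>j=1..num V. \<Sum>n\<in>?N. complex_of_real (amplitude w s l) * (complex_of_real (charge V j) *
       complex_of_real ((\<Prod>d\<in>UNIV. mesh V $ d) * ((\<Prod>d\<in>UNIV. ?g l j d (n $ d)) * (\<Prod>d\<in>UNIV. ?w d (n $ d))))))"
    by (subst sum.swap, rule sum.cong[OF refl], rule sum.swap)
  also have "\<dots> = (\<Sum>l\<le>m. complex_of_real (amplitude w s l) * (\<Sum>j=1..num V. complex_of_real (charge V j) *
       complex_of_real (\<Prod>d\<in>UNIV. gather_factor V i d (mu s V l d) (pos V j $ d))))"
    unfolding p by (simp only: sum_distrib_left of_real_sum)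
  finally show ?thesis .
qed

section \<open>Superpositions of modes and lattice sums\<close>

text \<open>
  Dual formulation of \<open>F = \<Sum>\<^sub>\<alpha> c\<^sub>\<alpha> \<phi>\<^sub>\<alpha>\<close> with \<open>\<phi>\<^sub>\<alpha> \<in> \<Phi>\<close> and \<open>\<Sum>\<^sub>\<alpha> |c\<^sub>\<alpha>| \<le> B\<close>: it is all that is needed to
  transfer the Debye--Hueckel bound from the modes \<open>\<Phi>\<close> to \<open>F\<close>, and it is stable under limits.
\<close>

definition superposition :: "'j set \<Rightarrow> ('j \<Rightarrow> complex) set \<Rightarrow> real \<Rightarrow> ('j \<Rightarrow> complex) \<Rightarrow> bool" where
  "superposition J \<Phi> B F \<longleftrightarrow> (\<forall>z D. (\<forall>\<phi>\<in>\<Phi>. cmod (\<Sum>j\<in>J. z j * \<phi> j) \<le> D) \<longrightarrow>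
     cmod (\<Sum>j\<in>J. z j * F j) \<le> B * D)"

lemma superpositionD:
  "superposition J \<Phi> B F \<Longrightarrow> (\<And>\<phi>. \<phi> \<in> \<Phi> \<Longrightarrow> cmod (\<Sum>j\<in>J. z j * \<phi> j) \<le> D) \<Longrightarrow>
     cmod (\<Sum>j\<in>J. z j * F j) \<le> B * D"
  unfolding superposition_def by blast

lemma superposition_base: "F \<in> \<Phi> \<Longrightarrow> superposition J \<Phi> 1 F"
  by (auto simp: superposition_def)

lemma superposition_cmult:
  assumes "superposition J \<Phi> B F" shows "superposition J \<Phi> (cmod c * B) (\<lambda>j. c * F j)"
proof -
  have "(\<Sum>j\<in>J. z j * (c * F j)) = c * (\<Sum>j\<in>J. z j * F j)" for z
    by (simp add: sum_distrib_left mult_ac)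
  then show ?thesis using assms
    by (auto simp: superposition_def norm_mult mult.assoc intro!: mult_left_mono)
qed

lemma superposition_zero: "superposition J \<Phi> 0 (\<lambda>j. 0)"
  by (auto simp: superposition_def)

lemma superposition_add:
  assumes "superposition J \<Phi> A F" "superposition J \<Phi> B G"
  shows "superposition J \<Phi> (A + B) (\<lambda>j. F j + G j)"
  unfolding superposition_def
proof (intro allI impI)
  fix z D assume *: "\<forall>\<phi>\<in>\<Phi>. cmod (\<Sum>j\<in>J. z j * \<phi> j) \<le> D"
  have "cmod (\<Sum>j\<in>J. z j * (F j + G j)) \<le> cmod (\<Sum>j\<in>J. z j * F j) + cmod (\<Sum>j\<in>J. z j * G j)"
    by (simp add: ring_distribs sum.distrib norm_triangle_ineq)
  also have "\<dots> \<le> A * D + B * D"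
    using * by (intro add_mono superpositionD[OF assms(1)] superpositionD[OF assms(2)]) auto
  finally show "cmod (\<Sum>j\<in>J. z j * (F j + G j)) \<le> (A + B) * D" by (simp add: ring_distribs)
qed

lemma superposition_sum:
  assumes "\<And>i. i \<in> I \<Longrightarrow> superposition J \<Phi> (B i) (F i)"
  shows "superposition J \<Phi> (\<Sum>i\<in>I. B i) (\<lambda>j. \<Sum>i\<in>I. F i j)"
  using assms
proof (induction I rule: infinite_finite_induct)
  case (insert i I)
  then show ?case using superposition_add[of J \<Phi> "B i" "F i" "\<Sum>i\<in>I. B i" "\<lambda>j. \<Sum>i\<in>I. F i j"] by simp
qed (auto simp: superposition_zero)

lemma superposition_mono:
  assumes "superposition J \<Phi> A F" "A \<le> B" "\<Phi> \<noteq> {}"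
  shows "superposition J \<Phi> B F"
  unfolding superposition_def
proof (intro allI impI)
  fix z D assume *: "\<forall>\<phi>\<in>\<Phi>. cmod (\<Sum>j\<in>J. z j * \<phi> j) \<le> D"
  obtain \<phi> where "\<phi> \<in> \<Phi>" using assms(3) by blast
  \<comment> \<open>A mode must exist here: \<open>D\<close> bounds a norm and hence cannot be
    negative, which allows enlarging the factor in front of it.\<close>
  with * have "D \<ge> 0" by (meson norm_ge_zero order_trans)
  have "cmod (\<Sum>j\<in>J. z j * F j) \<le> A * D" using * by (intro superpositionD[OF assms(1)]) auto
  also have "\<dots> \<le> B * D" using assms(2) \<open>D \<ge> 0\<close> by (rule mult_right_mono)
  finally show "cmod (\<Sum>j\<in>J. z j * F j) \<le> B * D" .
qed

text \<open>Each inequality in \<open>superposition\<close> is a closed condition on a sum over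
  \<open>J\<close>, so convergence at every \<open>j\<close> suffices, with no uniformity.\<close>

lemma superposition_limit:
  assumes F: "\<And>j. j \<in> J \<Longrightarrow> (\<lambda>n. F n j) \<longlonglongrightarrow> G j"
    and sup: "\<forall>\<^sub>F n in sequentially. superposition J \<Phi> B (F n)"
  shows "superposition J \<Phi> B G"
  unfolding superposition_def
proof (intro allI impI)
  fix z D assume *: "\<forall>\<phi>\<in>\<Phi>. cmod (\<Sum>j\<in>J. z j * \<phi> j) \<le> D"
  have "(\<lambda>n. cmod (\<Sum>j\<in>J. z j * F n j)) \<longlonglongrightarrow> cmod (\<Sum>j\<in>J. z j * G j)"
    by (intro tendsto_intros F)
  moreover have "\<forall>\<^sub>F n in sequentially. cmod (\<Sum>j\<in>J. z j * F n j) \<le> B * D"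
    using sup by eventually_elim (use * in \<open>auto intro: superpositionD\<close>)
  ultimately show "cmod (\<Sum>j\<in>J. z j * G j) \<le> B * D"
    by (intro tendsto_upperbound) auto
qed

text \<open>\<open>superposition\<close> quantifies over all coefficients \<open>z\<close>, so the
  factors of the other dimensions can be absorbed into them, and general factors replace modes one
  dimension at a time.\<close>

lemma superposition_prod3:
  assumes "superposition J \<Phi>1 B1 F1" "superposition J \<Phi>2 B2 F2" "superposition J \<Phi>3 B3 F3"
    and D: "\<And>\<phi>1 \<phi>2 \<phi>3. \<phi>1 \<in> \<Phi>1 \<Longrightarrow> \<phi>2 \<in> \<Phi>2 \<Longrightarrow> \<phi>3 \<in> \<Phi>3 \<Longrightarrow>
       cmod (\<Sum>j\<in>J. z j * (\<phi>1 j * \<phi>2 j * \<phi>3 j)) \<le> D"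
  shows "cmod (\<Sum>j\<in>J. z j * (F1 j * F2 j * F3 j)) \<le> B1 * (B2 * (B3 * D))"
proof -
  have 3: "cmod (\<Sum>j\<in>J. z j * \<phi>1 j * \<phi>2 j * F3 j) \<le> B3 * D" if "\<phi>1 \<in> \<Phi>1" "\<phi>2 \<in> \<Phi>2" for \<phi>1 \<phi>2
    by (rule superpositionD[OF assms(3)]) (use D[OF that] in \<open>simp add: mult_ac\<close>)
  have 2: "cmod (\<Sum>j\<in>J. z j * \<phi>1 j * F3 j * F2 j) \<le> B2 * (B3 * D)" if "\<phi>1 \<in> \<Phi>1" for \<phi>1
    by (rule superpositionD[OF assms(2)]) (use 3[OF that] in \<open>simp add: mult_ac\<close>)
  have "cmod (\<Sum>j\<in>J. z j * F3 j * F2 j * F1 j) \<le> B1 * (B2 * (B3 * D))"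
    by (rule superpositionD[OF assms(1)]) (use 2 in \<open>simp add: mult_ac\<close>)
  then show ?thesis by (simp add: mult_ac)
qed

text \<open>The one-dimensional factors of the charge sums in \<open>debye_hueckel\<close>: a plane
  wave times a Gaussian with arbitrary centre \<open>x\<close> and squared width from
  \<open>A\<close>.\<close>

definition gaussian_modes :: "('j \<Rightarrow> real) \<Rightarrow> real set \<Rightarrow> ('j \<Rightarrow> complex) set" where
  "gaussian_modes r A = {\<phi>. \<exists>k x. \<exists>a\<in>A. \<phi> = (\<lambda>j. cis (k * r j) * complex_of_real (exp (- ((x - r j)\<^sup>2 / a))))}"

lemma gaussian_mode: "a \<in> A \<Longrightarrow> (\<lambda>j. cis (k * r j) * complex_of_real (exp (- ((x - r j)\<^sup>2 / a)))) \<in> gaussian_modes r A"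
  by (auto simp: gaussian_modes_def)

lemma gaussian_mode0: "a \<in> A \<Longrightarrow> (\<lambda>j. complex_of_real (exp (- ((x - r j)\<^sup>2 / a)))) \<in> gaussian_modes r A"
  using gaussian_mode[of a A 0 r x] by simp

section \<open>Lattice sums of Gaussians and the complementary error function\<close>

text \<open>A value of \<open>\<bar>n\<bar> - K\<close> is taken by at most one nonnegative and one
  negative \<open>n\<close>, hence the factor 2.\<close>

lemma sum_int_le_twice_suminf:
  fixes f :: "int \<Rightarrow> real" and b :: "nat \<Rightarrow> real"
  assumes X: "finite X" and K: "\<And>n. n \<in> X \<Longrightarrow> K \<le> \<bar>n\<bar>"
    and le: "\<And>n. n \<in> X \<Longrightarrow> f n \<le> b (nat (\<bar>n\<bar> - K))"
    and b: "\<And>k. b k \<ge> 0" "summable b"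
  shows "(\<Sum>n\<in>X. f n) \<le> 2 * (\<Sum>k. b k)"
proof -
  have half: "(\<Sum>n\<in>Y. f n) \<le> (\<Sum>k. b k)" if Y: "Y \<subseteq> X" "inj_on (\<lambda>n. nat (\<bar>n\<bar> - K)) Y" for Y
  proof -
    have "(\<Sum>n\<in>Y. f n) \<le> (\<Sum>n\<in>Y. b (nat (\<bar>n\<bar> - K)))" using Y le by (intro sum_mono) auto
    also have "\<dots> = sum b ((\<lambda>n. nat (\<bar>n\<bar> - K)) ` Y)" by (simp add: sum.reindex[OF Y(2)])
    also have "\<dots> \<le> (\<Sum>k. b k)"
      using X Y finite_subset by (intro sum_le_suminf b) auto
    finally show ?thesis .
  qed
  have "inj_on (\<lambda>n. nat (\<bar>n\<bar> - K)) {n\<in>X. n \<ge> 0}" "inj_on (\<lambda>n. nat (\<bar>n\<bar> - K)) {n\<in>X. \<not> n \<ge> 0}"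
    using K by (auto simp: inj_on_def dest!: K)
  then have "(\<Sum>n | n \<in> X \<and> n \<ge> 0. f n) + (\<Sum>n | n \<in> X \<and> \<not> n \<ge> 0. f n) \<le> (\<Sum>k. b k) + (\<Sum>k. b k)"
    by (intro add_mono half) auto
  moreover have "(\<Sum>n\<in>X. f n) = (\<Sum>n | n \<in> X \<and> n \<ge> 0. f n) + (\<Sum>n | n \<in> X \<and> \<not> n \<ge> 0. f n)"
    using sum.Int_Diff[OF X, of f "{n. n \<ge> 0}"] by (simp add: Int_def set_diff_eq)
  ultimately show ?thesis by simp
qed

text \<open>With \<open>\<bar>n\<bar> = M + 1 + k\<close> the distance to \<open>\<theta>\<close> is
  at least \<open>M + 1/2 + k\<close>, whose square exceeds
  \<open>M\<^sup>2 + M * (1 + 2 * k)\<close>. For \<open>x = \<rho>\<^sup>2 * M\<close> the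
  geometric sum is \<open>1 / (exp x - exp (- x)) \<le> 1 / x\<close>, and
  \<open>\<rho> / x = 1 / sqrt S\<close>. The half mesh kept in the distance is what makes the bound
  uniform in \<open>\<rho>\<close>.\<close>

lemma lattice_gaussian_tail:
  assumes "S > 0" "M \<ge> (1::nat)" "\<rho> = sqrt S / M" "\<bar>\<theta>\<bar> \<le> 1 / 2"
    and X: "finite X" "\<And>n. n \<in> X \<Longrightarrow> \<bar>n\<bar> > int M"
  shows "(\<Sum>n\<in>X. \<rho> * exp (- \<rho>\<^sup>2 * (\<theta> - of_int n)\<^sup>2)) \<le> 2 * (exp (- S) / sqrt S)"
proof -
  have \<rho>: "\<rho> > 0" and S: "\<rho>\<^sup>2 * (real M)\<^sup>2 = S" "\<rho> * M = sqrt S" using assms by (auto simp: power_divide)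
  define x where "x = \<rho>\<^sup>2 * M"
  have x: "x > 0" using \<rho> assms by (simp add: x_def)
  define b where "b = (\<lambda>k. \<rho> * exp (- S) * exp (- x) * exp (- 2 * x) ^ k)"
  have b: "b k \<ge> 0" for k using \<rho> by (simp add: b_def)
  have sb: "summable b" unfolding b_def by (intro summable_mult summable_geometric) (simp add: x)
  have le: "\<rho> * exp (- \<rho>\<^sup>2 * (\<theta> - of_int n)\<^sup>2) \<le> b (nat (\<bar>n\<bar> - (int M + 1)))" if "n \<in> X" for n
  proof -
    define k where "k = nat (\<bar>n\<bar> - (int M + 1))"
    have n: "\<bar>of_int n\<bar> = real M + 1 + real k" using X(2)[OF that] by (simp add: k_def)
    have "real M + 1 / 2 + k \<le> \<bar>\<theta> - of_int n\<bar>" using n assms(4) by linarith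
    then have "(real M + 1 / 2 + k)\<^sup>2 \<le> (\<theta> - of_int n)\<^sup>2"
      by (metis (no_types, opaque_lifting) abs_le_square_iff abs_of_nonneg add_nonneg_nonneg of_nat_0_le_iff
          divide_nonneg_nonneg zero_le_one zero_le_numeral)
    moreover have "(real M)\<^sup>2 + M * (1 + 2 * real k) \<le> (real M + 1 / 2 + k)\<^sup>2"
      by (simp add: power2_eq_square algebra_simps)
    ultimately have "(real M)\<^sup>2 + M * (1 + 2 * real k) \<le> (\<theta> - of_int n)\<^sup>2" by simp
    then have "\<rho>\<^sup>2 * ((real M)\<^sup>2 + M * (1 + 2 * real k)) \<le> \<rho>\<^sup>2 * (\<theta> - of_int n)\<^sup>2"
      by (rule mult_left_mono) simp
    then have "S + x + 2 * x * k \<le> \<rho>\<^sup>2 * (\<theta> - of_int n)\<^sup>2"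
      unfolding S(1)[symmetric] x_def by (simp add: algebra_simps)
    then have "exp (- \<rho>\<^sup>2 * (\<theta> - of_int n)\<^sup>2) \<le> exp (- S + - x + real k * (- 2 * x))" by (simp add: mult_ac)
    also have "\<dots> = exp (- S) * exp (- x) * exp (- 2 * x) ^ k"
      by (simp only: exp_add exp_of_nat_mult)
    finally show ?thesis using \<rho> by (simp add: b_def k_def mult.assoc mult_left_mono)
  qed
  have "(\<Sum>n\<in>X. \<rho> * exp (- \<rho>\<^sup>2 * (\<theta> - of_int n)\<^sup>2)) \<le> 2 * (\<Sum>k. b k)"
    by (rule sum_int_le_twice_suminf[OF X(1) _ le b sb]) (use X(2) in fastforce)+
  also have "(\<Sum>k. b k) = \<rho> * exp (- S) * (exp (- x) / (1 - exp (- 2 * x)))"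
    unfolding b_def using x by (subst suminf_mult) (auto simp: suminf_geometric intro!: summable_geometric)
  also have "exp (- x) / (1 - exp (- 2 * x)) = 1 / (exp x - exp (- x))"
  proof -
    have "1 - exp (- 2 * x) = exp (- x) * (exp x - exp (- x))"
      by (simp add: right_diff_distrib exp_add[symmetric])
    then show ?thesis by simp
  qed
  also have "1 / (exp x - exp (- x)) \<le> 1 / x"
  proof -
    have "exp (- x) \<le> 1" using x by simp
    then have "x \<le> exp x - exp (- x)" using exp_ge_add_one_self[of x] by linarith
    then show ?thesis using x by (intro divide_left_mono mult_pos_pos) auto
  qed
  then have "\<rho> * exp (- S) * (1 / (exp x - exp (- x))) \<le> \<rho> * exp (- S) * (1 / x)"
    using \<rho> by (intro mult_left_mono) auto
  also have "\<rho> * exp (- S) * (1 / x) = exp (- S) / sqrt S"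
    unfolding S(2)[symmetric] x_def using \<rho> by (simp add: power2_eq_square)
  finally show ?thesis by simp
qed

text \<open>For \<open>n \<noteq> 0\<close> use
  \<open>\<bar>\<theta> - n\<bar> \<ge> \<bar>n\<bar> / 2\<close> and
  \<open>y\<^sup>2 \<ge> 2 * y - 1\<close> with \<open>y = \<rho> * \<bar>n\<bar> / 2\<close>. The
  geometric sum is \<open>1 / (exp \<rho> - 1) \<le> 1 / \<rho>\<close>, so the prefactor cancels
  and each half line costs at most \<open>exp 1\<close>; the remaining \<open>\<rho>\<close> is the
  term \<open>n = 0\<close>.\<close>

lemma lattice_gaussian_sum:
  fixes \<rho> \<theta> :: real
  assumes \<rho>: "\<rho> > 0" and \<theta>: "\<bar>\<theta>\<bar> \<le> 1 / 2" and X: "finite X"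
  shows "(\<Sum>n\<in>X. \<rho> * exp (- \<rho>\<^sup>2 * (\<theta> - of_int n)\<^sup>2)) \<le> \<rho> + 2 * exp 1"
proof -
  define b where "b = (\<lambda>k. \<rho> * exp 1 * exp (- \<rho>) * exp (- \<rho>) ^ k)"
  have b: "b k \<ge> 0" for k
    using \<rho> by (simp add: b_def)
  have sb: "summable b" unfolding b_def by (intro summable_mult summable_geometric) (simp add: \<rho>)
  have le: "\<rho> * exp (- \<rho>\<^sup>2 * (\<theta> - of_int n)\<^sup>2) \<le> b (nat (\<bar>n\<bar> - 1))" if "n \<noteq> 0" for n :: int
  proof -
    define k where "k = nat (\<bar>n\<bar> - 1)"
    have n: "\<bar>of_int n\<bar> = 1 + real k" using that by (simp add: k_def)
    have "(1 + real k) / 2 \<le> \<bar>\<theta> - of_int n\<bar>"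
      using n \<theta> abs_triangle_ineq2[of "of_int n" \<theta>] of_nat_0_le_iff[of k, where 'a = real]
      by (simp add: abs_minus_commute)
    then have "((1 + real k) / 2)\<^sup>2 \<le> (\<theta> - of_int n)\<^sup>2"
      using abs_le_square_iff[of "(1 + real k) / 2" "\<theta> - of_int n"] by simp
    then have "\<rho>\<^sup>2 * ((1 + real k) / 2)\<^sup>2 \<le> \<rho>\<^sup>2 * (\<theta> - of_int n)\<^sup>2"
      by (rule mult_left_mono) simp
    moreover have "\<rho> * (1 + real k) - 1 \<le> \<rho>\<^sup>2 * ((1 + real k) / 2)\<^sup>2"
    proof -
      have "(\<rho> * ((1 + real k) / 2) - 1)\<^sup>2 = \<rho>\<^sup>2 * ((1 + real k) / 2)\<^sup>2 - \<rho> * (1 + real k) + 1"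
        unfolding power2_diff power_mult_distrib by simp
      then show ?thesis using zero_le_power2[of "\<rho> * ((1 + real k) / 2) - 1"] by linarith
    qed
    ultimately have "exp (- \<rho>\<^sup>2 * (\<theta> - of_int n)\<^sup>2) \<le> exp (1 + - \<rho> + real k * (- \<rho>))" by (simp add: algebra_simps)
    also have "\<dots> = exp 1 * exp (- \<rho>) * exp (- \<rho>) ^ k"
      by (simp only: exp_add exp_of_nat_mult)
    finally show ?thesis using \<rho> by (simp add: b_def k_def mult.assoc mult_left_mono)
  qed
  let ?f = "\<lambda>n. \<rho> * exp (- \<rho>\<^sup>2 * (\<theta> - of_int n)\<^sup>2)"
  have "(\<Sum>n\<in>X. ?f n) \<le> (\<Sum>n\<in>insert 0 X. ?f n)"
    using X \<rho> by (intro sum_mono2) auto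
  also have "\<dots> = ?f 0 + (\<Sum>n\<in>X - {0}. ?f n)"
    using X by (simp add: sum.insert_remove)
  also have "\<dots> \<le> \<rho> + 2 * (\<Sum>k. b k)"
    by (intro add_mono sum_int_le_twice_suminf[of _ 1] le b sb) (use \<rho> X in \<open>auto simp: mult_le_cancel_left1\<close>)
  also have "(\<Sum>k. b k) = \<rho> * exp 1 * (exp (- \<rho>) / (1 - exp (- \<rho>)))"
    unfolding b_def using \<rho> by (subst suminf_mult) (auto simp: suminf_geometric intro!: summable_geometric)
  also have "exp (- \<rho>) / (1 - exp (- \<rho>)) = 1 / (exp \<rho> - 1)"
  proof -
    have "exp \<rho> * exp (- \<rho>) = 1" by (simp add: exp_add[symmetric])
    then show ?thesis using \<rho> by (simp add: field_simps)
  qed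
  also have "1 / (exp \<rho> - 1) \<le> 1 / \<rho>"
  proof -
    have "\<rho> \<le> exp \<rho> - 1" using exp_ge_add_one_self[of \<rho>] by linarith
    then show ?thesis using \<rho> by (intro divide_left_mono mult_pos_pos) auto
  qed
  then have "\<rho> * exp 1 * (1 / (exp \<rho> - 1)) \<le> \<rho> * exp 1 * (1 / \<rho>)"
    using \<rho> by (intro mult_left_mono) auto
  also have "\<rho> * exp 1 * (1 / \<rho>) = exp 1" using \<rho> by simp
  finally show ?thesis by simp
qed

text \<open>On \<open>[x, x + 1 / x]\<close> with \<open>x = sqrt S\<close> the integrand is at
  least \<open>exp (- (S + 2 + 1 / S))\<close> and the length is \<open>1 / x\<close>; the bound
  \<open>S \<ge> c0\<close> controls \<open>1 / S\<close>.\<close>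

lemma erfc_lower_bound:
  assumes "c0 > 0" "S \<ge> c0"
  shows "exp (- S) / sqrt S \<le> sqrt pi / 2 * exp (2 + 1 / c0) * erfc (sqrt S)"
proof -
  define x where "x = sqrt S"
  have x: "x > 0" "x\<^sup>2 = S" using assms by (auto simp: x_def)
  have "integrable lborel (\<lambda>t::real. exp (- t\<^sup>2))"
    using integrable_norm[OF gaussian_fourier(1)[of 1 0]] by simp
  then have int: "set_integrable lborel {x..} (\<lambda>t. exp (- t\<^sup>2))"
    unfolding set_integrable_def by (intro integrable_mult_indicator) auto
  have "exp (- S) / x * exp (- (2 + 1 / c0)) \<le> exp (- (x + 1 / x)\<^sup>2) * (1 / x)"
  proof -
    have "(x + 1 / x)\<^sup>2 = x\<^sup>2 + (2 + 1 / x\<^sup>2)" using x(1) by (simp add: power2_sum power_divide)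
    then have "(x + 1 / x)\<^sup>2 = S + (2 + 1 / S)" unfolding x(2) .
    moreover have "1 / S \<le> 1 / c0" using assms by (intro divide_left_mono mult_pos_pos) auto
    ultimately have "exp (- S) * exp (- (2 + 1 / c0)) \<le> exp (- (x + 1 / x)\<^sup>2)"
      by (simp add: exp_add[symmetric])
    then have "exp (- S) * exp (- (2 + 1 / c0)) * (1 / x) \<le> exp (- (x + 1 / x)\<^sup>2) * (1 / x)"
      using x by (intro mult_right_mono) auto
    then show ?thesis by (simp add: field_simps)
  qed
  also have "\<dots> = (LINT t:{x..x + 1 / x}|lborel. exp (- (x + 1 / x)\<^sup>2))"
    using x by (simp add: set_lebesgue_integral_def)
  also have "\<dots> \<le> (LINT t:{x..x + 1 / x}|lborel. exp (- t\<^sup>2))"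
  proof (rule set_integral_mono)
    show "set_integrable lborel {x..x + 1 / x} (\<lambda>t. exp (- (x + 1 / x)\<^sup>2))"
      using x by (simp add: set_integrable_def integrable_real_indicator)
    show "set_integrable lborel {x..x + 1 / x} (\<lambda>t. exp (- t\<^sup>2))"
      by (rule set_integrable_subset[OF int]) auto
    fix t assume "t \<in> {x..x + 1 / x}"
    then show "exp (- (x + 1 / x)\<^sup>2) \<le> exp (- t\<^sup>2)" using x by (auto intro!: power_mono)
  qed
  also have "\<dots> \<le> (LINT t:{x..}|lborel. exp (- t\<^sup>2))"
    unfolding set_lebesgue_integral_def
    by (rule integral_mono) (use int set_integrable_subset[OF int, of "{x..x + 1 / x}"] in
       \<open>auto simp: set_integrable_def indicator_def\<close>)
  also have "\<dots> = sqrt pi / 2 * erfc x"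
    by (simp add: erfc_def)
  finally have "exp (- S) / x * exp (- (2 + 1 / c0)) * exp (2 + 1 / c0) \<le> sqrt pi / 2 * erfc x * exp (2 + 1 / c0)"
    by (rule mult_right_mono) simp
  moreover have "exp (- (2 + 1 / c0)) * exp (2 + 1 / c0) = 1" by (simp add: exp_add[symmetric] del: minus_add_distrib)
  ultimately show ?thesis unfolding x_def[symmetric] by (simp add: mult_ac)
qed

text \<open>
  Moving half a mesh into the window costs a factor \<open>exp (\<rho> sqrt S)\<close>. If \<open>\<rho> sqrt S\<close> is large, this
  is not harmless, but then the mesh is so coarse that the aliasing term dominates.
\<close>

lemma boundary_term_bound:
  assumes "S > 0" "M \<ge> (1::nat)" "\<rho> = sqrt S / M" "\<rho> \<le> R"
  shows "\<rho> * exp (- \<rho>\<^sup>2 * (M - 1 / 2)\<^sup>2) \<le>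
    (2 * pi * exp (2 * pi) + R) * (exp (- (pi\<^sup>2 / \<rho>\<^sup>2)) + exp (- S) / sqrt S)"
proof -
  have \<rho>: "\<rho> > 0" and S: "\<rho>\<^sup>2 * (real M)\<^sup>2 = S" "\<rho> * M = sqrt S" using assms by (auto simp: power_divide)
  define P where "P = exp (- S) / sqrt S"
  have P: "P \<ge> 0" using assms by (simp add: P_def)
  define e where "e = exp (- (pi\<^sup>2 / \<rho>\<^sup>2))"
  have e: "e \<ge> 0" by (simp add: e_def)
  show ?thesis unfolding P_def[symmetric] e_def[symmetric]
  \<comment> \<open>The threshold is where \<open>pi\<^sup>2 / \<rho>\<^sup>2\<close> equals
    \<open>S / 4\<close>, and \<open>S / 4\<close> bounds
    \<open>\<rho>\<^sup>2 * (M - 1 / 2)\<^sup>2\<close> from below because \<open>M \<ge> 1\<close>.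
    Below the threshold, the prefactor \<open>\<rho> \<le> 2 * pi / sqrt S\<close> supplies the
    missing division by \<open>sqrt S\<close>.\<close>
  proof (cases "\<rho> * sqrt S \<le> 2 * pi")
    case True
    have "\<rho>\<^sup>2 * (M - 1 / 2)\<^sup>2 = S - \<rho> * (\<rho> * M) + \<rho>\<^sup>2 / 4"
      unfolding S(1)[symmetric] by (simp add: power2_eq_square algebra_simps)
    moreover have "\<rho>\<^sup>2 / 4 \<ge> 0" by simp
    ultimately have "- (\<rho>\<^sup>2 * (M - 1 / 2)\<^sup>2) \<le> - S + 2 * pi"
      using True unfolding S(2) by linarith
    then have "exp (- \<rho>\<^sup>2 * (M - 1 / 2)\<^sup>2) \<le> exp (- S + 2 * pi)" by simp
    then have "\<rho> * exp (- \<rho>\<^sup>2 * (M - 1 / 2)\<^sup>2) \<le> \<rho> * exp (- S + 2 * pi)"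
      using \<rho> by (intro mult_left_mono) auto
    also have "\<dots> = \<rho> * (exp (2 * pi) * (sqrt S * P))"
      using assms(1) by (simp add: P_def exp_add[symmetric])
    also have "\<dots> = (\<rho> * sqrt S) * (exp (2 * pi) * P)" by (simp only: mult_ac)
    also have "\<dots> \<le> (2 * pi) * (exp (2 * pi) * P)" using True P by (intro mult_right_mono) auto
    also have "\<dots> \<le> (2 * pi * exp (2 * pi) + R) * (e + P)"
      using P e \<rho> assms(4) by (simp add: ring_distribs)
    finally show "\<rho> * exp (- \<rho>\<^sup>2 * (M - 1 / 2)\<^sup>2) \<le> (2 * pi * exp (2 * pi) + R) * (e + P)" .
  next
    case False
    then have "(2 * pi)\<^sup>2 \<le> (\<rho> * sqrt S)\<^sup>2" by (intro power_mono) auto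
    then have "4 * pi\<^sup>2 \<le> \<rho>\<^sup>2 * S" using assms(1) by (simp add: power_mult_distrib)
    then have "pi\<^sup>2 / \<rho>\<^sup>2 \<le> S / 4" using \<rho> by (simp add: field_simps)
    moreover have "S / 4 \<le> \<rho>\<^sup>2 * (M - 1 / 2)\<^sup>2"
    proof -
      have "(real M / 2)\<^sup>2 \<le> (M - 1 / 2)\<^sup>2" using assms(2) by (intro power_mono) auto
      then have "\<rho>\<^sup>2 * (real M / 2)\<^sup>2 \<le> \<rho>\<^sup>2 * (M - 1 / 2)\<^sup>2" by (rule mult_left_mono) simp
      then show ?thesis using S(1) by (simp add: power_divide)
    qed
    ultimately have "pi\<^sup>2 / \<rho>\<^sup>2 \<le> \<rho>\<^sup>2 * (M - 1 / 2)\<^sup>2" by (rule order_trans)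
    then have "exp (- \<rho>\<^sup>2 * (M - 1 / 2)\<^sup>2) \<le> e" unfolding e_def by simp
    then have "\<rho> * exp (- \<rho>\<^sup>2 * (M - 1 / 2)\<^sup>2) \<le> R * e" using \<rho> assms(4) by (intro mult_mono) auto
    also have "\<dots> \<le> (2 * pi * exp (2 * pi) + R) * (e + P)"
      using P e \<rho> assms(4) by (simp add: ring_distribs)
    finally show "\<rho> * exp (- \<rho>\<^sup>2 * (M - 1 / 2)\<^sup>2) \<le> (2 * pi * exp (2 * pi) + R) * (e + P)" .
  qed
qed

section \<open>The periodized truncated window\<close>

lemma W_GS_nonneg: "W_GS S H x \<ge> 0"
  by (simp add: W_GS_def)

text \<open>An image with \<open>\<bar>n\<bar> \<ge> 2\<close> has its argument at distance at least
  \<open>2 * L - \<bar>y\<bar> > 4 * H - 3 * H = H\<close> from 0, outside the support.\<close>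

lemma periodize_W_GS:
  assumes "H > 0" "L \<ge> 2 * H" "\<bar>y\<bar> < 3 * H"
  shows "periodize L (W_GS S H) y = W_GS S H (y - L) + W_GS S H y + W_GS S H (y + L)"
proof -
  have "periodize L (W_GS S H) y = (\<Sum>\<^sub>\<infinity>n\<in>{-1, 0, 1::int}. W_GS S H (y + of_int n * L))"
    unfolding periodize_def
  proof (rule infsum_cong_neutral)
    fix n :: int assume n: "n \<in> UNIV - {-1, 0, 1}"
    then have "2 \<le> \<bar>n\<bar>" by auto
    then have "2 \<le> \<bar>real_of_int n\<bar>" by linarith
    then have "2 * L \<le> \<bar>of_int n * L\<bar>" using assms by (simp add: abs_mult mult_right_mono)
    then have "H < \<bar>y + of_int n * L\<bar>" using assms by linarith
    then show "W_GS S H (y + of_int n * L) = 0" by (simp add: W_GS_def)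
  qed auto
  then show ?thesis by simp
qed

lemma periodize_W_GS_interior:
  assumes "H > 0" "L \<ge> 2 * H" "\<bar>y\<bar> < H"
  shows "periodize L (W_GS S H) y = exp (- S * (y / H)\<^sup>2)"
  using assms by (subst periodize_W_GS) (auto simp: W_GS_def)

text \<open>Each of the three relevant images is evaluated at distance at least
  \<open>H - \<delta>\<close> from its centre, since
  \<open>\<bar>y \<plusminus> L\<bar> \<ge> 2 * H - (H + \<delta>)\<close>; hence three times one
  value of the Gaussian.\<close>

lemma periodize_W_GS_boundary:
  assumes "H > 0" "S \<ge> 0" "L \<ge> 2 * H" "0 \<le> \<delta>" "\<delta> \<le> H" "\<bar>y\<bar> \<le> H + \<delta>" "H - \<delta> \<le> \<bar>y\<bar>"
  shows "0 \<le> periodize L (W_GS S H) y" "periodize L (W_GS S H) y \<le> 3 * exp (- S * ((H - \<delta>) / H)\<^sup>2)"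
proof -
  have eq: "periodize L (W_GS S H) y = W_GS S H (y - L) + W_GS S H y + W_GS S H (y + L)"
    using assms by (intro periodize_W_GS) auto
  show "0 \<le> periodize L (W_GS S H) y" unfolding eq by (intro add_nonneg_nonneg W_GS_nonneg)
  have "W_GS S H x \<le> exp (- S * ((H - \<delta>) / H)\<^sup>2)" if "H - \<delta> \<le> \<bar>x\<bar>" for x
  proof -
    have "((H - \<delta>) / H)\<^sup>2 \<le> (\<bar>x\<bar> / H)\<^sup>2"
      using that assms by (intro power_mono divide_right_mono) auto
    then have "S * ((H - \<delta>) / H)\<^sup>2 \<le> S * (x / H)\<^sup>2" using assms by (intro mult_left_mono) (simp_all add: power_divide)
    then show ?thesis by (auto simp: W_GS_def)
  qed
  moreover have "H - \<delta> \<le> \<bar>y - L\<bar>" "H - \<delta> \<le> \<bar>y + L\<bar>" using assms by linarith+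
  ultimately have "W_GS S H (y - L) \<le> exp (- S * ((H - \<delta>) / H)\<^sup>2)" "W_GS S H y \<le> exp (- S * ((H - \<delta>) / H)\<^sup>2)"
     "W_GS S H (y + L) \<le> exp (- S * ((H - \<delta>) / H)\<^sup>2)" using assms by auto
  then show "periodize L (W_GS S H) y \<le> 3 * exp (- S * ((H - \<delta>) / H)\<^sup>2)" unfolding eq by simp
qed

section \<open>The gathering error in one dimension\<close>

lemma complete_square:
  fixes \<alpha> \<rho> \<beta> :: real
  assumes "\<alpha> + \<rho>\<^sup>2 = \<beta>" "\<beta> \<noteq> 0"
  shows "\<rho>\<^sup>2 * (\<theta> - n)\<^sup>2 + \<alpha> * (n - u)\<^sup>2 =
    \<beta> * (n - (\<alpha> * u + \<rho>\<^sup>2 * \<theta>) / \<beta>)\<^sup>2 + \<alpha> * \<rho>\<^sup>2 / \<beta> * (\<theta> - u)\<^sup>2"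
proof -
  have "\<beta> * (\<beta> * (n - (\<alpha> * u + \<rho>\<^sup>2 * \<theta>) / \<beta>)\<^sup>2 + \<alpha> * \<rho>\<^sup>2 / \<beta> * (\<theta> - u)\<^sup>2) =
     (\<beta> * (n - (\<alpha> * u + \<rho>\<^sup>2 * \<theta>) / \<beta>))\<^sup>2 + \<alpha> * \<rho>\<^sup>2 * (\<theta> - u)\<^sup>2"
  proof -
    have "\<beta> * (\<beta> * X\<^sup>2 + c / \<beta> * Y) = (\<beta> * X)\<^sup>2 + c * Y" for X c Y
      using assms(2) by (simp add: distrib_left power_mult_distrib power2_eq_square[of \<beta>])
    then show ?thesis .
  qed
  also have "\<beta> * (n - (\<alpha> * u + \<rho>\<^sup>2 * \<theta>) / \<beta>) = \<beta> * n - (\<alpha> * u + \<rho>\<^sup>2 * \<theta>)"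
    using assms(2) by (simp add: right_diff_distrib)
  also have "(\<beta> * n - (\<alpha> * u + \<rho>\<^sup>2 * \<theta>))\<^sup>2 + \<alpha> * \<rho>\<^sup>2 * (\<theta> - u)\<^sup>2 = \<beta> * (\<rho>\<^sup>2 * (\<theta> - n)\<^sup>2 + \<alpha> * (n - u)\<^sup>2)"
    unfolding assms(1)[symmetric] by (simp add: power2_eq_square algebra_simps)
  finally show ?thesis using assms(2) by simp
qed

lemma sum_int_symmetric: "(\<Sum>n\<in>{- int N..<int N}. f n) = (\<Sum>k<N. f (int k) + f (- int k - 1))"
  for f :: "int \<Rightarrow> 'a::comm_monoid_add"
proof (induction N)
  case (Suc N)
  have "{- int (Suc N)..<int (Suc N)} = insert (int N) (insert (- int N - 1) {- int N..<int N})" by auto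
  then show ?case using Suc by (simp add: ac_simps)
qed simp

text \<open>One dimension, one level and one target particle: \<open>x\<close> is the coordinate of
  the target, \<open>g\<close> that of its grid point, \<open>r j\<close> are the source
  coordinates, and the window reaches over \<open>M\<close> meshes on either side. In
  \<open>regime\<close> the 4 of \<open>alias_exponent\<close> has cancelled against
  \<open>(2 * M)\<^sup>2\<close>.\<close>

locale grid_window =
  fixes S H h L \<mu> s c0 \<mu>0 x g :: real and M :: nat and J :: "'j set" and r :: "'j \<Rightarrow> real"
  assumes c0: "c0 > 0" "S \<ge> c0" and \<mu>0: "\<mu>0 > 0" "\<mu> \<ge> \<mu>0" and H: "H > 0" "h * M = H" "M \<ge> 1"
    and L: "L \<ge> 2 * H" and s: "s > 0" "s\<^sup>2 = \<mu> + H\<^sup>2 / S" and near: "\<bar>x - g\<bar> \<le> h / 2"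
    and regime: "pi\<^sup>2 * \<mu> * (real M)\<^sup>2 / (s\<^sup>2 * S) \<ge> c0"
begin

text \<open>Positions are measured in meshes from \<open>g\<close>. In the grid index
  \<open>n\<close> the window decays with rate \<open>\<rho>\<^sup>2\<close> around
  \<open>\<theta>\<close> and the source with rate \<open>h\<^sup>2 / \<mu>\<close> around
  \<open>(r j - g) / h\<close>; \<open>\<beta>\<close> is the sum of the rates and
  \<open>v j\<close> the weighted mean of the centres. \<open>\<kappa>\<close> is the mesh size
  divided by the normalisations of source and window, and \<open>G\<close> is the window without
  truncation.\<close>

definition "\<rho> = sqrt S / M"
definition "\<theta> = (x - g) / h"
definition "E = pi\<^sup>2 * \<mu> * (real M)\<^sup>2 / (s\<^sup>2 * S)"
definition "\<beta> = \<rho>\<^sup>2 * s\<^sup>2 / \<mu>"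
definition "v j = (h\<^sup>2 / \<mu> * ((r j - g) / h) + \<rho>\<^sup>2 * \<theta>) / \<beta>"
definition "\<kappa> = \<rho> / (pi * sqrt \<mu>)"
definition "G n = exp (- \<rho>\<^sup>2 * (\<theta> - of_int n)\<^sup>2)"
definition "win n = periodize L (W_GS S H) (x - g - of_int n * h)"
definition "src n j = exp (- ((g + of_int n * h - r j)\<^sup>2 / \<mu>))"
definition "exact j = exp (- ((x - r j)\<^sup>2 / s\<^sup>2)) / sqrt (pi * s\<^sup>2)"
definition "gath j = (\<Sum>n | \<bar>real_of_int n\<bar> \<le> real M. h * src n j / (sqrt (pi * \<mu>) * (sqrt (pi / S) * H)) * win n)"
definition "\<Phi> = gaussian_modes r {s\<^sup>2, \<mu>}"

lemma positivity: "S > 0" "\<mu> > 0" "h > 0" "\<rho> > 0" "\<beta> > 0" "\<kappa> > 0" "real M > 0"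
proof -
  show "S > 0" "\<mu> > 0" "real M > 0" using c0 \<mu>0 H by auto
  then show "h > 0" "\<rho> > 0" using H by (auto simp: \<rho>_def zero_less_mult_iff)
  with \<open>\<mu> > 0\<close> s(1) show "\<beta> > 0" "\<kappa> > 0" by (auto simp: \<beta>_def \<kappa>_def)
qed

lemma \<rho>_sq: "\<rho>\<^sup>2 = h\<^sup>2 * S / H\<^sup>2"
  using positivity H(2)[symmetric] by (simp add: \<rho>_def power_divide power_mult_distrib)

lemma \<mu>_le: "\<mu> \<le> s\<^sup>2" using s(2) positivity by simp

lemma E_eq: "pi\<^sup>2 / \<beta> = E"
  using positivity by (simp add: \<beta>_def E_def \<rho>_def power_divide mult_ac)

lemma E_le: "E \<le> pi\<^sup>2 / \<rho>\<^sup>2"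
proof -
  have "E = pi\<^sup>2 / \<rho>\<^sup>2 * (\<mu> / s\<^sup>2)"
    using positivity by (simp add: E_def \<rho>_def power_divide mult_ac)
  also have "\<dots> \<le> pi\<^sup>2 / \<rho>\<^sup>2 * 1"
    using \<mu>_le s(1) by (intro mult_left_mono) auto
  finally show ?thesis by simp
qed

text \<open>The lower bound \<open>c0\<close> on the aliasing exponent bounds the coarseness of the
  grid relative to the window.\<close>

lemma \<rho>_le: "\<rho> \<le> pi / sqrt c0"
proof -
  have "c0 \<le> pi\<^sup>2 / \<rho>\<^sup>2" using regime E_le by (simp add: E_def)
  then have "c0 * \<rho>\<^sup>2 \<le> pi\<^sup>2" using positivity(4) by (simp add: pos_le_divide_eq)
  then have "\<rho>\<^sup>2 \<le> pi\<^sup>2 / c0" using c0(1) by (simp add: pos_le_divide_eq mult.commute)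
  also have "\<dots> = (pi / sqrt c0)\<^sup>2" using c0(1) by (simp add: power_divide)
  finally have "\<rho>\<^sup>2 \<le> (pi / sqrt c0)\<^sup>2" .
  then show ?thesis by (rule power2_le_imp_le) (use c0(1) in simp)
qed

lemma weight_eq: "h / (sqrt (pi * \<mu>) * (sqrt (pi / S) * H)) = \<kappa>"
proof -
  have "\<rho> = h * sqrt S / H" using H(2)[symmetric] positivity by (simp add: \<rho>_def)
  moreover have "sqrt (pi * \<mu>) * (sqrt (pi / S) * H) = pi * sqrt \<mu> * H / sqrt S"
    by (simp add: real_sqrt_mult real_sqrt_divide)
  ultimately show ?thesis using positivity H by (simp add: \<kappa>_def)
qed

lemma \<beta>_eq: "h\<^sup>2 / \<mu> + \<rho>\<^sup>2 = \<beta>"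
  unfolding \<beta>_def \<rho>_sq s(2) using positivity H by (simp add: field_simps)

lemma square_coeff: "h\<^sup>2 / \<mu> * \<rho>\<^sup>2 / \<beta> = h\<^sup>2 / s\<^sup>2"
  using positivity s by (simp add: \<beta>_def)

text \<open>The prefactor of the Poisson formula turns the quadrature weight into the normalisation
  of the exact Gaussian, so that the zero mode equals \<open>exact\<close>.\<close>

lemma \<kappa>_eq: "\<kappa> * sqrt (pi / \<beta>) = 1 / sqrt (pi * s\<^sup>2)"
proof -
  have sq: "sqrt (pi / \<beta>) = sqrt pi * sqrt \<mu> / (\<rho> * s)" "sqrt (pi * s\<^sup>2) = sqrt pi * s"
    using positivity(4) s(1) by (simp_all add: \<beta>_def real_sqrt_divide real_sqrt_mult)
  have \<kappa>: "\<kappa> = \<rho> / (sqrt pi * sqrt pi * sqrt \<mu>)" unfolding \<kappa>_def by simp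
  have cancel: "\<rho> / (p * p * q) * (p * q / (\<rho> * s)) = 1 / (p * s)" if "p > 0" "q > 0" for p q
    using that positivity s by simp
  show ?thesis unfolding sq \<kappa> by (rule cancel) (use positivity in auto)
qed

text \<open>The part of the completed square without \<open>n\<close> has rate
  \<open>h\<^sup>2 / s\<^sup>2\<close> in mesh units, which is the exact Gaussian factor; the rest
  is a lattice Gaussian ready for Poisson summation.\<close>

lemma G_src: "G n * src n j = exp (- ((x - r j)\<^sup>2 / s\<^sup>2)) * exp (- \<beta> * (of_int n - v j)\<^sup>2)"
proof -
  have 1: "(g + of_int n * h - r j)\<^sup>2 / \<mu> = h\<^sup>2 / \<mu> * (of_int n - (r j - g) / h)\<^sup>2"
  proof -
    have "g + of_int n * h - r j = h * (of_int n - (r j - g) / h)" using positivity by (simp add: field_simps)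
    then show ?thesis by (simp only: power_mult_distrib) simp
  qed
  have 2: "(x - r j)\<^sup>2 / s\<^sup>2 = h\<^sup>2 / s\<^sup>2 * (\<theta> - (r j - g) / h)\<^sup>2"
  proof -
    have "x - r j = h * (\<theta> - (r j - g) / h)" using positivity by (simp add: \<theta>_def field_simps)
    then show ?thesis by (simp only: power_mult_distrib) simp
  qed
  have "\<rho>\<^sup>2 * (\<theta> - of_int n)\<^sup>2 + h\<^sup>2 / \<mu> * (of_int n - (r j - g) / h)\<^sup>2 =
     \<beta> * (of_int n - v j)\<^sup>2 + h\<^sup>2 / s\<^sup>2 * (\<theta> - (r j - g) / h)\<^sup>2"
    unfolding v_def square_coeff[symmetric] using positivity by (intro complete_square \<beta>_eq) auto
  then show ?thesis unfolding G_def src_def 1 2 exp_add[symmetric] by simp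
qed

lemma window_arg: "- S * ((x - g - of_int n * h) / H)\<^sup>2 = - \<rho>\<^sup>2 * (\<theta> - of_int n)\<^sup>2"
proof -
  have "x - g - of_int n * h = h * (\<theta> - of_int n)" using positivity by (simp add: \<theta>_def field_simps)
  then show ?thesis unfolding \<rho>_sq by (simp only: power_divide power_mult_distrib) simp
qed

lemma \<theta>_le: "\<bar>\<theta>\<bar> \<le> 1 / 2"
  using near positivity by (simp add: \<theta>_def field_simps)

lemma win_interior:
  assumes "\<bar>n\<bar> < int M" shows "win n = G n"
proof -
  have "\<bar>real_of_int n\<bar> \<le> real M - 1" using assms by linarith
  then have "\<bar>of_int n * h\<bar> \<le> (real M - 1) * h" using positivity by (simp add: abs_mult mult_right_mono)
  then have "\<bar>x - g - of_int n * h\<bar> < H"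
    using near abs_triangle_ineq4[of "x - g" "of_int n * h"] positivity(3)
    unfolding left_diff_distrib mult.commute[of "real M"] H(2) by linarith
  then show ?thesis unfolding win_def G_def window_arg[symmetric] by (rule periodize_W_GS_interior[OF H(1) L])
qed

text \<open>The window Gaussian half a mesh inside the end of its support: a grid point with
  \<open>\<bar>n\<bar> = M\<close> can come no closer to the centre.\<close>

definition "edge = exp (- \<rho>\<^sup>2 * (M - 1 / 2)\<^sup>2)"

text \<open>
  For \<open>n = \<plusminus>M\<close> the grid point may lie outside the support of the window, or an image of the
  window may overlap it; \<open>win n\<close> is then not close to \<open>G n\<close>, but both are small.
\<close>

lemma win_boundary:
  assumes "\<bar>n\<bar> = int M" shows "0 \<le> win n" "win n \<le> 3 * edge" "\<bar>G n - win n\<bar> \<le> 3 * edge"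
proof -
  have "\<bar>real_of_int n\<bar> = real M" using assms by linarith
  then have "\<bar>of_int n * h\<bar> = H" using positivity H by (simp add: abs_mult mult.commute)
  then have le: "\<bar>x - g - of_int n * h\<bar> \<le> H + h / 2" "H - h / 2 \<le> \<bar>x - g - of_int n * h\<bar>"
    using near by linarith+
  have hH: "h / 2 \<le> H" using H positivity mult_left_mono[of 1 "real M" h] by auto
  have b: "- S * ((H - h / 2) / H)\<^sup>2 = - \<rho>\<^sup>2 * (M - 1 / 2)\<^sup>2"
  proof -
    have "H - h / 2 = h * (M - 1 / 2)" using H(2) by (simp add: right_diff_distrib)
    then show ?thesis unfolding \<rho>_sq by (simp only: power_divide power_mult_distrib) simp
  qed
  show w: "0 \<le> win n" "win n \<le> 3 * edge"
    unfolding win_def edge_def b[symmetric] using positivity(3)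
    by (intro periodize_W_GS_boundary[OF H(1) less_imp_le[OF positivity(1)] L _ hH le]; simp)+
  have "real M - 1 / 2 \<le> \<bar>\<theta> - of_int n\<bar>" using \<theta>_le \<open>\<bar>real_of_int n\<bar> = real M\<close> by linarith
  then have "(real M - 1 / 2)\<^sup>2 \<le> (\<theta> - of_int n)\<^sup>2"
    using abs_le_square_iff[of "real M - 1 / 2" "\<theta> - of_int n"] H(3) by simp
  then have "\<rho>\<^sup>2 * (real M - 1 / 2)\<^sup>2 \<le> \<rho>\<^sup>2 * (\<theta> - of_int n)\<^sup>2" by (rule mult_left_mono) simp
  then have "G n \<le> edge" by (simp add: G_def edge_def)
  moreover have "0 \<le> G n" "0 \<le> edge" by (simp_all add: G_def edge_def)
  ultimately show "\<bar>G n - win n\<bar> \<le> 3 * edge" using w by linarith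
qed

lemma \<Phi>_nonempty: "\<Phi> \<noteq> {}"
  using gaussian_mode0[of \<mu> "{s\<^sup>2, \<mu>}" 0 r] by (auto simp: \<Phi>_def)

lemma superposition_src: "superposition J \<Phi> 1 (\<lambda>j. complex_of_real (src n j))"
  unfolding src_def \<Phi>_def by (intro superposition_base gaussian_mode0) auto

text \<open>\<open>v j\<close> is affine in \<open>r j\<close>, so \<open>cis (t * v j)\<close> is a
  plane wave in \<open>r j\<close> up to a phase independent of \<open>j\<close>.\<close>

lemma superposition_exact_cis:
  "superposition J \<Phi> (1 / sqrt (pi * s\<^sup>2)) (\<lambda>j. complex_of_real (exact j) * cis (t * v j))"
proof -
  define p q where "p = h / (\<mu> * \<beta>)" and "q = (\<rho>\<^sup>2 * \<theta> - h / \<mu> * g) / \<beta>"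
  have v: "v j = q + p * r j" for j
    using positivity by (simp add: v_def p_def q_def field_simps power2_eq_square)
  have eq: "complex_of_real (exact j) * cis (t * v j) = complex_of_real (1 / sqrt (pi * s\<^sup>2)) * cis (t * q) *
     (cis (t * p * r j) * complex_of_real (exp (- ((x - r j)\<^sup>2 / s\<^sup>2))))" for j
  proof -
    have "t * v j = t * q + t * p * r j" unfolding v by (simp add: ring_distribs)
    then have "cis (t * v j) = cis (t * q) * cis (t * p * r j)" by (simp add: cis_mult)
    then show ?thesis unfolding exact_def by simp
  qed
  have "superposition J \<Phi> (cmod (complex_of_real (1 / sqrt (pi * s\<^sup>2)) * cis (t * q)) * 1)
     (\<lambda>j. complex_of_real (exact j) * cis (t * v j))"
    unfolding eq \<Phi>_def by (intro superposition_cmult superposition_base gaussian_mode) simp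
  then show ?thesis using s(1) by (simp add: norm_mult real_sqrt_mult norm_divide)
qed

lemma exact_bound_le: "1 / sqrt (pi * s\<^sup>2) \<le> 1 / sqrt (pi * \<mu>0)"
  using \<mu>_le \<mu>0 s by (intro divide_left_mono real_sqrt_le_mono mult_left_mono mult_pos_pos) auto

lemma superposition_exact: "superposition J \<Phi> (1 / sqrt (pi * \<mu>0)) (\<lambda>j. complex_of_real (exact j))"
  using superposition_mono[OF superposition_exact_cis[of 0] exact_bound_le \<Phi>_nonempty] by simp

lemma \<kappa>_le: "\<kappa> \<le> \<rho> / (pi * sqrt \<mu>0)"
  unfolding \<kappa>_def using positivity \<mu>0 by (intro divide_left_mono mult_left_mono mult_pos_pos) auto

lemma gath_eq: "gath j = (\<Sum>n\<in>{- int M..int M}. \<kappa> * win n * src n j)"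
proof -
  have "\<bar>real_of_int n\<bar> \<le> real M \<longleftrightarrow> \<bar>n\<bar> \<le> int M" for n
    by (metis of_int_abs of_int_le_iff of_int_of_nat_eq)
  then have "{n. \<bar>real_of_int n\<bar> \<le> real M} = {n. \<bar>n\<bar> \<le> int M}" by (simp only:)
  also have "\<dots> = {- int M..int M}" by (rule set_eqI) (simp add: abs_le_iff, linarith)
  finally show ?thesis unfolding gath_def weight_eq[symmetric] by (simp add: mult_ac)
qed

lemma edge_le: "edge \<le> 1" by (simp add: edge_def)

lemma sum_boundary_split:
  fixes f :: "int \<Rightarrow> real"
  assumes "finite X" "int M \<in> X" "- int M \<in> X"
  shows "(\<Sum>n\<in>X. f n) = f (int M) + f (- int M) + (\<Sum>n\<in>X - {int M, - int M}. f n)"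
proof -
  have "(\<Sum>n\<in>X. f n) = (\<Sum>n\<in>{int M, - int M}. f n) + (\<Sum>n\<in>X - {int M, - int M}. f n)"
    using assms by (subst sum.subset_diff[of "{int M, - int M}"]) (auto simp: add.commute)
  then show ?thesis using H(3) by simp
qed

text \<open>The gathering sum combines the modes \<open>src n\<close> with the coefficients
  \<open>\<kappa> * win n\<close>. Of the 7 multiples of \<open>\<rho>\<close>, six come from the
  two end points, where \<open>win n \<le> 3\<close>, and one from the central term of the lattice
  sum.\<close>

lemma superposition_gath:
  "superposition J \<Phi> ((7 * (pi / sqrt c0) + 2 * exp 1) / (pi * sqrt \<mu>0)) (\<lambda>j. complex_of_real (gath j))"
proof -
  let ?X = "{- int M..int M}"
  have "superposition J \<Phi> (\<Sum>n\<in>?X. cmod (complex_of_real (\<kappa> * win n)) * 1)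
     (\<lambda>j. \<Sum>n\<in>?X. complex_of_real (\<kappa> * win n) * complex_of_real (src n j))"
    by (intro superposition_sum superposition_cmult superposition_src)
  then have sup: "superposition J \<Phi> (\<Sum>n\<in>?X. \<bar>\<kappa> * win n\<bar>) (\<lambda>j. complex_of_real (gath j))"
    by (simp add: gath_eq norm_mult abs_mult)
  have bound: "\<bar>\<kappa> * win n\<bar> \<le> \<rho> / (pi * sqrt \<mu>0) * c" if "0 \<le> win n" "win n \<le> c" for n c
    using that \<kappa>_le positivity unfolding abs_mult by (intro mult_mono) auto
  have 1: "\<bar>\<kappa> * win n\<bar> \<le> \<rho> / (pi * sqrt \<mu>0) * 3" if "\<bar>n\<bar> = int M" for n
    using win_boundary(1,2)[OF that] edge_le by (intro bound) linarith+
  have 2: "\<bar>\<kappa> * win n\<bar> \<le> \<rho> / (pi * sqrt \<mu>0) * G n" if "n \<in> ?X - {int M, - int M}" for n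
  proof -
    have "win n = G n" using that by (intro win_interior) auto
    moreover have "G n \<ge> 0" by (simp add: G_def)
    ultimately show ?thesis by (intro bound) auto
  qed
  have "(\<Sum>n\<in>?X. \<bar>\<kappa> * win n\<bar>) = \<bar>\<kappa> * win (int M)\<bar> + \<bar>\<kappa> * win (- int M)\<bar> +
      (\<Sum>n\<in>?X - {int M, - int M}. \<bar>\<kappa> * win n\<bar>)"
    by (rule sum_boundary_split) auto
  also have "\<dots> \<le> \<rho> / (pi * sqrt \<mu>0) * 3 + \<rho> / (pi * sqrt \<mu>0) * 3 + (\<Sum>n\<in>?X - {int M, - int M}. \<rho> / (pi * sqrt \<mu>0) * G n)"
    by (intro add_mono sum_mono 1 2) auto
  also have "(\<Sum>n\<in>?X - {int M, - int M}. \<rho> / (pi * sqrt \<mu>0) * G n) =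
      (\<Sum>n\<in>?X - {int M, - int M}. \<rho> * G n) / (pi * sqrt \<mu>0)"
    by (simp add: sum_divide_distrib)
  also have "\<dots> \<le> (\<rho> + 2 * exp 1) / (pi * sqrt \<mu>0)"
    unfolding G_def using positivity \<theta>_le \<mu>0 by (intro divide_right_mono lattice_gaussian_sum) auto
  also have "\<rho> / (pi * sqrt \<mu>0) * 3 + \<rho> / (pi * sqrt \<mu>0) * 3 + (\<rho> + 2 * exp 1) / (pi * sqrt \<mu>0) =
     (7 * \<rho> + 2 * exp 1) / (pi * sqrt \<mu>0)"
    by (simp add: add_divide_distrib[symmetric])
  also have "\<dots> \<le> (7 * (pi / sqrt c0) + 2 * exp 1) / (pi * sqrt \<mu>0)"
    using \<rho>_le \<mu>0 by (intro divide_right_mono) auto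
  finally have "(\<Sum>n\<in>?X. \<bar>\<kappa> * win n\<bar>) \<le> (7 * (pi / sqrt c0) + 2 * exp 1) / (pi * sqrt \<mu>0)" by simp
  from superposition_mono[OF sup this \<Phi>_nonempty] show ?thesis .
qed

section \<open>Splitting the one-dimensional error into truncation and aliasing\<close>

text \<open>The untruncated window minus the one used in the sum: zero inside, a boundary term at
  \<open>\<bar>n\<bar> = M\<close>, and all of \<open>G\<close> beyond.\<close>

definition "defect n = G n - (if \<bar>n\<bar> \<le> int M then win n else 0)"

text \<open>The error with both infinite sums cut off at \<open>N\<close>: finite sums are what the
  superposition rules accept, and the limit is taken afterwards.\<close>

definition "partial N j = (\<Sum>n\<in>{- int N..<int N}. complex_of_real (\<kappa> * defect n) * complex_of_real (src n j)) -
   (\<Sum>k<N. complex_of_real (exact j) * complex_of_real (cos_term \<beta> k (- v j)))"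

text \<open>By Poisson summation at \<open>- v j\<close>, the full sum of
  \<open>\<kappa> * G n * src n j\<close> is \<open>exact j\<close> times one plus the cosine
  series. Subtracting the cosine series and the gathered part leaves
  \<open>exact j - gath j\<close>.\<close>

lemma partial_tendsto: "(\<lambda>N. partial N j) \<longlonglongrightarrow> complex_of_real (exact j - gath j)"
proof -
  have full: "(\<Sum>n\<in>{- int N..<int N}. \<kappa> * G n * src n j) =
      \<kappa> * exp (- ((x - r j)\<^sup>2 / s\<^sup>2)) * (\<Sum>k<N. gauss_pair \<beta> k (- v j))" for N
  proof -
    have "(\<Sum>n\<in>{- int N..<int N}. \<kappa> * G n * src n j) =
       \<kappa> * exp (- ((x - r j)\<^sup>2 / s\<^sup>2)) * (\<Sum>n\<in>{- int N..<int N}. exp (- \<beta> * (of_int n - v j)\<^sup>2))"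
      unfolding mult.assoc G_src sum_distrib_left ..
    also have "(\<Sum>n\<in>{- int N..<int N}. exp (- \<beta> * (of_int n - v j)\<^sup>2)) = (\<Sum>k<N. gauss_pair \<beta> k (- v j))"
    proof -
      have "real_of_int (int k) - v j = - v j + real k"
        "real_of_int (- int k - 1) - v j = - v j - (real k + 1)" for k by simp_all
      then show ?thesis unfolding sum_int_symmetric gauss_pair_def by (simp only:)
    qed
    finally show ?thesis .
  qed
  have ev: "\<forall>\<^sub>F N in sequentially. partial N j = complex_of_real
     (\<kappa> * exp (- ((x - r j)\<^sup>2 / s\<^sup>2)) * (\<Sum>k<N. gauss_pair \<beta> k (- v j)) - gath j -
       exact j * (\<Sum>k<N. cos_term \<beta> k (- v j)))"
    using eventually_gt_at_top[of M]
  proof eventually_elim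
    case (elim N)
    have "(\<Sum>n\<in>{- int N..<int N}. \<kappa> * defect n * src n j) =
       (\<Sum>n\<in>{- int N..<int N}. \<kappa> * G n * src n j) - (\<Sum>n\<in>{- int N..<int N}. if \<bar>n\<bar> \<le> int M then \<kappa> * win n * src n j else 0)"
      unfolding sum_subtractf[symmetric] by (intro sum.cong refl) (simp add: defect_def ring_distribs)
    also have "(\<Sum>n\<in>{- int N..<int N}. if \<bar>n\<bar> \<le> int M then \<kappa> * win n * src n j else 0) = gath j"
      unfolding gath_eq using elim by (intro sum.mono_neutral_cong_right) auto
    finally have "(\<Sum>n\<in>{- int N..<int N}. \<kappa> * defect n * src n j) =
      \<kappa> * exp (- ((x - r j)\<^sup>2 / s\<^sup>2)) * (\<Sum>k<N. gauss_pair \<beta> k (- v j)) - gath j" unfolding full .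
    then show ?case unfolding partial_def of_real_mult[symmetric] of_real_sum[symmetric] of_real_diff[symmetric]
      by (simp only: sum_distrib_left)
  qed
  have "(\<lambda>N. complex_of_real (\<kappa> * exp (- ((x - r j)\<^sup>2 / s\<^sup>2)) * (\<Sum>k<N. gauss_pair \<beta> k (- v j)) - gath j -
       exact j * (\<Sum>k<N. cos_term \<beta> k (- v j)))) \<longlonglongrightarrow>
     complex_of_real (\<kappa> * exp (- ((x - r j)\<^sup>2 / s\<^sup>2)) * (\<Sum>k. gauss_pair \<beta> k (- v j)) - gath j -
       exact j * (\<Sum>k. cos_term \<beta> k (- v j)))"
    by (intro tendsto_intros summable_LIMSEQ gauss_pair_summable cos_term_summable positivity)
  also have "\<kappa> * exp (- ((x - r j)\<^sup>2 / s\<^sup>2)) * (\<Sum>k. gauss_pair \<beta> k (- v j)) =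
     exact j * (1 + (\<Sum>k. cos_term \<beta> k (- v j)))"
  proof -
    have "\<kappa> * exp (- ((x - r j)\<^sup>2 / s\<^sup>2)) * (\<Sum>k. gauss_pair \<beta> k (- v j)) =
      (\<kappa> * sqrt (pi / \<beta>)) * exp (- ((x - r j)\<^sup>2 / s\<^sup>2)) * (1 + (\<Sum>k. cos_term \<beta> k (- v j)))"
      unfolding poisson_summation_gaussian[OF positivity(5)] by (simp only: mult_ac)
    then show ?thesis unfolding \<kappa>_eq exact_def by simp
  qed
  finally show ?thesis
    using tendsto_cong[OF ev] by (simp add: ring_distribs)
qed

definition "alias_bound = 2 / sqrt (pi * \<mu>0) / (1 - exp (- c0)) * exp (- E)"

text \<open>Every cosine is two plane waves in \<open>v j\<close>, whence the 2 in
  \<open>alias_bound\<close>. The weights sum to at most \<open>exp (- E) / (1 - exp (- E))\<close>,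
  and \<open>E \<ge> c0\<close> bounds the denominator from below.\<close>

lemma superposition_alias:
  "superposition J \<Phi> alias_bound (\<lambda>j. \<Sum>k<N. complex_of_real (exact j) * complex_of_real (cos_term \<beta> k (- v j)))"
proof -
  define w where "w = (\<lambda>k::nat. exp (- (E * (real k + 1)\<^sup>2)))"
  have E: "E \<ge> c0" using regime by (simp add: E_def)
  have cos_split: "complex_of_real (exact j) * complex_of_real (cos_term \<beta> k (- v j)) =
    complex_of_real (w k) * (complex_of_real (exact j) * cis (2 * pi * (real k + 1) * v j) +
      complex_of_real (exact j) * cis ((- 2 * pi * (real k + 1)) * v j))" for k j
  proof -
    have c: "complex_of_real (2 * cos y) = cis y + cis (- y)" for y by (simp add: complex_eq_iff)
    have "pi\<^sup>2 * (real k + 1)\<^sup>2 / \<beta> = E * (real k + 1)\<^sup>2" unfolding E_eq[symmetric] by simp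
    then have "cos_term \<beta> k (- v j) = w k * (2 * cos (2 * pi * (real k + 1) * v j))"
      by (simp add: cos_term_def w_def)
    moreover have "(- 2 * pi * (real k + 1)) * v j = - (2 * pi * (real k + 1) * v j)" by simp
    ultimately show ?thesis
      by (simp only: of_real_mult[of "w k"] c distrib_left mult.left_commute)
  qed
  let ?c = "1 / sqrt (pi * s\<^sup>2)"
  have "superposition J \<Phi> (\<Sum>k<N. cmod (complex_of_real (w k)) * (?c + ?c))
    (\<lambda>j. \<Sum>k<N. complex_of_real (exact j) * complex_of_real (cos_term \<beta> k (- v j)))"
    unfolding cos_split by (intro superposition_sum superposition_cmult superposition_add superposition_exact_cis)
  moreover have "(\<Sum>k<N. cmod (complex_of_real (w k)) * (?c + ?c)) \<le> alias_bound"
  proof -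
    have "(\<Sum>k<N. w k) \<le> (\<Sum>k<N. exp (- E) * exp (- E) ^ k)"
      unfolding w_def using E c0 by (intro sum_mono theta_weight_le) auto
    also have "\<dots> \<le> (\<Sum>k. exp (- E) * exp (- E) ^ k)"
      using E c0 by (intro sum_le_suminf summable_mult summable_geometric) auto
    also have "\<dots> = exp (- E) * (1 / (1 - exp (- E)))"
      using E c0 by (subst suminf_mult) (auto simp: suminf_geometric intro!: summable_geometric)
    also have "\<dots> \<le> exp (- E) * (1 / (1 - exp (- c0)))"
      using E c0 by (intro mult_left_mono divide_left_mono mult_pos_pos) auto
    finally have W: "(\<Sum>k<N. w k) \<le> exp (- E) * (1 / (1 - exp (- c0)))" .
    have "(\<Sum>k<N. cmod (complex_of_real (w k)) * (?c + ?c)) = (\<Sum>k<N. w k) * (?c + ?c)"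
      unfolding sum_distrib_right by (intro sum.cong refl) (simp add: w_def)
    also have "\<dots> \<le> (exp (- E) * (1 / (1 - exp (- c0)))) * (1 / sqrt (pi * \<mu>0) + 1 / sqrt (pi * \<mu>0))"
      using W exact_bound_le s(1) c0 by (intro mult_mono add_mono) (auto simp: sum_nonneg w_def)
    also have "\<dots> = alias_bound" by (simp add: alias_bound_def mult.commute)
    finally show ?thesis .
  qed
  ultimately show ?thesis using \<Phi>_nonempty by (rule superposition_mono)
qed

text \<open>The 6 counts two end points with defect at most \<open>3 * edge\<close> each; the other
  summand is the tail outside the window.\<close>

definition "trunc_bound = (6 * (\<rho> * edge) + 2 * (exp (- S) / sqrt S)) / (pi * sqrt \<mu>0)"

lemma superposition_truncation:
  assumes N: "N > M"
  shows "superposition J \<Phi> trunc_bound (\<lambda>j. \<Sum>n\<in>{- int N..<int N}. complex_of_real (\<kappa> * defect n) * complex_of_real (src n j))"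
proof -
  let ?X = "{- int N..<int N}" and ?c = "pi * sqrt \<mu>0"
  have "superposition J \<Phi> (\<Sum>n\<in>?X. cmod (complex_of_real (\<kappa> * defect n)) * 1)
    (\<lambda>j. \<Sum>n\<in>?X. complex_of_real (\<kappa> * defect n) * complex_of_real (src n j))"
    by (intro superposition_sum superposition_cmult superposition_src)
  moreover have "(\<Sum>n\<in>?X. cmod (complex_of_real (\<kappa> * defect n)) * 1) \<le> trunc_bound"
  proof -
    have le: "\<bar>\<kappa> * defect n\<bar> \<le> \<rho> / ?c * c" if "\<bar>defect n\<bar> \<le> c" for n c
      using that \<kappa>_le positivity unfolding abs_mult by (intro mult_mono) auto
    have 1: "\<bar>\<kappa> * defect n\<bar> \<le> \<rho> / ?c * (3 * edge)" if "\<bar>n\<bar> = int M" for n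
      using win_boundary(3)[OF that] that by (intro le) (simp add: defect_def)
    have 2: "\<bar>\<kappa> * defect n\<bar> \<le> \<rho> / ?c * G n" if "\<bar>n\<bar> > int M" for n
    proof -
      have "defect n = G n" using that by (simp add: defect_def)
      moreover have "G n \<ge> 0" by (simp add: G_def)
      ultimately show ?thesis by (intro le) simp
    qed
    have "(\<Sum>n\<in>?X. cmod (complex_of_real (\<kappa> * defect n)) * 1) = (\<Sum>n\<in>?X. \<bar>\<kappa> * defect n\<bar>)"
      unfolding norm_of_real by simp
    also have "\<dots> = \<bar>\<kappa> * defect (int M)\<bar> + \<bar>\<kappa> * defect (- int M)\<bar> + (\<Sum>n\<in>?X - {int M, - int M}. \<bar>\<kappa> * defect n\<bar>)"
      using N by (intro sum_boundary_split) auto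
    also have "(\<Sum>n\<in>?X - {int M, - int M}. \<bar>\<kappa> * defect n\<bar>) = (\<Sum>n | n \<in> ?X \<and> \<bar>n\<bar> > int M. \<bar>\<kappa> * defect n\<bar>)"
      by (rule sum.mono_neutral_right) (auto simp: defect_def win_interior)
    also have "\<bar>\<kappa> * defect (int M)\<bar> + \<bar>\<kappa> * defect (- int M)\<bar> + (\<Sum>n | n \<in> ?X \<and> \<bar>n\<bar> > int M. \<bar>\<kappa> * defect n\<bar>)
      \<le> \<rho> / ?c * (3 * edge) + \<rho> / ?c * (3 * edge) + (\<Sum>n | n \<in> ?X \<and> \<bar>n\<bar> > int M. \<rho> / ?c * G n)"
      by (intro add_mono sum_mono 1 2) auto
    also have "(\<Sum>n | n \<in> ?X \<and> \<bar>n\<bar> > int M. \<rho> / ?c * G n) = (\<Sum>n | n \<in> ?X \<and> \<bar>n\<bar> > int M. \<rho> * G n) / ?c"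
      by (simp add: sum_divide_distrib)
    also have "\<dots> \<le> 2 * (exp (- S) / sqrt S) / ?c"
    proof (rule divide_right_mono)
      show "(\<Sum>n | n \<in> ?X \<and> \<bar>n\<bar> > int M. \<rho> * G n) \<le> 2 * (exp (- S) / sqrt S)"
        unfolding G_def
        by (rule lattice_gaussian_tail[OF positivity(1) H(3) \<rho>_def \<theta>_le]) (auto intro: finite_subset[of _ ?X])
    qed (use \<mu>0 in simp)
    also have "\<rho> / ?c * (3 * edge) + \<rho> / ?c * (3 * edge) + 2 * (exp (- S) / sqrt S) / ?c = trunc_bound"
      by (simp add: trunc_bound_def add_divide_distrib)
    finally show ?thesis by simp
  qed
  ultimately show ?thesis using \<Phi>_nonempty by (rule superposition_mono)
qed

lemma superposition_error:
  "superposition J \<Phi> (trunc_bound + alias_bound) (\<lambda>j. complex_of_real (exact j - gath j))"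
proof (rule superposition_limit)
  show "(\<lambda>N. partial N j) \<longlonglongrightarrow> complex_of_real (exact j - gath j)" for j by (rule partial_tendsto)
  show "\<forall>\<^sub>F N in sequentially. superposition J \<Phi> (trunc_bound + alias_bound) (partial N)"
    using eventually_gt_at_top[of M]
  proof eventually_elim
    case (elim N)
    have "superposition J \<Phi> (trunc_bound + cmod (- 1) * alias_bound) (partial N)"
      using superposition_add[OF superposition_truncation[OF elim] superposition_cmult[OF superposition_alias, of "- 1" N]]
      by (simp add: partial_def[abs_def])
    then show ?case by simp
  qed
qed

lemma error_bound_le:
  defines "R \<equiv> pi / sqrt c0"
  shows "trunc_bound + alias_bound \<le>
     ((6 * (2 * pi * exp (2 * pi) + R) + 2) / (pi * sqrt \<mu>0) * (1 + sqrt pi / 2 * exp (2 + 1 / c0)) +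
       2 / sqrt (pi * \<mu>0) / (1 - exp (- c0))) * (exp (- E) + erfc (sqrt S))"
proof -
  define A P e K where "A = 2 * pi * exp (2 * pi) + R" and "P = exp (- S) / sqrt S" and
    "e = exp (- E)" and "K = sqrt pi / 2 * exp (2 + 1 / c0)"
  have A: "A \<ge> 0" using c0 by (simp add: A_def R_def)
  have P: "P \<ge> 0" using positivity by (simp add: P_def)
  have e: "e \<ge> 0" by (simp add: e_def)
  have K: "K \<ge> 0" by (simp add: K_def)
  have PK: "P \<le> K * erfc (sqrt S)" unfolding P_def K_def by (rule erfc_lower_bound[OF c0])
  have K': "K > 0" by (simp add: K_def)
  with PK P have er: "erfc (sqrt S) \<ge> 0" by (meson order_trans zero_le_mult_iff not_le)
  have "\<rho> * edge \<le> A * (exp (- (pi\<^sup>2 / \<rho>\<^sup>2)) + P)"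
    unfolding edge_def A_def P_def R_def by (rule boundary_term_bound[OF positivity(1) H(3) \<rho>_def \<rho>_le])
  also have "\<dots> \<le> A * (e + P)" using E_le A by (intro mult_left_mono add_mono) (auto simp: e_def)
  finally have "6 * (\<rho> * edge) + 2 * P \<le> (6 * A + 2) * (e + P)" using e by (simp add: ring_distribs)
  also have "\<dots> \<le> (6 * A + 2) * ((1 + K) * (e + erfc (sqrt S)))"
  proof (rule mult_left_mono)
    have "0 \<le> K * e" using K e by simp
    then show "e + P \<le> (1 + K) * (e + erfc (sqrt S))" using PK er by (simp add: ring_distribs)
  qed (use A in simp)
  finally have "trunc_bound \<le> (6 * A + 2) * ((1 + K) * (e + erfc (sqrt S))) / (pi * sqrt \<mu>0)"
    unfolding trunc_bound_def P_def[symmetric] using \<mu>0 by (intro divide_right_mono) auto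
  moreover have "alias_bound \<le> 2 / sqrt (pi * \<mu>0) / (1 - exp (- c0)) * (e + erfc (sqrt S))"
    unfolding alias_bound_def e_def[symmetric] using er c0 \<mu>0 by (intro mult_left_mono) auto
  moreover have "a * (b * z) / c + d * z = (a / c * b + d) * z" for a b c d z :: real
    by (simp add: algebra_simps)
  ultimately show ?thesis unfolding A_def[symmetric] K_def[symmetric] e_def[symmetric]
    by (metis add_mono)
qed

end

section \<open>Padding and gathering errors\<close>

lemma periodize_W_GS_eq:
  assumes "0 < H" "\<bar>y\<bar> < L - H"
  shows "periodize L (W_GS S H) y = W_GS S H y"
proof -
  have "periodize L (W_GS S H) y = (\<Sum>\<^sub>\<infinity>n\<in>{0::int}. W_GS S H (y + of_int n * L))"
    unfolding periodize_def
  proof (rule infsum_cong_neutral)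
    fix n :: int assume "n \<in> UNIV - {0}"
    then have "1 \<le> \<bar>real_of_int n\<bar>" by auto
    then have "1 * L \<le> \<bar>real_of_int n\<bar> * L" using assms by (intro mult_right_mono) auto
    then have "L \<le> \<bar>of_int n * L\<bar>" using assms by (simp add: abs_mult)
    then have "H < \<bar>y + of_int n * L\<bar>" using assms by linarith
    then show "W_GS S H (y + of_int n * L) = 0" by (simp add: W_GS_def)
  qed auto
  then show ?thesis by simp
qed

lemma Lz_ext_ge:
  assumes "valid_solver s m V"
  shows "box V $ 3 + 2 * halfw V $ 3 \<le> Lz_ext V"
proof -
  have v: "padlen V \<ge> 2 * halfw V $ 3" "padfac V \<ge> 1" "box V $ 3 > 0" "halfw V $ 3 > 0"
    using assms by (auto simp: valid_solver_def)
  have "box V $ 3 + 2 * halfw V $ 3 \<le> 1 * (box V $ 3 + padlen V)" using v(1) by simp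
  also have "\<dots> \<le> padfac V * (box V $ 3 + padlen V)"
    using v by (intro mult_right_mono) auto
  finally show ?thesis unfolding Lz_ext_def .
qed

text \<open>
  The window around a particle lies inside the padded box, so padding changes the integrand at
  most at the two end points \<open>z = \<plusminus>L_z*/2\<close>.
\<close>

lemma E_padd_eq_0:
  assumes V: "valid_solver s m V" and i: "i \<in> {1..num V}"
  shows "E_padd \<L> w s m V i = 0"
proof -
  let ?H = "halfw V $ 3" and ?L = "Lz_ext V"
  have H: "?H > 0" and z: "\<bar>pos V i $ 3\<bar> \<le> box V $ 3 / 2"
    using V i by (auto simp: valid_solver_def)
  note L = Lz_ext_ge[OF V]
  \<comment> \<open>\<open>\<bar>pos V i $ 3 - z\<bar>\<close> is less than
    \<open>box V $ 3 / 2 + ?L / 2\<close>, which is at most \<open>?L - ?H\<close>; every image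
    other than the central one therefore vanishes.\<close>
  have in_box: "window_1d_per V 3 (pos V i $ 3 - z) = window_1d V 3 (pos V i $ 3 - z)" if "\<bar>z\<bar> < ?L / 2" for z
    unfolding window_1d_per_def window_1d_def periods_def
    using that z L H by (simp only: vector_3) (intro periodize_W_GS_eq; linarith)
  have outside: "window_1d V 3 (pos V i $ 3 - z) = 0" if "\<bar>z\<bar> > ?L / 2" for z
  proof -
    have "?H < \<bar>pos V i $ 3 - z\<bar>" using that z L by linarith
    then show ?thesis by (simp add: window_1d_def W_GS_def)
  qed
  have "gather_integral \<L> w s m V UNIV (window_1d V 3) i =
      gather_integral \<L> w s m V {- ?L / 2..?L / 2} (window_1d_per V 3) i"
    unfolding gather_integral_def set_lebesgue_integral_def[of lborel UNIV] set_lebesgue_integral_def[of lborel "{_.._}"]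
  proof (intro arg_cong2[of _ _ _ _ "(*)"] refl integral_discrete_difference[of "{- ?L / 2, ?L / 2}"])
    fix z assume "z \<notin> {- ?L / 2, ?L / 2}"
    then consider "\<bar>z\<bar> < ?L / 2" | "\<bar>z\<bar> > ?L / 2" by fastforce
    then show "indicator UNIV z *\<^sub>R (LINT p:cell_xy V|lborel. S_scal \<L> w s m V (vector [p $ 1, p $ 2, z]) *
        complex_of_real (window_1d_per V 1 (pos V i $ 1 - p $ 1) * window_1d_per V 2 (pos V i $ 2 - p $ 2) *
          window_1d V 3 (pos V i $ 3 - z))) =
      indicator {- ?L / 2..?L / 2} z *\<^sub>R (LINT p:cell_xy V|lborel. S_scal \<L> w s m V (vector [p $ 1, p $ 2, z]) *
        complex_of_real (window_1d_per V 1 (pos V i $ 1 - p $ 1) * window_1d_per V 2 (pos V i $ 2 - p $ 2) *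
          window_1d_per V 3 (pos V i $ 3 - z)))"
    proof cases
      case 1
      then have "z \<in> {- ?L / 2..?L / 2}" by (auto simp: abs_less_iff)
      then show ?thesis by (simp add: in_box[OF 1])
    next
      case 2
      then have "z \<notin> {- ?L / 2..?L / 2}" by auto
      then show ?thesis by (simp add: outside[OF 2])
    qed
  qed auto
  then show ?thesis by (simp add: E_padd_def)
qed

text \<open>Nearness is Euclidean in three dimensions; comparing with the two grid neighbours in
  direction \<open>d\<close> isolates that coordinate, since
  \<open>norm u \<le> norm (u - v)\<close> means
  \<open>2 * (v \<bullet> u) \<le> v \<bullet> v\<close>.\<close>

lemma nearest_grid_point_dist:
  assumes V: "valid_solver s m V" and i: "i \<in> {1..num V}"
  shows "\<bar>pos V i $ d - gridpt V i $ d\<bar> \<le> mesh V $ d / 2"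
proof -
  let ?u = "pos V i - gridpt V i" and ?h = "mesh V $ d"
  have h: "?h > 0" using V by (auto simp: valid_solver_def)
  have "nearest_grid_points V" using V by (simp add: valid_solver_def)
  then obtain g where g: "gridpt V i \<in> uniform_grid g (mesh V)"
    "\<And>x. x \<in> uniform_grid g (mesh V) \<Longrightarrow> dist (pos V i) (gridpt V i) \<le> dist (pos V i) x"
    using i unfolding nearest_grid_points_def by blast
  have le: "2 * (of_int e * ?h * (?u $ d)) \<le> (of_int e * ?h)\<^sup>2" for e :: int
  proof -
    define v where "v = (axis d (of_int e * ?h) :: real^3)"
    obtain n where n: "\<And>d'. gridpt V i $ d' = g $ d' + of_int (n $ d') * mesh V $ d'"
      using g(1) by (auto simp: uniform_grid_def)
    have "gridpt V i + v \<in> uniform_grid g (mesh V)"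
      unfolding uniform_grid_def
      by (rule CollectI, rule exI[of _ "n + axis d e"]) (simp add: n v_def axis_def ring_distribs)
    then have "norm ?u \<le> norm (?u - v)" using g(2) by (simp add: dist_norm diff_diff_eq)
    then have "(norm ?u)\<^sup>2 \<le> (norm (?u - v))\<^sup>2" by (intro power_mono) auto
    then have "2 * (v \<bullet> ?u) \<le> v \<bullet> v"
      by (simp add: power2_norm_eq_inner inner_diff_left inner_diff_right inner_commute)
    then show ?thesis
      by (simp add: v_def inner_axis_axis inner_axis' power2_eq_square)
  qed
  define t where "t = ?u $ d"
  have "?h * (2 * \<bar>t\<bar>) \<le> ?h * ?h"
    using le[of 1] le[of "-1"] unfolding t_def[symmetric]
    by (cases "t \<ge> 0") (simp_all add: power2_eq_square)
  then show ?thesis using h by (simp add: t_def)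
qed

section \<open>Assembling the three dimensions and the levels\<close>

definition error_constant :: "real \<Rightarrow> real \<Rightarrow> real" where
  "error_constant c0 \<mu>0 =
     (6 * (2 * pi * exp (2 * pi) + pi / sqrt c0) + 2) / (pi * sqrt \<mu>0) * (1 + sqrt pi / 2 * exp (2 + 1 / c0)) +
       2 / sqrt (pi * \<mu>0) / (1 - exp (- c0))"

definition gather_constant :: "real \<Rightarrow> real \<Rightarrow> real" where
  "gather_constant c0 \<mu>0 = max (1 / sqrt (pi * \<mu>0)) ((7 * (pi / sqrt c0) + 2 * exp 1) / (pi * sqrt \<mu>0))"

definition exact_factor :: "(nat \<Rightarrow> real) \<Rightarrow> solver \<Rightarrow> nat \<Rightarrow> nat \<Rightarrow> 3 \<Rightarrow> nat \<Rightarrow> real" where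
  "exact_factor s V i l d j = exp (- ((pos V i $ d - pos V j $ d)\<^sup>2 / (s l)\<^sup>2)) / sqrt (pi * (s l)\<^sup>2)"

definition modes :: "(nat \<Rightarrow> real) \<Rightarrow> solver \<Rightarrow> nat \<Rightarrow> 3 \<Rightarrow> (nat \<Rightarrow> complex) set" where
  "modes s V l d = gaussian_modes (\<lambda>j. pos V j $ d) {(s l)\<^sup>2, mu s V l d}"

lemma modes_nonempty: "modes s V l d \<noteq> {}"
  using gaussian_mode0[of "(s l)\<^sup>2" "{(s l)\<^sup>2, mu s V l d}" 0 "\<lambda>j. pos V j $ d"]
  by (auto simp: modes_def)

text \<open>Transfers the one-dimensional estimates to the solver. The constants involve only
  \<open>c0\<close> and \<open>\<mu>0\<close>, hence are uniform in particle, level, dimension and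
  solver.\<close>

lemma dimension_superpositions:
  assumes V: "valid_solver s m V" "in_regime c0 \<mu>0 s m V" "window_fits V"
    and c0: "c0 > 0" "\<mu>0 > 0" and s: "\<And>l. s l > 0"
    and i: "i \<in> {1..num V}" and l: "l \<le> m"
  shows "superposition {1..num V} (modes s V l d) (gather_constant c0 \<mu>0)
           (\<lambda>j. complex_of_real (exact_factor s V i l d j))"
    and "superposition {1..num V} (modes s V l d) (gather_constant c0 \<mu>0)
           (\<lambda>j. complex_of_real (gather_factor V i d (mu s V l d) (pos V j $ d)))"
    and "superposition {1..num V} (modes s V l d)
           (error_constant c0 \<mu>0 * (exp (- alias_exponent s V l d) + erfc (sqrt (shape V))))
           (\<lambda>j. complex_of_real (exact_factor s V i l d j - gather_factor V i d (mu s V l d) (pos V j $ d)))"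
proof -
  define M where "M = (npts V d - 1) div 2"
  have v: "mesh V $ d > 0" "halfw V $ d > 0" "odd (npts V d)"
    "real (npts V d) = 2 * halfw V $ d / mesh V $ d + 1" "shape V > 0"
    using V(1) by (auto simp: valid_solver_def)
  have npts: "npts V d = 2 * M + 1" using v(3) by (auto simp: M_def elim!: oddE)
  then have M: "real (npts V d) - 1 = 2 * real M" by simp
  with v have hM: "mesh V $ d * real M = halfw V $ d" by (simp add: field_simps)
  then have M1: "M \<ge> 1" using v(1,2) by (cases M) auto
  \<comment> \<open>In x and y this is \<open>window_fits\<close>; in z the padding guarantees
    it.\<close>
  have L: "periods V $ d \<ge> 2 * halfw V $ d"
  proof -
    have "box V $ 3 > 0" using V(1) by (auto simp: valid_solver_def)
    then show ?thesis using exhaust_3[of d] V(3) Lz_ext_ge[OF V(1)]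
      by (auto simp: periods_def window_fits_def)
  qed
  have alias_eq: "pi\<^sup>2 * mu s V l d * (real M)\<^sup>2 / ((s l)\<^sup>2 * shape V) = alias_exponent s V l d"
    unfolding alias_exponent_def M by (simp add: power_mult_distrib)
  interpret grid_window "shape V" "halfw V $ d" "mesh V $ d" "periods V $ d" "mu s V l d" "s l" c0 \<mu>0
    "pos V i $ d" "gridpt V i $ d" M "{1..num V}" "\<lambda>j. pos V j $ d"
    by unfold_locales
      (use V(2) c0 l v hM M1 L s nearest_grid_point_dist[OF V(1) i] alias_eq in
        \<open>auto simp: in_regime_def mu_def\<close>)
  have exact: "exact j = exact_factor s V i l d j" for j
    by (simp add: exact_def exact_factor_def)
  have gath: "gath j = gather_factor V i d (mu s V l d) (pos V j $ d)" for j
    unfolding gath_def gather_factor_def src_def win_def window_mass_def window_1d_per_def window_1d_def M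
    by simp
  have modes: "\<Phi> = modes s V l d" by (simp add: \<Phi>_def modes_def)
  show "superposition {1..num V} (modes s V l d) (gather_constant c0 \<mu>0)
     (\<lambda>j. complex_of_real (exact_factor s V i l d j))"
    unfolding exact[symmetric] modes[symmetric]
    by (rule superposition_mono[OF superposition_exact _ \<Phi>_nonempty]) (simp add: gather_constant_def)
  show "superposition {1..num V} (modes s V l d) (gather_constant c0 \<mu>0)
     (\<lambda>j. complex_of_real (gather_factor V i d (mu s V l d) (pos V j $ d)))"
    unfolding gath[symmetric] modes[symmetric]
    by (rule superposition_mono[OF superposition_gath _ \<Phi>_nonempty]) (simp add: gather_constant_def)
  show "superposition {1..num V} (modes s V l d)
     (error_constant c0 \<mu>0 * (exp (- alias_exponent s V l d) + erfc (sqrt (shape V))))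
     (\<lambda>j. complex_of_real (exact_factor s V i l d j - gather_factor V i d (mu s V l d) (pos V j $ d)))"
    unfolding gath[symmetric] exact[symmetric] modes[symmetric] alias_eq[symmetric] E_def[symmetric] error_constant_def
    by (rule superposition_mono[OF superposition_error error_bound_le \<Phi>_nonempty])
qed

lemma debye_hueckel_modes:
  assumes DH: "debye_hueckel C s m V" and i: "i \<in> {1..num V}" and l: "l \<le> m"
    and \<phi>: "\<phi>1 \<in> modes s V l 1" "\<phi>2 \<in> modes s V l 2" "\<phi>3 \<in> modes s V l 3"
  shows "cmod (\<Sum>j=1..num V. complex_of_real (charge V j) * (\<phi>1 j * \<phi>2 j * \<phi>3 j)) \<le> C * q_max V"
proof -
  let ?\<phi> = "\<lambda>d k x a j. cis (k * pos V j $ d) * complex_of_real (exp (- ((x - pos V j $ d)\<^sup>2 / a)))"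
  obtain k1 x1 a1 k2 x2 a2 k3 x3 a3 where
    a: "a1 \<in> {(s l)\<^sup>2, mu s V l 1}" "a2 \<in> {(s l)\<^sup>2, mu s V l 2}" "a3 \<in> {(s l)\<^sup>2, mu s V l 3}" and
    e: "\<phi>1 = ?\<phi> 1 k1 x1 a1" "\<phi>2 = ?\<phi> 2 k2 x2 a2" "\<phi>3 = ?\<phi> 3 k3 x3 a3"
    using \<phi> unfolding modes_def gaussian_modes_def by blast
  \<comment> \<open>\<open>debye_hueckel\<close> has phases in \<open>pos V i - pos V j\<close>, so
    the wave vector changes sign; the remaining phase \<open>cis (k \<bullet> pos V i)\<close> has
    modulus one.\<close>
  define k x a :: "real^3" where "k = vector [- k1, - k2, - k3]" and "x = vector [x1, x2, x3]" and "a = vector [a1, a2, a3]"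
  have "\<forall>d. a $ d = (s l)\<^sup>2 \<or> a $ d = mu s V l d"
    using a by (auto simp: a_def forall_3)
  with DH i l have le: "cmod (\<Sum>j=1..num V. complex_of_real (charge V j) * cis (k \<bullet> (pos V i - pos V j)) *
      complex_of_real (\<Prod>d\<in>UNIV. exp (- (x $ d - pos V j $ d)\<^sup>2 / a $ d))) \<le> C * q_max V"
    unfolding debye_hueckel_def by blast
  have eq: "complex_of_real (charge V j) * cis (k \<bullet> (pos V i - pos V j)) *
      complex_of_real (\<Prod>d\<in>UNIV. exp (- (x $ d - pos V j $ d)\<^sup>2 / a $ d)) =
    cis (k \<bullet> pos V i) * (complex_of_real (charge V j) * (\<phi>1 j * \<phi>2 j * \<phi>3 j))" for j
  proof -
    have "k \<bullet> (pos V i - pos V j) = k \<bullet> pos V i + (k1 * pos V j $ 1 + k2 * pos V j $ 2 + k3 * pos V j $ 3)"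
    proof -
      have "k \<bullet> pos V j = - (k1 * pos V j $ 1 + k2 * pos V j $ 2 + k3 * pos V j $ 3)"
        by (simp add: inner_vec_def sum_3 k_def)
      then show ?thesis by (simp add: inner_diff_right)
    qed
    then have c: "cis (k \<bullet> (pos V i - pos V j)) =
       cis (k \<bullet> pos V i) * (cis (k1 * pos V j $ 1) * cis (k2 * pos V j $ 2) * cis (k3 * pos V j $ 3))"
      by (simp add: cis_mult add.assoc)
    show ?thesis unfolding c e prod_three by (simp add: x_def a_def mult_ac)
  qed
  have "cmod (cis (k \<bullet> pos V i) * (\<Sum>j=1..num V. complex_of_real (charge V j) * (\<phi>1 j * \<phi>2 j * \<phi>3 j))) \<le> C * q_max V"
    using le unfolding eq sum_distrib_left .
  then show ?thesis by (simp add: norm_mult)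
qed

lemma gather_level_bound:
  assumes V: "valid_solver s m V" "in_regime c0 \<mu>0 s m V" "window_fits V" "debye_hueckel C s m V"
    and c0: "c0 > 0" "\<mu>0 > 0" and s: "\<And>l. s l > 0"
    and i: "i \<in> {1..num V}" and l: "l \<le> m"
    and \<epsilon>: "\<And>d. error_constant c0 \<mu>0 * (exp (- alias_exponent s V l d) + erfc (sqrt (shape V))) \<le> \<epsilon>"
  shows "cmod (\<Sum>j=1..num V. complex_of_real (charge V j) *
      (complex_of_real (\<Prod>d\<in>UNIV. exact_factor s V i l d j) -
       complex_of_real (\<Prod>d\<in>UNIV. gather_factor V i d (mu s V l d) (pos V j $ d))))
    \<le> 3 * (\<epsilon> * ((gather_constant c0 \<mu>0)\<^sup>2 * (C * q_max V)))"
proof -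
  let ?X = "\<lambda>d j. complex_of_real (exact_factor s V i l d j)"
  let ?T = "\<lambda>d j. complex_of_real (gather_factor V i d (mu s V l d) (pos V j $ d))"
  let ?D = "\<lambda>d j. complex_of_real (exact_factor s V i l d j - gather_factor V i d (mu s V l d) (pos V j $ d))"
  let ?q = "\<lambda>j. complex_of_real (charge V j)" and ?b = "gather_constant c0 \<mu>0" and ?J = "{1..num V}"
  note sup = dimension_superpositions[OF V(1-3) c0 s i l]
  have D: "superposition ?J (modes s V l d) \<epsilon> (?D d)" for d
    by (rule superposition_mono[OF sup(3) \<epsilon> modes_nonempty])
  note DH = debye_hueckel_modes[OF V(4) i l]
  \<comment> \<open>Telescoping of a difference of products: exactly one dimension carries the
    difference \<open>?D\<close>, those before it the gathered factor \<open>?T\<close> and those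
    after it the exact factor \<open>?X\<close>.\<close>
  have "cmod (\<Sum>j\<in>?J. ?q j * (?D 1 j * ?X 2 j * ?X 3 j)) \<le> \<epsilon> * (?b * (?b * (C * q_max V)))"
    by (rule superposition_prod3[OF D sup(1) sup(1) DH])
  moreover have "cmod (\<Sum>j\<in>?J. ?q j * (?T 1 j * ?D 2 j * ?X 3 j)) \<le> ?b * (\<epsilon> * (?b * (C * q_max V)))"
    by (rule superposition_prod3[OF sup(2) D sup(1) DH])
  moreover have "cmod (\<Sum>j\<in>?J. ?q j * (?T 1 j * ?T 2 j * ?D 3 j)) \<le> ?b * (?b * (\<epsilon> * (C * q_max V)))"
    by (rule superposition_prod3[OF sup(2) sup(2) D DH])
  moreover have "(\<Sum>j\<in>?J. ?q j * (complex_of_real (\<Prod>d\<in>UNIV. exact_factor s V i l d j) -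
       complex_of_real (\<Prod>d\<in>UNIV. gather_factor V i d (mu s V l d) (pos V j $ d)))) =
    (\<Sum>j\<in>?J. ?q j * (?D 1 j * ?X 2 j * ?X 3 j)) + (\<Sum>j\<in>?J. ?q j * (?T 1 j * ?D 2 j * ?X 3 j)) +
    (\<Sum>j\<in>?J. ?q j * (?T 1 j * ?T 2 j * ?D 3 j))"
    unfolding sum.distrib[symmetric] prod_three of_real_mult of_real_diff
    by (intro sum.cong refl) (simp add: algebra_simps)
  moreover have "cmod (a + b + c) \<le> cmod a + cmod b + cmod c" for a b c
    by (meson add_mono norm_triangle_ineq order_refl order_trans)
  ultimately have "cmod (\<Sum>j\<in>?J. ?q j * (complex_of_real (\<Prod>d\<in>UNIV. exact_factor s V i l d j) -
       complex_of_real (\<Prod>d\<in>UNIV. gather_factor V i d (mu s V l d) (pos V j $ d)))) \<le>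
     \<epsilon> * (?b * (?b * (C * q_max V))) + ?b * (\<epsilon> * (?b * (C * q_max V))) + ?b * (?b * (\<epsilon> * (C * q_max V)))"
    by (smt (verit, best))
  also have "\<dots> = 3 * (\<epsilon> * (?b\<^sup>2 * (C * q_max V)))" by (simp add: power2_eq_square)
  finally show ?thesis .
qed

lemma E_gath_eq:
  assumes V: "valid_solver s m V" "in_regime c0 \<mu>0 s m V" and c0: "\<mu>0 > 0" and s: "\<And>l. s l > 0"
  shows "E_gath whole_space_op w s m V i = 4 * complex_of_real pi *
    (\<Sum>l\<le>m. complex_of_real (amplitude w s l) * (\<Sum>j=1..num V. complex_of_real (charge V j) *
      (complex_of_real (\<Prod>d\<in>UNIV. exact_factor s V i l d j) -
       complex_of_real (\<Prod>d\<in>UNIV. gather_factor V i d (mu s V l d) (pos V j $ d)))))"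
proof -
  have v: "shape V > 0" "halfw V $ d > 0" for d using V(1) by (auto simp: valid_solver_def)
  have mu: "mu s V l d > 0" if "l \<le> m" for l d
  proof -
    have "\<mu>0 \<le> mu s V l d" using V(2) that by (auto simp: in_regime_def)
    then show ?thesis using c0 by simp
  qed
  have "gather_sum whole_space_op w s m V i = 4 * complex_of_real pi *
    (\<Sum>l\<le>m. complex_of_real (amplitude w s l) * (\<Sum>j=1..num V. complex_of_real (charge V j) *
       complex_of_real (\<Prod>d\<in>UNIV. gather_factor V i d (mu s V l d) (pos V j $ d))))"
    by (rule gather_sum_eq[OF v mu])
  then show ?thesis
    unfolding E_gath_def Phi_mid_eq[OF s] exact_factor_def[symmetric]
    by (simp only: right_diff_distrib sum_subtractf)
qed

lemma error_constant_nonneg: "c0 > 0 \<Longrightarrow> \<mu>0 > 0 \<Longrightarrow> error_constant c0 \<mu>0 \<ge> 0"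
  unfolding error_constant_def by (intro add_nonneg_nonneg mult_nonneg_nonneg divide_nonneg_nonneg) auto

lemma max_norm_le:
  assumes "num V \<ge> 1" "\<And>i. i \<in> {1..num V} \<Longrightarrow> cmod (E i) \<le> B"
  shows "max_norm V E \<le> B"
  unfolding max_norm_def using assms by (subst Max_le_iff) auto

theorem theorem4p4:
  fixes b \<sigma> \<omega> C Q c0 \<mu>0 :: real and s w :: "nat \<Rightarrow> real" and m :: nat
  assumes "b > 1" and "\<sigma> > 0" and "\<omega> > 0"
    and "\<And>l. s l = sqrt 2 * b ^ l * \<sigma>"
    and "\<And>l. l \<ge> 1 \<Longrightarrow> w l = (pi / 2) powr (- 1 / 2) * b powr (- real l) * \<sigma> powr (- 1) * ln b"
    and "w 0 = \<omega> * (pi / 2) powr (- 1 / 2) * \<sigma> powr (- 1) * ln b"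
    and "c0 > 0" and "\<mu>0 > 0"
  shows
    "(\<forall>S H. \<exists>K. \<forall>V.
        valid_solver s m V \<and> in_regime c0 \<mu>0 s m V \<and>
        debye_hueckel C s m V \<and> q_max V = Q \<and> shape V = S \<and> halfw V = H \<longrightarrow>
        max_norm V (E_padd whole_space_op w s m V)
          \<le> K * erfc (padfac V * (box V $ 3 + padlen V) / (2 * sqrt (mu s V m 3)))) \<and>
     (\<exists>K. \<forall>V.
        valid_solver s m V \<and> in_regime c0 \<mu>0 s m V \<and>
        debye_hueckel C s m V \<and> q_max V = Q \<and> window_fits V \<longrightarrow>
        max_norm V (E_gath whole_space_op w s m V)
          \<le> K * ((MAX d\<in>(UNIV :: 3 set). \<Sum>l\<le>m. w l *
                    exp (- (pi\<^sup>2 * mu s V l d * (real (npts V d) - 1)\<^sup>2 / (4 * (s l)\<^sup>2 * shape V))))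
                 + erfc (sqrt (shape V))))"
proof -
  have s: "s l > 0" for l using assms(1-4) by simp
  have w: "w l > 0" for l
    using assms(1-3,5,6) by (cases "l = 0") auto
  define \<gamma> where "\<gamma> = error_constant c0 \<mu>0"
  \<comment> \<open>The factor \<open>1 + 1 / w l\<close> absorbs the weights: one term of the
    weighted sum gives \<open>exp (- alias_exponent s V l d) \<le> X / w l\<close>, with
    \<open>X\<close> the maximum over the dimensions. \<open>K\<close> depends on the solver only
    through the prescribed value \<open>Q\<close> of \<open>q_max\<close>.\<close>
  define K where "K = 4 * pi * (\<Sum>l\<le>m. amplitude w s l *
     (3 * ((\<gamma> * (1 + 1 / w l)) * ((gather_constant c0 \<mu>0)\<^sup>2 * (C * Q)))))"
  have num: "num V \<ge> 1" if "valid_solver s m V" for V using that by (simp add: valid_solver_def)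
  have "max_norm V (E_gath whole_space_op w s m V)
          \<le> K * ((MAX d\<in>(UNIV :: 3 set). \<Sum>l\<le>m. w l *
                    exp (- (pi\<^sup>2 * mu s V l d * (real (npts V d) - 1)\<^sup>2 / (4 * (s l)\<^sup>2 * shape V))))
                 + erfc (sqrt (shape V)))"
    if V: "valid_solver s m V" "in_regime c0 \<mu>0 s m V" "debye_hueckel C s m V" "q_max V = Q" "window_fits V" for V
    unfolding alias_exponent_def[symmetric]
  proof (rule max_norm_le[OF num[OF V(1)]])
    fix i assume i: "i \<in> {1..num V}"
    let ?A = "\<lambda>d. \<Sum>l\<le>m. w l * exp (- alias_exponent s V l d)"
    define e where "e = erfc (sqrt (shape V))"
    define X where "X = (MAX d\<in>(UNIV :: 3 set). ?A d)"
    have X: "?A d \<le> X" for d unfolding X_def by (intro Max_ge) auto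
    have "?A 1 \<ge> 0" using w by (intro sum_nonneg mult_nonneg_nonneg) (auto intro: less_imp_le)
    with X[of 1] have X0: "X \<ge> 0" by simp
    have e0: "e \<ge> 0" unfolding e_def erfc_def set_lebesgue_integral_def
      by (intro mult_nonneg_nonneg Bochner_Integration.integral_nonneg) auto
    have \<gamma>: "\<gamma> \<ge> 0" unfolding \<gamma>_def by (rule error_constant_nonneg[OF assms(7,8)])
    have A: "amplitude w s l \<ge> 0" for l using w[of l] s[of l] by (simp add: amplitude_def)
    have \<epsilon>: "\<gamma> * (exp (- alias_exponent s V l d) + erfc (sqrt (shape V))) \<le> \<gamma> * (1 + 1 / w l) * (X + e)"
      if l: "l \<le> m" for l d
    proof -
      have "w l * exp (- alias_exponent s V l d) \<le> ?A d"
        using l w by (intro member_le_sum) (auto intro: less_imp_le)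
      then have "w l * exp (- alias_exponent s V l d) \<le> X" using X[of d] by simp
      then have "exp (- alias_exponent s V l d) \<le> X / w l" using w[of l] by (simp add: field_simps)
      moreover have "0 \<le> e / w l" using e0 w[of l] by simp
      moreover have "(1 + 1 / w l) * (X + e) = X + e + X / w l + e / w l"
        by (simp add: ring_distribs add_divide_distrib)
      ultimately have "exp (- alias_exponent s V l d) + e \<le> (1 + 1 / w l) * (X + e)" using X0 by linarith
      then show ?thesis unfolding e_def[symmetric] mult.assoc using \<gamma> by (rule mult_left_mono)
    qed
    let ?L = "\<lambda>l. \<Sum>j=1..num V. complex_of_real (charge V j) *
      (complex_of_real (\<Prod>d\<in>UNIV. exact_factor s V i l d j) -
       complex_of_real (\<Prod>d\<in>UNIV. gather_factor V i d (mu s V l d) (pos V j $ d)))"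
    have L: "cmod (?L l) \<le> 3 * ((\<gamma> * (1 + 1 / w l) * (X + e)) * ((gather_constant c0 \<mu>0)\<^sup>2 * (C * Q)))"
      if "l \<le> m" for l
      using gather_level_bound[OF V(1,2,5,3) assms(7,8) s i that] \<epsilon>[OF that] V(4) unfolding \<gamma>_def by blast
    have "cmod (E_gath whole_space_op w s m V i) = 4 * pi * cmod (\<Sum>l\<le>m. complex_of_real (amplitude w s l) * ?L l)"
      unfolding E_gath_eq[OF V(1,2) assms(8) s] by (simp add: norm_mult)
    also have "\<dots> \<le> 4 * pi * (\<Sum>l\<le>m. amplitude w s l *
        (3 * ((\<gamma> * (1 + 1 / w l) * (X + e)) * ((gather_constant c0 \<mu>0)\<^sup>2 * (C * Q)))))"
      using A L by (intro mult_left_mono sum_norm_le) (auto simp: norm_mult intro!: mult_left_mono)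
    also have "\<dots> = K * (X + e)"
      unfolding K_def mult.assoc[of "4 * pi"] sum_distrib_right by (simp only: mult_ac)
    finally show "cmod (E_gath whole_space_op w s m V i) \<le> K * (X + e)" .
  qed
  moreover have "max_norm V (E_padd whole_space_op w s m V) \<le>
      0 * erfc (padfac V * (box V $ 3 + padlen V) / (2 * sqrt (mu s V m 3)))"
    if V: "valid_solver s m V" for V
    using num[OF V] by (rule max_norm_le) (simp add: E_padd_eq_0[OF V])
  ultimately show ?thesis by blast
qed

end
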